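(* Let $R$ be an integral domain, $\mathbf{u}=(u_1,\dots,u_\ell)\in R^\ell$, and let $H_{\ell,n}=H_{\ell,n}^R(\mathbf{u})$ be the degenerate cyclotomic Hecke algebra, with descending map $\epsilon_n:H_{\ell,n}\to H_{\ell,n-1}$ and Murphy basis $\{m_{\mathfrak{s}\mathfrak{t}}\}$. Let $\boldsymbol{\lambda}\in\mathscr{P}_{\ell,n}$ and $\mathfrak{s},\mathfrak{t}\in\mathrm{Std}(\boldsymbol{\lambda})$. Then $$\epsilon_n(m_{\mathfrak{s}\mathfrak{t}})=\begin{cases} m_{\mathfrak{s}_{\downarrow\le(n-1)}\mathfrak{t}_{\downarrow\le(n-1)}}, & \text{if } n(\mathfrak{s})=n(\mathfrak{t})\text{ and } l(\mathfrak{t},n)=1,\\ 0,&\text{otherwise.}\end{cases}$$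
   Context: Algebra. Let $\ell,n\ge1$. For $k\ge1$, $H_{\ell,k}$ is the unital associative $R$-algebra with generators $s_1,\dots,s_{k-1},L_1,\dots,L_k$ and relations: $(L_1-u_1)\cdots(L_1-u_\ell)=0$; $s_i^2=1$; $s_is_j=s_js_i$ for $1\le i<j-1<k-1$; $s_is_{i+1}s_i=s_{i+1}s_is_{i+1}$ for $1\le i<k-1$; $L_iL_j=L_jL_i$; $s_iL_l=L_ls_i$ for $l\ne i,i+1$; $L_{i+1}=s_iL_is_i+s_i$ for $1\le i<k$. $H_{\ell,0}=R$, and $H_{\ell,k-1}$ is regarded as the subalgebra of $H_{\ell,k}$ generated by $s_1,\dots,s_{k-2},L_1,\dots,L_{k-1}$. $\mathfrak{S}_n$ is the symmetric group with $\sigma_i=(i,i+1)$, acting from the right on $\{1,\dots,n\}$ (in a product the left factor is applied first); $w\in\mathfrak{S}_n$ is regarded as an element of $H_{\ell,n}$ via $\sigma_i\mapsto s_i$. $*$ is the $R$-algebra anti-automorphism fixing all $s_i$ and $L_j$. Descending map. For $k\ge1$, as $(H_{\ell,k-1},H_{\ell,k-1})$-bimodules, $H_{\ell,k}=H_{\ell,k-1}s_{k-1}H_{\ell,k-1}\oplus\bigoplus_{j=0}^{\ell-1}H_{\ell,k-1}L_k^j$ (for $k=1$ the first summand is absent), where each $H_{\ell,k-1}\to H_{\ell,k-1}L_k^j$, $c\mapsto cL_k^j$, is an isomorphism. So each $h\in H_{\ell,k}$ is uniquely $h=h'+\sum_{j=0}^{\ell-1}\mathrm{p}^{(k)}_j(h)L_k^j$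 with $h'\in H_{\ell,k-1}s_{k-1}H_{\ell,k-1}$, $\mathrm{p}_j^{(k)}(h)\in H_{\ell,k-1}$. Define $\epsilon_k(h)=\mathrm{p}^{(k)}_{\ell-1}(h)$. Combinatorics. $\mathscr{P}_{\ell,n}$ is the set of $\ell$-partitions $\boldsymbol{\lambda}=(\lambda^{(1)},\dots,\lambda^{(\ell)})$ of $n$; $[\boldsymbol{\lambda}]=\{(r,c,l)\mid 1\le l\le\ell,\ r\ge1,\ 1\le c\le\lambda^{(l)}_r\}$. A $\boldsymbol{\lambda}$-tableau is a bijection $\mathfrak{t}:[\boldsymbol{\lambda}]\to\{1,\dots,n\}$; it is standard if in every component entries increase along rows and down columns; $\mathrm{Std}(\boldsymbol{\lambda})$ is the set of these. $\mathfrak{t}^{\boldsymbol{\lambda}}$ has $1,\dots,n$ entered in order along successive rows of $\lambda^{(1)}$, then $\lambda^{(2)}$, etc. $d(\mathfrak{t})\in\mathfrak{S}_n$ is the unique element with $\mathfrak{t}=\mathfrak{t}^{\boldsymbol{\lambda}}d(\mathfrak{t})$ (right action on entries). $\mathfrak{t}_{\downarrow\le k}$ is the subtableau of $\mathfrak{t}$ with entries $1,\dots,k$. $n(\mathfrak{t})$ is the unique integer in $\{1,\dots,n\}$ with $\mathfrak{t}^{-1}(n)=(\mathfrak{t}^{\boldsymbol{\lambda}})^{-1}(n(\mathfrak{t}))$. $l(\mathfrak{t},n)$ is the component containing $n$: $\mathfrak{t}^{-1}(n)=(r(\mathfrak{t},n),c(\mathfrak{t},n),l(\mathfrak{t},n))$.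 If $n(\mathfrak{s})=n(\mathfrak{t})$ then $\mathfrak{s}_{\downarrow\le(n-1)}$ and $\mathfrak{t}_{\downarrow\le(n-1)}$ have the same shape. Murphy basis (for every $n$; $m=1$ for $n=0$). $\mathfrak{S}_{\boldsymbol{\lambda}}\le\mathfrak{S}_n$ is the Young subgroup of the composition listing all nonzero row lengths of $\lambda^{(1)}$, then $\lambda^{(2)}$, etc. (the row stabilizer of $\mathfrak{t}^{\boldsymbol{\lambda}}$). Put $\mathfrak{a}_s=|\lambda^{(1)}|+\cdots+|\lambda^{(s-1)}|$, $\mathrm{x}_{\boldsymbol{\lambda}}=\sum_{w\in\mathfrak{S}_{\boldsymbol{\lambda}}}w$, $u^+_{\boldsymbol{\lambda}}=\prod_{s=2}^{\ell}\prod_{k=1}^{\mathfrak{a}_s}(L_k-u_s)$, $m_{\boldsymbol{\lambda}}=\mathrm{x}_{\boldsymbol{\lambda}}u^+_{\boldsymbol{\lambda}}$, $m_{\mathfrak{s}\mathfrak{t}}=d(\mathfrak{s})^*m_{\boldsymbol{\lambda}}d(\mathfrak{t})$. *)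

theory Defs
  imports "HOL-Algebra.Algebra" "HOL-Algebra.Algebraic_Closure_Type"
    "HOL-Library.Poly_Mapping" "HOL-Combinatorics.Permutations"
begin

section \<open>The free unital algebra on the generators $s_i$, $L_i$\<close>

datatype gen = SGen nat | LGen nat

datatype word = Word (letters: "gen list")

instantiation word :: monoid_add
begin

definition zero_word :: word where
  "0 = Word []"

definition plus_word :: "word \<Rightarrow> word \<Rightarrow> word" where
  "v + w = Word (letters v @ letters w)"

instance
  by standard (simp_all add: zero_word_def plus_word_def)

end

text \<open>Since words form a monoid under concatenation, \<^typ>\<open>word \<Rightarrow>\<^sub>0 'r\<close> with its
  convolution product is the free associative algebra over \<^typ>\<open>'r\<close>.\<close>

definition const :: "'r \<Rightarrow> word \<Rightarrow>\<^sub>0 'r::comm_ring_1" where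
  "const c = Poly_Mapping.single 0 c"

definition s_free :: "nat \<Rightarrow> word \<Rightarrow>\<^sub>0 'r::comm_ring_1" where
  "s_free i = Poly_Mapping.single (Word [SGen i]) 1"

definition L_free :: "nat \<Rightarrow> word \<Rightarrow>\<^sub>0 'r::comm_ring_1" where
  "L_free i = Poly_Mapping.single (Word [LGen i]) 1"

definition gens :: "nat \<Rightarrow> gen set" where
  "gens k = SGen ` {i. 1 \<le> i \<and> i < k} \<union> LGen ` {1..k}"

definition free_alg :: "nat \<Rightarrow> (word \<Rightarrow>\<^sub>0 'r::comm_ring_1) ring" where
  "free_alg k = ring_of_type_algebra
     \<lparr>carrier := {f. \<forall>w \<in> Poly_Mapping.keys f. set (letters w) \<subseteq> gens k}\<rparr>"

section \<open>The degenerate cyclotomic Hecke algebra\<close>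

text \<open>The parameters $u_1,\dots,u_\ell$ are the values \<^term>\<open>u 1\<close>, \dots, \<^term>\<open>u l\<close>; other values
  of \<^term>\<open>u\<close> are irrelevant. The cyclotomic relation is present only for $k \ge 1$, so that the
  algebra for $k = 0$ is $R$.\<close>

definition relators :: "nat \<Rightarrow> (nat \<Rightarrow> 'r) \<Rightarrow> nat \<Rightarrow> (word \<Rightarrow>\<^sub>0 'r::comm_ring_1) set" where
  "relators l u k =
     (if 1 \<le> k then {prod_list (map (\<lambda>j. L_free 1 - const (u j)) [1..<Suc l])} else {})
   \<union> {s_free i * s_free i - 1 | i. 1 \<le> i \<and> i < k}
   \<union> {s_free i * s_free j - s_free j * s_free i | i j. 1 \<le> i \<and> i + 1 < j \<and> j < k}
   \<union> {s_free i * s_free (i + 1) * s_free i - s_free (i + 1) * s_free i * s_free (i + 1)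
        | i. 1 \<le> i \<and> i + 1 < k}
   \<union> {L_free i * L_free j - L_free j * L_free i | i j. 1 \<le> i \<and> i \<le> k \<and> 1 \<le> j \<and> j \<le> k}
   \<union> {s_free i * L_free j - L_free j * s_free i
        | i j. 1 \<le> i \<and> i < k \<and> 1 \<le> j \<and> j \<le> k \<and> j \<noteq> i \<and> j \<noteq> i + 1}
   \<union> {L_free (i + 1) - (s_free i * L_free i * s_free i + s_free i) | i. 1 \<le> i \<and> i < k}"

definition rel_ideal :: "nat \<Rightarrow> (nat \<Rightarrow> 'r) \<Rightarrow> nat \<Rightarrow> (word \<Rightarrow>\<^sub>0 'r::comm_ring_1) set" where
  "rel_ideal l u k = genideal (free_alg k) (relators l u k)"

definition hecke :: "nat \<Rightarrow> (nat \<Rightarrow> 'r) \<Rightarrow> nat \<Rightarrow> (word \<Rightarrow>\<^sub>0 'r::comm_ring_1) set ring" where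
  "hecke l u k = free_alg k Quot rel_ideal l u k"

definition proj :: "nat \<Rightarrow> (nat \<Rightarrow> 'r) \<Rightarrow> nat \<Rightarrow> (word \<Rightarrow>\<^sub>0 'r) \<Rightarrow> (word \<Rightarrow>\<^sub>0 'r::comm_ring_1) set" where
  "proj l u k x = rel_ideal l u k +>\<^bsub>free_alg k\<^esub> x"

definition hs :: "nat \<Rightarrow> (nat \<Rightarrow> 'r) \<Rightarrow> nat \<Rightarrow> nat \<Rightarrow> (word \<Rightarrow>\<^sub>0 'r::comm_ring_1) set" where
  "hs l u k i = proj l u k (s_free i)"

definition hL :: "nat \<Rightarrow> (nat \<Rightarrow> 'r) \<Rightarrow> nat \<Rightarrow> nat \<Rightarrow> (word \<Rightarrow>\<^sub>0 'r::comm_ring_1) set" where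
  "hL l u k i = proj l u k (L_free i)"

text \<open>The identification of $H_{\ell,k-1}$ with a subalgebra of $H_{\ell,k}$ is made explicit:
  \<open>incl l u k\<close> is the homomorphism from \<^term>\<open>hecke l u (k - 1)\<close> to \<^term>\<open>hecke l u k\<close> that sends
  generators to the generators of the same name. It sends the coset $I_{k-1} + x$ to
  $I_k + (I_{k-1} + x) = I_k + x$, because $I_{k-1} \subseteq I_k$.\<close>

definition incl :: "nat \<Rightarrow> (nat \<Rightarrow> 'r) \<Rightarrow> nat \<Rightarrow> (word \<Rightarrow>\<^sub>0 'r) set \<Rightarrow> (word \<Rightarrow>\<^sub>0 'r::comm_ring_1) set" where
  "incl l u k A = rel_ideal l u k <+>\<^bsub>free_alg k\<^esub> A"

text \<open>Reversal of words is the anti-automorphism of the free algebra fixing the generators. It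
  preserves the ideal of relations, so taking the image of a coset under it is the
  anti-automorphism $*$ of the quotient. As reversal is an involution, pulling coefficients back
  along it (\<^const>\<open>Poly_Mapping.map_key\<close>) is the same as pushing them forward.\<close>

definition rev_word :: "word \<Rightarrow> word" where
  "rev_word w = Word (rev (letters w))"

definition star :: "(word \<Rightarrow>\<^sub>0 'r) set \<Rightarrow> (word \<Rightarrow>\<^sub>0 'r::comm_ring_1) set" where
  "star A = Poly_Mapping.map_key rev_word ` A"

text \<open>Noncommutative product, in the order of the list.\<close>

definition list_mult :: "('a, 'b) monoid_scheme \<Rightarrow> 'a list \<Rightarrow> 'a" where
  "list_mult G xs = foldr (\<lambda>x y. x \<otimes>\<^bsub>G\<^esub> y) xs \<one>\<^bsub>G\<^esub>"

text \<open>\<open>word_perm [i1, \<dots>, ir]\<close> is the product of $\sigma_{i_1}, \dots, \sigma_{i_r}$ for the right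
  action: the leftmost factor is applied first.\<close>

fun word_perm :: "nat list \<Rightarrow> nat \<Rightarrow> nat" where
  "word_perm [] = id"
| "word_perm (i # is) = word_perm is \<circ> Transposition.transpose i (Suc i)"

text \<open>The image of $w \in S_k$ under $\sigma_i \mapsto s_i$. By the Coxeter relations the value does
  not depend on the expression of $w$ as a product of the $\sigma_i$.\<close>

definition perm_elem :: "nat \<Rightarrow> (nat \<Rightarrow> 'r) \<Rightarrow> nat \<Rightarrow> (nat \<Rightarrow> nat) \<Rightarrow> (word \<Rightarrow>\<^sub>0 'r::comm_ring_1) set" where
  "perm_elem l u k w = (THE A. \<exists>is. set is \<subseteq> {i. 1 \<le> i \<and> i < k} \<and> word_perm is = w \<and>
      A = list_mult (hecke l u k) (map (hs l u k) is))"

section \<open>The descending map\<close>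

text \<open>The sub-bimodule $H_{\ell,k-1} s_{k-1} H_{\ell,k-1}$, i.e. all sums of products $a s_{k-1} b$;
  it is $0$ for $k = 1$.\<close>

definition HsH :: "nat \<Rightarrow> (nat \<Rightarrow> 'r) \<Rightarrow> nat \<Rightarrow> (word \<Rightarrow>\<^sub>0 'r::comm_ring_1) set set" where
  "HsH l u k = generate (add_monoid (hecke l u k))
     {incl l u k a \<otimes>\<^bsub>hecke l u k\<^esub> hs l u k (k - 1) \<otimes>\<^bsub>hecke l u k\<^esub> incl l u k b
       | a b. 2 \<le> k \<and> a \<in> carrier (hecke l u (k - 1)) \<and> b \<in> carrier (hecke l u (k - 1))}"

definition p_coeff ::
    "nat \<Rightarrow> (nat \<Rightarrow> 'r) \<Rightarrow> nat \<Rightarrow> nat \<Rightarrow> (word \<Rightarrow>\<^sub>0 'r) set \<Rightarrow> (word \<Rightarrow>\<^sub>0 'r::comm_ring_1) set" where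
  "p_coeff l u k j h = (THE c. \<exists>h' p. h' \<in> HsH l u k \<and>
      (\<forall>i < l. p i \<in> carrier (hecke l u (k - 1))) \<and>
      h = h' \<oplus>\<^bsub>hecke l u k\<^esub> (\<Oplus>\<^bsub>hecke l u k\<^esub>i \<in> {..<l}.
              incl l u k (p i) \<otimes>\<^bsub>hecke l u k\<^esub> hL l u k k [^]\<^bsub>hecke l u k\<^esub> (i::nat)) \<and>
      c = p j)"

definition descend :: "nat \<Rightarrow> (nat \<Rightarrow> 'r) \<Rightarrow> nat \<Rightarrow> (word \<Rightarrow>\<^sub>0 'r) set \<Rightarrow> (word \<Rightarrow>\<^sub>0 'r::comm_ring_1) set" where
  "descend l u k h = p_coeff l u k (l - 1) h"

section \<open>Multipartitions and tableaux\<close>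

text \<open>Rows and components are indexed from 1: \<open>lam j r\<close> is the length of row \<open>r\<close> of the
  component $\lambda^{(j)}$, and nodes are triples (row, column, component).\<close>

definition is_partition :: "(nat \<Rightarrow> nat) \<Rightarrow> bool" where
  "is_partition p \<longleftrightarrow> p 0 = 0 \<and> (\<forall>r \<ge> 1. p (Suc r) \<le> p r) \<and> finite {r. p r \<noteq> 0}"

definition psize :: "(nat \<Rightarrow> nat) \<Rightarrow> nat" where
  "psize p = (\<Sum>r | p r \<noteq> 0. p r)"

definition multipartitions :: "nat \<Rightarrow> nat \<Rightarrow> (nat \<Rightarrow> nat \<Rightarrow> nat) set" where
  "multipartitions l n = {lam. (\<forall>j \<in> {1..l}. is_partition (lam j)) \<and>
      (\<forall>j. j \<notin> {1..l} \<longrightarrow> lam j = (\<lambda>_. 0)) \<and> (\<Sum>j = 1..l. psize (lam j)) = n}"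

type_synonym node = "nat \<times> nat \<times> nat"

definition diagram :: "nat \<Rightarrow> (nat \<Rightarrow> nat \<Rightarrow> nat) \<Rightarrow> node set" where
  "diagram l lam = {(r, c, j). 1 \<le> j \<and> j \<le> l \<and> 1 \<le> r \<and> 1 \<le> c \<and> c \<le> lam j r}"

text \<open>Tableaux are \<^const>\<open>undefined\<close> outside their diagram.\<close>

definition tableaux :: "nat \<Rightarrow> nat \<Rightarrow> (nat \<Rightarrow> nat \<Rightarrow> nat) \<Rightarrow> (node \<Rightarrow> nat) set" where
  "tableaux l n lam = {t \<in> extensional (diagram l lam). bij_betw t (diagram l lam) {1..n}}"

definition Std :: "nat \<Rightarrow> nat \<Rightarrow> (nat \<Rightarrow> nat \<Rightarrow> nat) \<Rightarrow> (node \<Rightarrow> nat) set" where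
  "Std l n lam = {t \<in> tableaux l n lam.
      (\<forall>r c c' j. (r, c, j) \<in> diagram l lam \<and> (r, c', j) \<in> diagram l lam \<and> c < c'
          \<longrightarrow> t (r, c, j) < t (r, c', j)) \<and>
      (\<forall>r r' c j. (r, c, j) \<in> diagram l lam \<and> (r', c, j) \<in> diagram l lam \<and> r < r'
          \<longrightarrow> t (r, c, j) < t (r', c, j))}"

definition partial_size :: "(nat \<Rightarrow> nat \<Rightarrow> nat) \<Rightarrow> nat \<Rightarrow> nat" where
  "partial_size lam j = (\<Sum>i = 1..<j. psize (lam i))"

definition initial_tab :: "nat \<Rightarrow> (nat \<Rightarrow> nat \<Rightarrow> nat) \<Rightarrow> node \<Rightarrow> nat" where
  "initial_tab l lam = restrict (\<lambda>(r, c, j). partial_size lam j + (\<Sum>i = 1..<r. lam j i) + c)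
     (diagram l lam)"

definition tab_perm :: "nat \<Rightarrow> nat \<Rightarrow> (nat \<Rightarrow> nat \<Rightarrow> nat) \<Rightarrow> (node \<Rightarrow> nat) \<Rightarrow> nat \<Rightarrow> nat" where
  "tab_perm l n lam t = (THE w. w permutes {1..n} \<and>
      (\<forall>x \<in> diagram l lam. t x = w (initial_tab l lam x)))"

definition node_of :: "nat \<Rightarrow> (nat \<Rightarrow> nat \<Rightarrow> nat) \<Rightarrow> (node \<Rightarrow> nat) \<Rightarrow> nat \<Rightarrow> node" where
  "node_of l lam t v = inv_into (diagram l lam) t v"

definition n_of :: "nat \<Rightarrow> nat \<Rightarrow> (nat \<Rightarrow> nat \<Rightarrow> nat) \<Rightarrow> (node \<Rightarrow> nat) \<Rightarrow> nat" where
  "n_of l n lam t = (THE m. m \<in> {1..n} \<and> node_of l lam t n = node_of l lam (initial_tab l lam) m)"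

definition comp_of :: "nat \<Rightarrow> (nat \<Rightarrow> nat \<Rightarrow> nat) \<Rightarrow> (node \<Rightarrow> nat) \<Rightarrow> nat \<Rightarrow> nat" where
  "comp_of l lam t v = (case node_of l lam t v of (r, c, j) \<Rightarrow> j)"

definition sub_nodes :: "nat \<Rightarrow> (nat \<Rightarrow> nat \<Rightarrow> nat) \<Rightarrow> (node \<Rightarrow> nat) \<Rightarrow> nat \<Rightarrow> node set" where
  "sub_nodes l lam t k = {x \<in> diagram l lam. t x \<le> k}"

definition sub_tab :: "nat \<Rightarrow> (nat \<Rightarrow> nat \<Rightarrow> nat) \<Rightarrow> (node \<Rightarrow> nat) \<Rightarrow> nat \<Rightarrow> node \<Rightarrow> nat" where
  "sub_tab l lam t k = restrict t (sub_nodes l lam t k)"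

definition sub_shape :: "nat \<Rightarrow> (nat \<Rightarrow> nat \<Rightarrow> nat) \<Rightarrow> (node \<Rightarrow> nat) \<Rightarrow> nat \<Rightarrow> nat \<Rightarrow> nat \<Rightarrow> nat" where
  "sub_shape l lam t k j r = card {c. (r, c, j) \<in> sub_nodes l lam t k}"

section \<open>The Murphy basis\<close>

definition young_subgroup :: "nat \<Rightarrow> nat \<Rightarrow> (nat \<Rightarrow> nat \<Rightarrow> nat) \<Rightarrow> (nat \<Rightarrow> nat) set" where
  "young_subgroup l n lam = {w. w permutes {1..n} \<and>
      (\<forall>r c j. (r, c, j) \<in> diagram l lam \<longrightarrow> (\<exists>c'. (r, c', j) \<in> diagram l lam \<and>
         w (initial_tab l lam (r, c, j)) = initial_tab l lam (r, c', j)))}"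

definition x_elem :: "nat \<Rightarrow> (nat \<Rightarrow> 'r) \<Rightarrow> nat \<Rightarrow> (nat \<Rightarrow> nat \<Rightarrow> nat) \<Rightarrow> (word \<Rightarrow>\<^sub>0 'r::comm_ring_1) set" where
  "x_elem l u n lam = (\<Oplus>\<^bsub>hecke l u n\<^esub>w \<in> young_subgroup l n lam. perm_elem l u n w)"

definition u_plus :: "nat \<Rightarrow> (nat \<Rightarrow> 'r) \<Rightarrow> nat \<Rightarrow> (nat \<Rightarrow> nat \<Rightarrow> nat) \<Rightarrow> (word \<Rightarrow>\<^sub>0 'r::comm_ring_1) set" where
  "u_plus l u n lam = list_mult (hecke l u n)
     [hL l u n k \<ominus>\<^bsub>hecke l u n\<^esub> proj l u n (const (u s)).
        s \<leftarrow> [2..<Suc l], k \<leftarrow> [1..<Suc (partial_size lam s)]]"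

definition m_shape :: "nat \<Rightarrow> (nat \<Rightarrow> 'r) \<Rightarrow> nat \<Rightarrow> (nat \<Rightarrow> nat \<Rightarrow> nat) \<Rightarrow> (word \<Rightarrow>\<^sub>0 'r::comm_ring_1) set" where
  "m_shape l u n lam = x_elem l u n lam \<otimes>\<^bsub>hecke l u n\<^esub> u_plus l u n lam"

text \<open>For \<open>n = 0\<close> all factors are empty, so this is the unit.\<close>

definition murphy :: "nat \<Rightarrow> (nat \<Rightarrow> 'r) \<Rightarrow> nat \<Rightarrow> (nat \<Rightarrow> nat \<Rightarrow> nat) \<Rightarrow> (node \<Rightarrow> nat) \<Rightarrow> (node \<Rightarrow> nat)
    \<Rightarrow> (word \<Rightarrow>\<^sub>0 'r::comm_ring_1) set" where
  "murphy l u n lam s t =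
     star (perm_elem l u n (tab_perm l n lam s)) \<otimes>\<^bsub>hecke l u n\<^esub> m_shape l u n lam
       \<otimes>\<^bsub>hecke l u n\<^esub> perm_elem l u n (tab_perm l n lam t)"

end

theory Submission
  imports Defs "HOL-Library.Function_Algebras"
begin

text \<open>That the coefficient $\mathrm{p}_{\ell-1}$ is unique is the point of substance in the definition
  of $\epsilon_n$. Write $A = H_{\ell,n-1}$ and $f(z) = (z-u_1)\cdots(z-u_\ell)$. The elements
  $s_i \cdots s_1\, p(L_1)\, s_1 \cdots s_{n-1}$ with $0 \le i < n$ and $p \in A[z]/(f)$ ought to
  make up $H_{\ell,n}$, and left multiplication by $s_m$ and by $L_1$ is given on them by simple formulas.
  These formulas define an action of $H_{\ell,n}$ on $(A[z]/(f))^n$, and the coefficient of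
  $z^{\ell-1}$ in the last position of $h \cdot (0, \dots, 0, 1)$ is a functional of $h$ that vanishes on
  $A s_{n-1} A$ and on $A L_n^j$ for $j < \ell-1$ and maps $c L_n^{\ell-1}$ to $c$.

  For the value of $\epsilon_n$, put $m = n(\mathfrak{t})$, so that $d(\mathfrak{t}) = z\, d(\mathfrak{t}')$
  with $z = s_m \cdots s_{n-1}$ and $\mathfrak{t}' = \mathfrak{t}_{\downarrow\le(n-1)}$. Up to terms of lower
  degree in $L_n$, moving a factor $\prod_{k \le a}(L_k - u_s)$ of $u^+$ to the right across $z$
  turns it into $\prod_{k < a}(L_k - u_s) \cdot (L_n - u_s)$ if $a \ge m$, whereas it commutes with $z$ if
  $a < m$. So degree $\ell - 1$ is reached only if $\mathfrak{a}_s \ge m$ for all $s \ge 2$, that is, if $n$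
  lies in the first component. The leading coefficient then comes from those $w$ in the row stabilizer with
  $d(\mathfrak{s})^{-1} w z \in \mathfrak{S}_{n-1}$. This forces $n(\mathfrak{s}) = m$ and $w$ to fix $m$,
  and conjugation by $z$ maps these $w$ onto the row stabilizer of the smaller shape.\<close>

text \<open>\<open>descend\<close> is a definite description, so it has a known value only where a
  decomposition exists and its top coefficient is unique; the module supplies the uniqueness. Its
  input is the relations of A alone: f(L_1) = 0 in A makes substitution of L_1 for z well defined on
  A[z]/(f), and L_1 L_2 = L_2 L_1 in A is what lets the operators of L_1 and L_2 commute. Expanding
  in the products (z - u_1)...(z - u_j) instead of powers of z keeps the leading coefficient and
  makes multiplication by z free of the coefficients of f. For the value, the obstacle is that terms
  of lower degree arise to the right of arbitrary permutations d(s)^{-1} w, whereas A s_{n-1} A +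
  sum_{j<d} A L_n^j is visibly stable only under left multiplication by A. A second filtration, by
  the spans of v a L_n^j with v in S_n and a in A, is stable under S_n and lies in the first one;
  the error terms are estimated there. That w fixes m comes from n(s) and n(t) both being ends of
  rows: a row-preserving w that carries one to the other keeps the row.\<close>

section \<open>The free algebra, its evaluations, and the quotient by the relations\<close>

lemma poly_mapping_expand:
  "x = (\<Sum>w\<in>Poly_Mapping.keys x. Poly_Mapping.single w (Poly_Mapping.lookup x w))"
proof (rule poly_mapping_eqI)
  fix k
  have "(\<Sum>w\<in>Poly_Mapping.keys x. Poly_Mapping.lookup (Poly_Mapping.single w (Poly_Mapping.lookup x w)) k)
      = (\<Sum>w\<in>Poly_Mapping.keys x. if w = k then Poly_Mapping.lookup x k else 0)"
    by (rule sum.cong) (auto simp: lookup_single when_def)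
  also have "\<dots> = Poly_Mapping.lookup x k"
    by (simp add: in_keys_iff)
  finally show "Poly_Mapping.lookup x k = Poly_Mapping.lookup
      (\<Sum>w\<in>Poly_Mapping.keys x. Poly_Mapping.single w (Poly_Mapping.lookup x w)) k"
    by (simp add: lookup_sum)
qed

lemma const_0 [simp]: "const 0 = 0"
  and const_1 [simp]: "const 1 = 1"
  and const_add: "const (a + b) = const a + const b"
  and const_mult: "const (a * b) = const a * const b"
  and const_uminus: "const (- a) = - const a"
  by (simp_all add: const_def single_add mult_single single_uminus)

lemma const_central: "const a * x = x * const a"
proof -
  have "const a * Poly_Mapping.single w b = Poly_Mapping.single w b * const a" for w b
    by (simp add: const_def mult_single mult.commute)
  then have "const a * (\<Sum>w\<in>Poly_Mapping.keys x. Poly_Mapping.single w (Poly_Mapping.lookup x w))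
    = (\<Sum>w\<in>Poly_Mapping.keys x. Poly_Mapping.single w (Poly_Mapping.lookup x w)) * const a"
    by (simp add: sum_distrib_left sum_distrib_right)
  then show ?thesis using poly_mapping_expand[of x] by simp
qed

definition gen_elem :: "gen \<Rightarrow> word \<Rightarrow>\<^sub>0 'r::comm_ring_1" where
  "gen_elem g = Poly_Mapping.single (Word [g]) 1"

lemma s_free_gen: "s_free i = gen_elem (SGen i)" and L_free_gen: "L_free i = gen_elem (LGen i)"
  by (simp_all add: s_free_def L_free_def gen_elem_def)

lemma single_word:
  "Poly_Mapping.single w a = const a * prod_list (map gen_elem (letters w))"
proof -
  have "Poly_Mapping.single (Word gs) (1::'a) = prod_list (map gen_elem gs)" for gs
  proof (induction gs)
    case Nil
    then show ?case by (simp add: zero_word_def[symmetric])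
  next
    case (Cons g gs)
    have "Poly_Mapping.single (Word (g # gs)) (1::'a) = gen_elem g * Poly_Mapping.single (Word gs) 1"
      by (simp add: gen_elem_def mult_single plus_word_def)
    then show ?case using Cons by simp
  qed
  from this[of "letters w"] have "const a * prod_list (map gen_elem (letters w)) = Poly_Mapping.single w a"
    by (simp add: const_def mult_single flip: \<open>\<And>gs. _ gs = _\<close>)
  then show ?thesis by simp
qed

section \<open>The free algebra\<close>

lemma free_alg_simps [simp]:
  "x \<otimes>\<^bsub>free_alg k\<^esub> y = x * y" "x \<oplus>\<^bsub>free_alg k\<^esub> y = x + y"
  "\<one>\<^bsub>free_alg k\<^esub> = 1" "\<zero>\<^bsub>free_alg k\<^esub> = 0"
  by (simp_all add: free_alg_def ring_of_type_algebra_def)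

lemma free_alg_carrier:
  "x \<in> carrier (free_alg k) \<longleftrightarrow> (\<forall>w \<in> Poly_Mapping.keys x. set (letters w) \<subseteq> gens k)"
  by (simp add: free_alg_def)

lemma free_alg_closed [simp]:
  fixes x y :: "word \<Rightarrow>\<^sub>0 'r::comm_ring_1"
  shows "0 \<in> carrier (free_alg k)" "1 \<in> carrier (free_alg k)"
  "x \<in> carrier (free_alg k) \<Longrightarrow> y \<in> carrier (free_alg k) \<Longrightarrow> x + y \<in> carrier (free_alg k)"
  "x \<in> carrier (free_alg k) \<Longrightarrow> y \<in> carrier (free_alg k) \<Longrightarrow> x - y \<in> carrier (free_alg k)"
  "x \<in> carrier (free_alg k) \<Longrightarrow> y \<in> carrier (free_alg k) \<Longrightarrow> x * y \<in> carrier (free_alg k)"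
  "x \<in> carrier (free_alg k) \<Longrightarrow> - x \<in> carrier (free_alg k)"
  "const a \<in> carrier (free_alg k)"
  "1 \<le> i \<Longrightarrow> i < k \<Longrightarrow> s_free i \<in> carrier (free_alg k)"
  "1 \<le> i \<Longrightarrow> i \<le> k \<Longrightarrow> L_free i \<in> carrier (free_alg k)"
proof -
  have *: "x \<in> carrier (free_alg k) \<Longrightarrow> y \<in> carrier (free_alg k) \<Longrightarrow> x + y \<in> carrier (free_alg k)"
    for x y :: "word \<Rightarrow>\<^sub>0 'r"
    using keys_add[of x y] by (auto simp: free_alg_carrier)
  have **: "x \<in> carrier (free_alg k) \<Longrightarrow> - x \<in> carrier (free_alg k)" for x :: "word \<Rightarrow>\<^sub>0 'r"
    by (auto simp: free_alg_carrier in_keys_iff)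
  show "x \<in> carrier (free_alg k) \<Longrightarrow> y \<in> carrier (free_alg k) \<Longrightarrow> x + y \<in> carrier (free_alg k)"
    by (rule *)
  show "x \<in> carrier (free_alg k) \<Longrightarrow> - x \<in> carrier (free_alg k)" by (rule **)
  show "x \<in> carrier (free_alg k) \<Longrightarrow> y \<in> carrier (free_alg k) \<Longrightarrow> x - y \<in> carrier (free_alg k)"
    using *[of x "- y"] **[of y] by simp
  show "x \<in> carrier (free_alg k) \<Longrightarrow> y \<in> carrier (free_alg k) \<Longrightarrow> x * y \<in> carrier (free_alg k)"
    using keys_mult[of x y] by (fastforce simp: free_alg_carrier plus_word_def)
qed (auto simp: free_alg_carrier const_def in_keys_iff lookup_single when_def lookup_one s_free_def L_free_def gens_def zero_word_def single_one[symmetric]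
      simp del: single_one)

lemma ring_free_alg: "ring (free_alg k :: (word \<Rightarrow>\<^sub>0 'r::comm_ring_1) ring)"
proof (rule ringI)
  show "abelian_group (free_alg k :: (word \<Rightarrow>\<^sub>0 'r) ring)"
  proof (rule abelian_groupI)
    fix x :: "word \<Rightarrow>\<^sub>0 'r" assume "x \<in> carrier (free_alg k)"
    then show "\<exists>y\<in>carrier (free_alg k). y \<oplus>\<^bsub>free_alg k\<^esub> x = \<zero>\<^bsub>free_alg k\<^esub>"
      by (intro bexI[of _ "- x"]) auto
  qed (simp_all add: algebra_simps)
  show "monoid (free_alg k :: (word \<Rightarrow>\<^sub>0 'r) ring)" by (rule monoidI) (simp_all add: mult.assoc)
qed (simp_all add: algebra_simps)

lemma free_alg_a_inv [simp]:
  assumes "x \<in> carrier (free_alg k)"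
  shows "\<ominus>\<^bsub>free_alg k\<^esub> x = - x"
proof -
  interpret ring "free_alg k" by (rule ring_free_alg)
  show ?thesis using assms minus_equality[of "- x" x] by simp
qed

lemma free_alg_sum_closed [simp]:
  "(\<And>i. i \<in> A \<Longrightarrow> f i \<in> carrier (free_alg k)) \<Longrightarrow> sum f A \<in> carrier (free_alg k)"
  by (induction A rule: infinite_finite_induct) auto

lemma free_alg_prod_list_closed [simp]:
  "(\<And>x. x \<in> set xs \<Longrightarrow> x \<in> carrier (free_alg k)) \<Longrightarrow> prod_list xs \<in> carrier (free_alg k)"
  by (induction xs) auto

lemma free_alg_power_closed [simp]: "x \<in> carrier (free_alg k) \<Longrightarrow> x ^ j \<in> carrier (free_alg k)"
  by (induction j) auto

lemma free_alg_mono: "x \<in> carrier (free_alg j) \<Longrightarrow> j \<le> k \<Longrightarrow> x \<in> carrier (free_alg k)"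
  by (fastforce simp: free_alg_carrier gens_def)

lemma free_alg_induct [consumes 1, case_names const add mult s L]:
  fixes P :: "(word \<Rightarrow>\<^sub>0 'r::comm_ring_1) \<Rightarrow> bool"
  assumes x: "x \<in> carrier (free_alg k)"
    and const: "\<And>a. P (const a)"
    and add: "\<And>x y. x \<in> carrier (free_alg k) \<Longrightarrow> y \<in> carrier (free_alg k) \<Longrightarrow> P x \<Longrightarrow> P y \<Longrightarrow> P (x + y)"
    and mult: "\<And>x y. x \<in> carrier (free_alg k) \<Longrightarrow> y \<in> carrier (free_alg k) \<Longrightarrow> P x \<Longrightarrow> P y \<Longrightarrow> P (x * y)"
    and s: "\<And>i. 1 \<le> i \<Longrightarrow> i < k \<Longrightarrow> P (s_free i)"
    and L: "\<And>i. 1 \<le> i \<Longrightarrow> i \<le> k \<Longrightarrow> P (L_free i)"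
  shows "P x"
proof -
  have word: "(prod_list (map gen_elem gs) :: word \<Rightarrow>\<^sub>0 'r) \<in> carrier (free_alg k) \<and> P (prod_list (map gen_elem gs))"
    if "set gs \<subseteq> gens k" for gs
    using that
  proof (induction gs)
    case Nil
    then show ?case using const[of 1] by simp
  next
    case (Cons g gs)
    from Cons.prems have "(gen_elem g :: word \<Rightarrow>\<^sub>0 'r) \<in> carrier (free_alg k)" "P (gen_elem g)"
      using s L by (auto simp: gens_def s_free_gen[symmetric] L_free_gen[symmetric])
    then show ?case using Cons mult by auto
  qed
  have sum: "(\<Sum>w\<in>W. Poly_Mapping.single w (Poly_Mapping.lookup x w)) \<in> carrier (free_alg k)
     \<and> P (\<Sum>w\<in>W. Poly_Mapping.single w (Poly_Mapping.lookup x w))"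
    if "finite W" "W \<subseteq> Poly_Mapping.keys x" for W
    using that
  proof (induction W)
    case empty
    then show ?case using const[of 0] by simp
  next
    case (insert w W)
    have "set (letters w) \<subseteq> gens k" using insert.prems x by (auto simp: free_alg_carrier)
    then have "Poly_Mapping.single w (Poly_Mapping.lookup x w) \<in> carrier (free_alg k)
       \<and> P (Poly_Mapping.single w (Poly_Mapping.lookup x w))"
      using word[of "letters w"] const mult free_alg_closed(5,7) unfolding single_word by blast
    then show ?case using insert add by auto
  qed
  from sum[of "Poly_Mapping.keys x"] show ?thesis using poly_mapping_expand[of x] by simp
qed

section \<open>Evaluation of the free algebra\<close>

text \<open>The universal property of the free algebra: \<open>c\<close> is the structure map of the
  target as an R-algebra. Commutation of its values with those of the generators is what allows the
  scalars of a product to be collected in front of the words (\<open>c_word\<close>).\<close>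

locale evaluation =
  fixes c :: "'r::comm_ring_1 \<Rightarrow> 'a::ring_1" and \<phi> :: "gen \<Rightarrow> 'a"
  assumes c_1 [simp]: "c 1 = 1"
    and c_add: "c (a + b) = c a + c b"
    and c_mult: "c (a * b) = c a * c b"
    and c_gen: "c a * \<phi> g = \<phi> g * c a"
begin

lemma c_0 [simp]: "c 0 = 0"
  using c_add[of 0 0] by simp

definition eval_free :: "(word \<Rightarrow>\<^sub>0 'r) \<Rightarrow> 'a" where
  "eval_free x = (\<Sum>w\<in>Poly_Mapping.keys x. c (Poly_Mapping.lookup x w) * prod_list (map \<phi> (letters w)))"

lemma eval_superset:
  assumes "finite W" "Poly_Mapping.keys x \<subseteq> W"
  shows "eval_free x = (\<Sum>w\<in>W. c (Poly_Mapping.lookup x w) * prod_list (map \<phi> (letters w)))"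
  unfolding eval_free_def using assms
  by (intro sum.mono_neutral_left) (auto simp: in_keys_iff)

lemma eval_add: "eval_free (x + y) = eval_free x + eval_free y"
proof -
  let ?W = "Poly_Mapping.keys x \<union> Poly_Mapping.keys y"
  have "eval_free (x + y) = (\<Sum>w\<in>?W. c (Poly_Mapping.lookup (x + y) w) * prod_list (map \<phi> (letters w)))"
    by (rule eval_superset) (use keys_add[of x y] in auto)
  also have "\<dots> = eval_free x + eval_free y"
    by (simp add: lookup_add c_add distrib_right sum.distrib eval_superset[of ?W])
  finally show ?thesis .
qed

lemma eval_0 [simp]: "eval_free 0 = 0"
  by (simp add: eval_free_def)

lemma eval_uminus: "eval_free (- x) = - eval_free x"
  using eval_add[of x "- x"] by (simp add: eq_neg_iff_add_eq_0 add.commute)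

lemma eval_diff: "eval_free (x - y) = eval_free x - eval_free y"
  using eval_add[of x "- y"] by (simp add: eval_uminus)

lemma eval_sum: "eval_free (sum f A) = (\<Sum>i\<in>A. eval_free (f i))"
  by (induction A rule: infinite_finite_induct) (auto simp: eval_add)

lemma eval_single: "eval_free (Poly_Mapping.single w a) = c a * prod_list (map \<phi> (letters w))"
  by (cases "a = 0") (auto simp: eval_free_def)

lemma c_word: "c a * prod_list (map \<phi> gs) = prod_list (map \<phi> gs) * c a"
proof (induction gs)
  case (Cons g gs)
  have "c a * (\<phi> g * prod_list (map \<phi> gs)) = \<phi> g * (c a * prod_list (map \<phi> gs))"
    by (simp add: c_gen flip: mult.assoc)
  with Cons show ?case by (simp add: mult.assoc)
qed simp

lemma eval_mult: "eval_free (x * y) = eval_free x * eval_free y"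
proof -
  have single: "eval_free (Poly_Mapping.single v a * Poly_Mapping.single w b)
      = eval_free (Poly_Mapping.single v a) * eval_free (Poly_Mapping.single w b)" for v w a b
  proof -
    have "eval_free (Poly_Mapping.single v a * Poly_Mapping.single w b)
        = c a * (c b * prod_list (map \<phi> (letters v))) * prod_list (map \<phi> (letters w))"
      by (simp add: mult_single eval_single c_mult plus_word_def mult.assoc)
    also have "c a * (c b * prod_list (map \<phi> (letters v))) = c a * prod_list (map \<phi> (letters v)) * c b"
      by (simp only: c_word[of b] mult.assoc)
    finally show ?thesis by (simp add: eval_single mult.assoc)
  qed
  let ?e = "\<lambda>x. \<Sum>w\<in>Poly_Mapping.keys x. Poly_Mapping.single w (Poly_Mapping.lookup x w)"
  have "eval_free (?e x * ?e y) = eval_free (?e x) * eval_free (?e y)"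
    by (simp add: sum_product eval_sum single)
  then show ?thesis using poly_mapping_expand[of x] poly_mapping_expand[of y] by simp
qed

lemma eval_const: "eval_free (const a) = c a"
  by (simp add: const_def eval_single zero_word_def)

lemma eval_1 [simp]: "eval_free 1 = 1"
  using eval_const[of 1] by simp

lemma eval_s: "eval_free (s_free i) = \<phi> (SGen i)"
  and eval_L: "eval_free (L_free i) = \<phi> (LGen i)"
  by (simp_all add: s_free_def L_free_def eval_single)

lemma eval_prod_list: "eval_free (prod_list xs) = prod_list (map eval_free xs)"
  by (induction xs) (auto simp: eval_mult)

lemma eval_power: "eval_free (x ^ j) = eval_free x ^ j"
  by (induction j) (auto simp: eval_mult)

end

section \<open>The ideal of relations and the quotient\<close>

lemma relators_closed: "relators l u k \<subseteq> carrier (free_alg k)"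
proof
  fix x assume "x \<in> relators l u k"
  moreover have "prod_list (map (\<lambda>j. L_free 1 - const (u j)) [1..<Suc l]) \<in> carrier (free_alg k)" if "1 \<le> k"
    using that by (intro free_alg_prod_list_closed) auto
  ultimately show "x \<in> carrier (free_alg k)"
    unfolding relators_def by (auto split: if_splits simp del: upt_Suc)
qed

lemma ideal_rel: "ideal (rel_ideal l u k) (free_alg k)"
  unfolding rel_ideal_def by (rule ring.genideal_ideal[OF ring_free_alg relators_closed])

lemma relators_in_ideal: "x \<in> relators l u k \<Longrightarrow> x \<in> rel_ideal l u k"
  unfolding rel_ideal_def using ring.genideal_self[OF ring_free_alg relators_closed] by blast

lemma rel_ideal_minimal: "ideal J (free_alg k) \<Longrightarrow> relators l u k \<subseteq> J \<Longrightarrow> rel_ideal l u k \<subseteq> J"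
  unfolding rel_ideal_def by (rule ring.genideal_minimal[OF ring_free_alg])

lemma free_alg_idealI:
  assumes "J \<subseteq> carrier (free_alg k)" "0 \<in> J" "\<And>x y. x \<in> J \<Longrightarrow> y \<in> J \<Longrightarrow> x + y \<in> J"
    "\<And>x a. x \<in> J \<Longrightarrow> a \<in> carrier (free_alg k) \<Longrightarrow> a * x \<in> J"
    "\<And>x a. x \<in> J \<Longrightarrow> a \<in> carrier (free_alg k) \<Longrightarrow> x * a \<in> J"
  shows "ideal J (free_alg k)"
proof (rule idealI[OF ring_free_alg])
  show "subgroup J (add_monoid (free_alg k))"
  proof
    fix x assume "x \<in> J"
    moreover from this have "- x \<in> J" using assms(4)[of x "- 1"] by simp
    ultimately show "inv\<^bsub>add_monoid (free_alg k)\<^esub> x \<in> J"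
      using assms(1) free_alg_a_inv[of x k] by (auto simp: a_inv_def)
  qed (use assms in auto)
qed (use assms in auto)

lemma rel_ideal_closed:
  "x \<in> rel_ideal l u k \<Longrightarrow> x \<in> carrier (free_alg k)"
  "0 \<in> rel_ideal l u k"
  "x \<in> rel_ideal l u k \<Longrightarrow> y \<in> rel_ideal l u k \<Longrightarrow> x + y \<in> rel_ideal l u k"
  "x \<in> rel_ideal l u k \<Longrightarrow> - x \<in> rel_ideal l u k"
  "x \<in> rel_ideal l u k \<Longrightarrow> a \<in> carrier (free_alg k) \<Longrightarrow> a * x \<in> rel_ideal l u k"
  "x \<in> rel_ideal l u k \<Longrightarrow> a \<in> carrier (free_alg k) \<Longrightarrow> x * a \<in> rel_ideal l u k"
proof -
  interpret ideal "rel_ideal l u k" "free_alg k" by (rule ideal_rel)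
  show 1: "x \<in> rel_ideal l u k \<Longrightarrow> x \<in> carrier (free_alg k)" by (rule a_Hcarr)
  show "0 \<in> rel_ideal l u k" using zero_closed additive_subgroup.zero_closed[OF additive_subgroup_axioms] by simp
  show "x \<in> rel_ideal l u k \<Longrightarrow> y \<in> rel_ideal l u k \<Longrightarrow> x + y \<in> rel_ideal l u k"
    using additive_subgroup.a_closed[OF additive_subgroup_axioms, of x y] by simp
  have *: "x \<in> rel_ideal l u k \<Longrightarrow> a \<in> carrier (free_alg k) \<Longrightarrow> a * x \<in> rel_ideal l u k" for x a
    using I_l_closed[of x a] by simp
  then show "x \<in> rel_ideal l u k \<Longrightarrow> a \<in> carrier (free_alg k) \<Longrightarrow> a * x \<in> rel_ideal l u k" .
  show "x \<in> rel_ideal l u k \<Longrightarrow> - x \<in> rel_ideal l u k" using *[of x "- 1"] by simp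
  show "x \<in> rel_ideal l u k \<Longrightarrow> a \<in> carrier (free_alg k) \<Longrightarrow> x * a \<in> rel_ideal l u k"
    using I_r_closed[of x a] by simp
qed

lemma ring_hecke: "ring (hecke l u k)"
  unfolding hecke_def by (rule ideal.quotient_is_ring[OF ideal_rel])

lemma proj_ring_hom: "proj l u k \<in> ring_hom (free_alg k) (hecke l u k)"
  using ideal.rcos_ring_hom[OF ideal_rel[of l u k]]
  unfolding hecke_def proj_def by (simp add: eta_contract_eq)

lemma proj_closed [simp]: "x \<in> carrier (free_alg k) \<Longrightarrow> proj l u k x \<in> carrier (hecke l u k)"
  by (rule ring_hom_closed[OF proj_ring_hom])

lemma carrier_hecke: "carrier (hecke l u k) = proj l u k ` carrier (free_alg k)"
  unfolding hecke_def FactRing_def A_RCOSETS_def' proj_def by auto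

lemma proj_mult: "x \<in> carrier (free_alg k) \<Longrightarrow> y \<in> carrier (free_alg k) \<Longrightarrow>
    proj l u k (x * y) = proj l u k x \<otimes>\<^bsub>hecke l u k\<^esub> proj l u k y"
  using ring_hom_mult[OF proj_ring_hom[of l u k], of x y] by simp

lemma proj_add: "x \<in> carrier (free_alg k) \<Longrightarrow> y \<in> carrier (free_alg k) \<Longrightarrow>
    proj l u k (x + y) = proj l u k x \<oplus>\<^bsub>hecke l u k\<^esub> proj l u k y"
  using ring_hom_add[OF proj_ring_hom[of l u k], of x y] by simp

lemma proj_1: "proj l u k 1 = \<one>\<^bsub>hecke l u k\<^esub>"
  using ring_hom_one[OF proj_ring_hom[of l u k]] by simp

lemma proj_0: "proj l u k 0 = \<zero>\<^bsub>hecke l u k\<^esub>"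
  using ring_hom_zero[OF proj_ring_hom ring_free_alg ring_hecke] by simp

lemma proj_uminus:
  assumes "x \<in> carrier (free_alg k)"
  shows "proj l u k (- x) = \<ominus>\<^bsub>hecke l u k\<^esub> proj l u k x"
proof -
  interpret ring "hecke l u k" by (rule ring_hecke)
  have "proj l u k (- x) \<oplus>\<^bsub>hecke l u k\<^esub> proj l u k x = \<zero>\<^bsub>hecke l u k\<^esub>"
    using proj_add[of "- x" k x l u] assms by (simp add: proj_0)
  then show ?thesis using assms minus_equality[of "proj l u k (- x)" "proj l u k x"] by simp
qed

lemma proj_diff: "x \<in> carrier (free_alg k) \<Longrightarrow> y \<in> carrier (free_alg k) \<Longrightarrow>
    proj l u k (x - y) = proj l u k x \<ominus>\<^bsub>hecke l u k\<^esub> proj l u k y"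
  using proj_add[of x k "- y" l u] proj_uminus[of y k l u] by (simp add: a_minus_def)

lemma proj_sum:
  assumes "\<And>i. i \<in> A \<Longrightarrow> f i \<in> carrier (free_alg k)"
  shows "proj l u k (sum f A) = (\<Oplus>\<^bsub>hecke l u k\<^esub>i\<in>A. proj l u k (f i))"
proof -
  interpret ring "hecke l u k" by (rule ring_hecke)
  show ?thesis
  proof (cases "finite A")
    case True
    then show ?thesis using assms
      by (induction A) (simp_all add: proj_0 proj_add Pi_def)
  next
    case False
    then show ?thesis by (simp add: proj_0 finsum_infinite)
  qed
qed

lemma proj_prod_list:
  assumes "\<And>x. x \<in> set xs \<Longrightarrow> x \<in> carrier (free_alg k)"
  shows "proj l u k (prod_list xs) = list_mult (hecke l u k) (map (proj l u k) xs)"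
  using assms by (induction xs) (simp_all add: list_mult_def proj_1 proj_mult)

lemma proj_power:
  assumes "x \<in> carrier (free_alg k)"
  shows "proj l u k (x ^ j) = proj l u k x [^]\<^bsub>hecke l u k\<^esub> j"
proof -
  interpret ring "hecke l u k" by (rule ring_hecke)
  show ?thesis using assms
    by (induction j) (simp_all add: proj_1 proj_mult power_Suc2 del: power_Suc)
qed

lemma proj_eq_iff:
  assumes "x \<in> carrier (free_alg k)" "y \<in> carrier (free_alg k)"
  shows "proj l u k x = proj l u k y \<longleftrightarrow> x - y \<in> rel_ideal l u k"
proof -
  interpret ideal "rel_ideal l u k" "free_alg k" by (rule ideal_rel)
  show ?thesis using quotient_eq_iff_same_a_r_cos[OF ideal_rel assms] assms
    by (simp add: proj_def a_minus_def)
qed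

text \<open>The trace of the larger ideal on the smaller free algebra is an ideal there and contains
  all relators of that algebra. The inclusion is what makes \<open>incl\<close> send cosets to
  cosets.\<close>

lemma rel_ideal_mono: "rel_ideal l u (k - 1) \<subseteq> rel_ideal l u k"
proof -
  have "ideal (rel_ideal l u k \<inter> carrier (free_alg (k - 1))) (free_alg (k - 1))"
    using free_alg_mono[of _ "k - 1" k]
    by (intro free_alg_idealI) (auto intro: rel_ideal_closed)
  moreover have "relators l u j \<subseteq> relators l u k" if "j \<le> k" for j
    unfolding relators_def using that
    by (intro Un_mono) (auto 0 0 simp del: upt_Suc, (blast intro: less_le_trans order_trans)+)
  from this[of "k - 1"] have "relators l u (k - 1) \<subseteq> rel_ideal l u k \<inter> carrier (free_alg (k - 1))"
    using relators_in_ideal[of _ l u k] relators_closed[of l u "k - 1"] by auto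
  ultimately have "rel_ideal l u (k - 1) \<subseteq> rel_ideal l u k \<inter> carrier (free_alg (k - 1))"
    by (rule rel_ideal_minimal)
  then show ?thesis by blast
qed

lemma proj_set: "proj l u k x = (\<lambda>r. r + x) ` rel_ideal l u k"
  unfolding proj_def a_r_coset_def' by auto

lemma incl_proj:
  assumes "x \<in> carrier (free_alg (k - 1))"
  shows "incl l u k (proj l u (k - 1) x) = proj l u k x"
proof (intro Set.set_eqI iffI)
  fix y assume "y \<in> incl l u k (proj l u (k - 1) x)"
  then obtain r r' where "y = r + (r' + x)" "r \<in> rel_ideal l u k" "r' \<in> rel_ideal l u (k - 1)"
    unfolding incl_def set_add_def' proj_set by auto
  then show "y \<in> proj l u k x"
    using rel_ideal_mono[of l u k] rel_ideal_closed(3)[of r l u k r'] by (auto simp: add.assoc proj_set image_iff)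
next
  fix y assume "y \<in> proj l u k x"
  then obtain r where "y = r + (0 + x)" "r \<in> rel_ideal l u k"
    unfolding proj_set by auto
  then show "y \<in> incl l u k (proj l u (k - 1) x)"
    unfolding incl_def set_add_def' proj_set using rel_ideal_closed(2) by force
qed

section \<open>The presentation of the algebra, read in an arbitrary ring\<close>

section \<open>The defining relations in a ring\<close>

lemma commutes_mult: "a * c = c * a \<Longrightarrow> b * c = c * b \<Longrightarrow> (a * b) * c = c * (a * (b :: 'a::semigroup_mult))"
  by (metis mult.assoc)

lemma commutes_add: "a * c = c * a \<Longrightarrow> b * c = c * b \<Longrightarrow> (a + b) * c = c * (a + (b :: 'a::semiring))"
  by (simp add: distrib_left distrib_right)

lemma commutes_diff: "a * c = c * a \<Longrightarrow> b * c = c * b \<Longrightarrow> (a - b) * c = c * (a - (b :: 'a::ring))"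
  by (simp add: left_diff_distrib right_diff_distrib)

lemma commutes_power: "a * c = c * a \<Longrightarrow> a * c ^ j = c ^ j * (a :: 'a::monoid_mult)"
  by (induction j) (simp_all, metis mult.assoc)

lemma commutes_prod_list:
  "(\<And>x. x \<in> set xs \<Longrightarrow> x * c = c * x) \<Longrightarrow> prod_list xs * c = c * (prod_list xs :: 'a::monoid_mult)"
  by (induction xs) (auto intro!: commutes_mult)

text \<open>The relations as properties of elements of any ring, with \<open>q j\<close> for the
  image of u_j and commutation in place of R-linearity. The locale serves both for operators on the
  induced module and for the algebras themselves.\<close>

locale hecke_relations =
  fixes S L q :: "nat \<Rightarrow> 'a::ring_1" and l k :: nat
  assumes cyclotomic: "1 \<le> k \<Longrightarrow> prod_list (map (\<lambda>j. L 1 - q j) [1..<Suc l]) = 0"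
    and S_S: "1 \<le> i \<Longrightarrow> i < k \<Longrightarrow> S i * S i = 1"
    and S_far: "1 \<le> i \<Longrightarrow> i + 1 < j \<Longrightarrow> j < k \<Longrightarrow> S i * S j = S j * S i"
    and S_braid: "1 \<le> i \<Longrightarrow> i + 1 < k \<Longrightarrow> S i * S (i + 1) * S i = S (i + 1) * S i * S (i + 1)"
    and L_L: "1 \<le> i \<Longrightarrow> i \<le> k \<Longrightarrow> 1 \<le> j \<Longrightarrow> j \<le> k \<Longrightarrow> L i * L j = L j * L i"
    and S_L: "1 \<le> i \<Longrightarrow> i < k \<Longrightarrow> 1 \<le> j \<Longrightarrow> j \<le> k \<Longrightarrow> j \<noteq> i \<Longrightarrow> j \<noteq> i + 1 \<Longrightarrow> S i * L j = L j * S i"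
    and L_rec: "1 \<le> i \<Longrightarrow> i < k \<Longrightarrow> L (i + 1) = S i * L i * S i + S i"
    and q_S: "1 \<le> i \<Longrightarrow> i < k \<Longrightarrow> q j * S i = S i * q j"
    and q_L: "1 \<le> i \<Longrightarrow> i \<le> k \<Longrightarrow> q j * L i = L i * q j"
    and q_q: "q i * q j = q j * q i"
begin

lemma S_S_assoc: "1 \<le> i \<Longrightarrow> i < k \<Longrightarrow> S i * (S i * a) = a"
  by (simp add: S_S flip: mult.assoc)

lemma S_L_Suc: "1 \<le> i \<Longrightarrow> i < k \<Longrightarrow> S i * L (i + 1) = L i * S i + 1"
  by (simp add: L_rec[simplified] distrib_left S_S S_S_assoc mult.assoc)

lemma L_Suc_S: "1 \<le> i \<Longrightarrow> i < k \<Longrightarrow> L (i + 1) * S i = S i * L i + 1"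
  by (simp add: L_rec[simplified] distrib_right S_S mult.assoc)

end

text \<open>It suffices to check the relations that involve only $s_1, \dots, s_{k-1}$ and $L_1$, together
  with $L_1 L_2 = L_2 L_1$.\<close>

lemma hecke_relationsI:
  fixes S L q :: "nat \<Rightarrow> 'a::ring_1"
  assumes cyc: "1 \<le> k \<Longrightarrow> prod_list (map (\<lambda>j. L 1 - q j) [1..<Suc l]) = 0"
    and S_S: "\<And>i. 1 \<le> i \<Longrightarrow> i < k \<Longrightarrow> S i * S i = 1"
    and S_far: "\<And>i j. 1 \<le> i \<Longrightarrow> i + 1 < j \<Longrightarrow> j < k \<Longrightarrow> S i * S j = S j * S i"
    and S_braid: "\<And>i. 1 \<le> i \<Longrightarrow> i + 1 < k \<Longrightarrow> S i * S (i + 1) * S i = S (i + 1) * S i * S (i + 1)"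
    and S_L1: "\<And>i. 2 \<le> i \<Longrightarrow> i < k \<Longrightarrow> S i * L 1 = L 1 * S i"
    and L1_L2: "2 \<le> k \<Longrightarrow> L 1 * L 2 = L 2 * L 1"
    and L_rec: "\<And>i. 1 \<le> i \<Longrightarrow> i < k \<Longrightarrow> L (i + 1) = S i * L i * S i + S i"
    and q_S: "\<And>i j. 1 \<le> i \<Longrightarrow> i < k \<Longrightarrow> q j * S i = S i * q j"
    and q_L1: "\<And>j. q j * L 1 = L 1 * q j"
    and q_q: "\<And>i j. q i * q j = q j * q i"
  shows "hecke_relations S L q l k"
proof -
  have L_Suc: "L (Suc j) = S j * L j * S j + S j" if "1 \<le> j" "j < k" for j
    using L_rec[OF that] by simp
  have L_comm: "c * L (Suc j) = L (Suc j) * c"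
    if "1 \<le> j" "j < k" "c * S j = S j * c" "c * L j = L j * c" for c j
    unfolding L_Suc[OF that(1,2)] using that(3,4)
    by (intro commutes_add[symmetric] commutes_mult) simp_all
  have q_L: "q j * L i = L i * q j" if "1 \<le> i" "i \<le> k" for i j
    using that by (induction i rule: dec_induct) (auto simp: q_L1[simplified] intro!: L_comm q_S)
  have S_L_less: "S i * L j = L j * S i" if "1 \<le> j" "j < i" "i < k" for i j
    using that
  proof (induction j rule: dec_induct)
    case base
    then show ?case using S_L1 by simp
  next
    case (step j)
    then show ?case using S_far[of j i] by (intro L_comm) auto
  qed
  \<comment> \<open>With a = s_i, b = s_{i+1}, y = L_i one has L_{i+2} = bayab + bab + b. The braid
    relation carries a through the first summand. It commutes with neither of the other two, but
    exchanges them: a(bab) = ba and (bab)a = ab.\<close>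
  have S_L_Suc_Suc: "S i * L (i + 2) = L (i + 2) * S i" if i: "1 \<le> i" "i + 1 < k" for i
  proof -
    let ?a = "S i" and ?b = "S (i + 1)" and ?y = "L i"
    have aa: "?a * ?a = 1" and bb: "?b * ?b = 1" using S_S i by auto
    have br: "?a * ?b * ?a = ?b * ?a * ?b" using S_braid i by simp
    have by': "?b * ?y = ?y * ?b" using S_L_less[of i "i + 1"] i by simp
    have L: "L (i + 2) = ?b * ?a * ?y * ?a * ?b + ?b * ?a * ?b + ?b"
      using L_rec[of "i + 1"] L_rec[of i] i
      by (simp add: distrib_left distrib_right mult.assoc)
    have 1: "?a * (?b * ?a * ?y * ?a * ?b) = ?b * ?a * ?y * ?a * ?b * ?a"
    proof -
      have "?a * (?b * ?a * ?y * ?a * ?b) = (?a * ?b * ?a) * ?y * ?a * ?b" by (simp only: mult.assoc)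
      also have "\<dots> = ?b * ?a * (?b * ?y) * ?a * ?b" by (simp only: br) (simp only: mult.assoc)
      also have "\<dots> = ?b * ?a * ?y * (?b * ?a * ?b)" by (simp only: by') (simp only: mult.assoc)
      also have "\<dots> = ?b * ?a * ?y * (?a * ?b * ?a)" by (simp only: br)
      finally show ?thesis by (simp only: mult.assoc)
    qed
    have 2: "?a * (?b * ?a * ?b) = ?b * ?a"
    proof -
      have "?a * (?b * ?a * ?b) = (?a * ?b * ?a) * ?b" by (simp only: mult.assoc)
      also have "\<dots> = ?b * ?a * (?b * ?b)" by (simp only: br) (simp only: mult.assoc)
      finally show ?thesis by (simp only: bb mult_1_right)
    qed
    have 3: "?b * ?a * ?b * ?a = ?a * ?b"
    proof -
      have "?b * ?a * ?b * ?a = (?a * ?b * ?a) * ?a" by (simp only: br)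
      also have "\<dots> = ?a * ?b * (?a * ?a)" by (simp only: mult.assoc)
      finally show ?thesis by (simp only: aa mult_1_right)
    qed
    show ?thesis unfolding L distrib_left distrib_right 1 2 3 by (simp only: add.commute add.left_commute)
  qed
  have S_L_greater: "S i * L j = L j * S i" if "1 \<le> i" "i + 2 \<le> j" "j \<le> k" for i j
    using that(2,3,1)
  proof (induction j rule: dec_induct)
    case base
    then show ?case using S_L_Suc_Suc by simp
  next
    case (step j)
    then show ?case using S_far[of i j] by (intro L_comm) auto
  qed
  have S_L: "S i * L j = L j * S i" if "1 \<le> i" "i < k" "1 \<le> j" "j \<le> k" "j \<noteq> i" "j \<noteq> i + 1" for i j
    using S_L_less[of j i] S_L_greater[of i j] that by (cases "j < i") auto
  have L1_L: "L 1 * L j = L j * L 1" if "1 \<le> j" "j \<le> k" for j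
    using that
  proof (induction j rule: dec_induct)
    case (step j)
    then show ?case
    proof (cases "j = 1")
      case True
      then show ?thesis using L1_L2 step by (simp add: numeral_2_eq_2)
    next
      case False
      then show ?thesis using step S_L1[of j] by (intro L_comm) auto
    qed
  qed simp
  have L_L_less: "L i * L j = L j * L i" if "1 \<le> i" "i \<le> j" "j \<le> k" for i j
    using that
  proof (induction i rule: dec_induct)
    case base
    then show ?case using L1_L[of j] by simp
  next
    case (step i)
    then show ?case using S_L[of i j] by (cases "j = Suc i") (auto intro!: L_comm[symmetric])
  qed
  have L_L: "L i * L j = L j * L i" if "1 \<le> i" "i \<le> k" "1 \<le> j" "j \<le> k" for i j
    using L_L_less[of i j] L_L_less[of j i] that by (cases "i \<le> j") auto
  show ?thesis
    by unfold_locales (rule cyc S_S S_far S_braid L_L S_L L_rec q_S q_L q_q; assumption)+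
qed

lemma relators_cases [consumes 1, case_names cyclotomic SS far braid LL SL rec]:
  assumes "y \<in> relators l u k"
  obtains "1 \<le> k" "y = prod_list (map (\<lambda>j. L_free 1 - const (u j)) [1..<Suc l])"
  | i where "1 \<le> i" "i < k" "y = s_free i * s_free i - 1"
  | i j where "1 \<le> i" "i + 1 < j" "j < k" "y = s_free i * s_free j - s_free j * s_free i"
  | i where "1 \<le> i" "i + 1 < k"
      "y = s_free i * s_free (i + 1) * s_free i - s_free (i + 1) * s_free i * s_free (i + 1)"
  | i j where "1 \<le> i" "i \<le> k" "1 \<le> j" "j \<le> k" "y = L_free i * L_free j - L_free j * L_free i"
  | i j where "1 \<le> i" "i < k" "1 \<le> j" "j \<le> k" "j \<noteq> i" "j \<noteq> i + 1"
      "y = s_free i * L_free j - L_free j * s_free i"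
  | i where "1 \<le> i" "i < k" "y = L_free (i + 1) - (s_free i * L_free i * s_free i + s_free i)"
  using assms unfolding relators_def
  apply (elim UnE)
  subgoal by (cases "1 \<le> k") (auto intro: that(1) simp del: upt_Suc)
  subgoal by (elim CollectE exE conjE) (rule that(2))
  subgoal by (elim CollectE exE conjE) (rule that(3))
  subgoal by (elim CollectE exE conjE) (rule that(4))
  subgoal by (elim CollectE exE conjE) (rule that(5))
  subgoal by (elim CollectE exE conjE) (rule that(6))
  subgoal by (elim CollectE exE conjE) (rule that(7))
  done

text \<open>The kernel of the evaluation is an ideal of the free algebra and contains the relators.
  Hence values of the generators that satisfy the relations define a representation of
  \<open>hecke\<close>.\<close>

lemma (in evaluation) eval_rel_ideal:
  assumes "hecke_relations (\<lambda>i. \<phi> (SGen i)) (\<lambda>i. \<phi> (LGen i)) (\<lambda>j. c (u j)) l k"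
    and "x \<in> rel_ideal l u k"
  shows "eval_free x = 0"
proof -
  interpret hecke_relations "\<lambda>i. \<phi> (SGen i)" "\<lambda>i. \<phi> (LGen i)" "\<lambda>j. c (u j)" l k by fact
  let ?J = "{x \<in> carrier (free_alg k). eval_free x = 0}"
  have "ideal ?J (free_alg k)"
    by (rule free_alg_idealI) (auto simp: eval_add eval_mult)
  moreover have "relators l u k \<subseteq> ?J"
  proof
    fix y assume y: "y \<in> relators l u k"
    have "eval_free y = 0"
      using y
    proof (cases rule: relators_cases)
      case cyclotomic
      then show ?thesis using hecke_relations.cyclotomic[OF assms(1)]
        by (simp add: eval_prod_list o_def eval_diff eval_L eval_const del: upt_Suc)
    next
      case (SS i)
      then show ?thesis using S_S[of i] by (simp add: eval_diff eval_mult eval_s)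
    next
      case (far i j)
      then show ?thesis using S_far[of i j] by (simp add: eval_diff eval_mult eval_s)
    next
      case (braid i)
      then show ?thesis using S_braid[of i] by (simp add: eval_diff eval_mult eval_s)
    next
      case (LL i j)
      then show ?thesis using L_L[of i j] by (simp add: eval_diff eval_mult eval_L)
    next
      case (SL i j)
      then show ?thesis using S_L[of i j] by (simp add: eval_diff eval_mult eval_s eval_L)
    next
      case (rec i)
      then show ?thesis using L_rec[of i] by (simp add: eval_diff eval_add eval_mult eval_s eval_L)
    qed
    with y relators_closed show "y \<in> ?J" by blast
  qed
  ultimately have "rel_ideal l u k \<subseteq> ?J" by (rule rel_ideal_minimal)
  with assms(2) show ?thesis by blast
qed

section \<open>The module that detects the leading coefficient\<close>

section \<open>Additive endomorphisms\<close>

text \<open>Operators are made into a type of class \<open>ring_1\<close> so that the locales for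
  evaluations and relations apply to them. The sort of \<open>'m\<close> includes
  \<open>zero_neq_one\<close> because the class demands that 0 and 1 differ as
  endomorphisms.\<close>

typedef (overloaded) ('m::"{ab_group_add,zero_neq_one}") endo =
  "{f :: 'm \<Rightarrow> 'm. \<forall>x y. f (x + y) = f x + f y}"
  morphisms app Endo
  by (rule exI[of _ "\<lambda>x. x"]) auto

setup_lifting type_definition_endo

lemma app_add: "app f (x + y) = app f x + app f y"
  by transfer blast

lemma endo_eqI: "(\<And>x. app f x = app g x) \<Longrightarrow> f = g"
  using app_inject by blast

instantiation endo :: ("{ab_group_add,zero_neq_one}") ring_1
begin

lift_definition zero_endo :: "'a endo" is "\<lambda>_. 0" by simp
lift_definition one_endo :: "'a endo" is "\<lambda>x. x" by simp
lift_definition plus_endo :: "'a endo \<Rightarrow> 'a endo \<Rightarrow> 'a endo" is "\<lambda>f g x. f x + g x" by (simp add: algebra_simps)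
lift_definition minus_endo :: "'a endo \<Rightarrow> 'a endo \<Rightarrow> 'a endo" is "\<lambda>f g x. f x - g x" by (simp add: algebra_simps)
lift_definition uminus_endo :: "'a endo \<Rightarrow> 'a endo" is "\<lambda>f x. - f x" by simp
lift_definition times_endo :: "'a endo \<Rightarrow> 'a endo \<Rightarrow> 'a endo" is "\<lambda>f g x. f (g x)" by simp

instance
proof
  have "app (0::'a endo) 1 \<noteq> app 1 1" by (simp add: zero_endo.rep_eq one_endo.rep_eq)
  then show "(0::'a endo) \<noteq> 1" by metis
qed (rule endo_eqI, simp add: zero_endo.rep_eq one_endo.rep_eq plus_endo.rep_eq minus_endo.rep_eq
       uminus_endo.rep_eq times_endo.rep_eq app_add ac_simps)+

end

lemma app_simps [simp]: "app 0 x = 0" "app 1 x = x" "app (f + g) x = app f x + app g x"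
  "app (f - g) x = app f x - app g x" "app (- f) x = - app f x" "app (f * g) x = app f (app g x)"
  by (simp_all add: zero_endo.rep_eq one_endo.rep_eq plus_endo.rep_eq minus_endo.rep_eq
       uminus_endo.rep_eq times_endo.rep_eq)

lemma app_0 [simp]: "app f 0 = 0"
  using app_add[of f 0 0] by simp

lemma app_uminus: "app f (- x) = - app f x"
  using app_add[of f x "- x"] by (simp add: eq_neg_iff_add_eq_0 add.commute)

lemma app_diff: "app f (x - y) = app f x - app f y"
  using app_add[of f x "- y"] by (simp add: app_uminus)

lemma app_sum: "app f (sum g A) = (\<Sum>i\<in>A. app f (g i))"
  by (induction A rule: infinite_finite_induct) (auto simp: app_add)

lemma app_Endo: "(\<And>x y. f (x + y) = f x + f y) \<Longrightarrow> app (Endo f) = f"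
  by (simp add: Endo_inverse)

section \<open>The induced module\<close>

text \<open>The ring \<open>'a\<close> with \<open>c\<close> and \<open>\<phi>\<close> stands for A
  = H_{l,K}, which enters through its relations only; the module constructed over it is one for
  H_{l,K+1}.\<close>

locale induced_module = evaluation c \<phi>
    + hecke_relations "\<lambda>i. \<phi> (SGen i)" "\<lambda>i. \<phi> (LGen i)" "\<lambda>j. c (u j)" l K
  for c :: "'r::comm_ring_1 \<Rightarrow> 'a::ring_1" and \<phi> u l K +
  assumes l_pos: "1 \<le> l"
begin

abbreviation "S i \<equiv> \<phi> (SGen i)"
abbreviation "x \<equiv> \<phi> (LGen (Suc 0))"
abbreviation "q j \<equiv> c (u j)"

lemma c_comm: "c a * c b = c b * c a"
  by (metis c_mult mult.commute)

lemma c_comm_assoc: "c a * (\<phi> g * y) = \<phi> g * (c a * y)"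
  by (metis c_gen mult.assoc)

definition smul :: "'a \<Rightarrow> (nat \<Rightarrow> 'a) \<Rightarrow> nat \<Rightarrow> 'a" where "smul a p = (\<lambda>j. a * p j)"

definition cst :: "'a \<Rightarrow> nat \<Rightarrow> 'a" where "cst a = (\<lambda>j. if j = 0 then a else 0)"

definition supp :: "(nat \<Rightarrow> 'a) \<Rightarrow> bool" where "supp p \<longleftrightarrow> (\<forall>j\<ge>l. p j = 0)"

text \<open>A function \<open>p\<close> supported on $\{0, \dots, l-1\}$ stands for the element
  $\sum_j (z - q_1) \cdots (z - q_j) p_j$ of $A[z]/\prod_j (z - q_j)$. Multiplication by $z$ is \<open>zop\<close>,
  and \<open>ev\<close> substitutes \<open>x\<close> for \<open>z\<close>.\<close>

definition zop :: "(nat \<Rightarrow> 'a) \<Rightarrow> nat \<Rightarrow> 'a" where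
  "zop p = (\<lambda>j. if j < l then (if j = 0 then 0 else p (j - 1)) + q (Suc j) * p j else 0)"

definition xprod :: "nat \<Rightarrow> 'a" where "xprod j = prod_list (map (\<lambda>r. x - q r) [1..<Suc j])"

definition ev :: "(nat \<Rightarrow> 'a) \<Rightarrow> 'a" where "ev p = (\<Sum>j<l. xprod j * p j)"

lemma smul_smul: "smul a (smul b p) = smul (a * b) p"
  by (simp add: smul_def mult.assoc)

lemma smul_1 [simp]: "smul 1 p = p"
  by (simp add: smul_def)

lemma smul_diff: "smul a (p - p') = smul a p - smul a p'"
  by (simp add: smul_def right_diff_distrib fun_eq_iff)

lemma smul_cst: "smul a (cst b) = cst (a * b)"
  by (auto simp: smul_def cst_def fun_eq_iff)

lemma smul_add_left: "smul (a + b) p = smul a p + smul b p"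
  by (simp add: smul_def distrib_right fun_eq_iff)

lemma cst_add: "cst (a + b) = cst a + cst b"
  by (auto simp: cst_def fun_eq_iff)

lemma cst_diff: "cst (a - b) = cst a - cst b"
  by (auto simp: cst_def fun_eq_iff)

lemma supp_simps [simp]: "supp p \<Longrightarrow> supp (smul a p)" "supp (cst a)" "supp (zop p)"
  "supp p \<Longrightarrow> supp p' \<Longrightarrow> supp (p + p')" "supp p \<Longrightarrow> supp p' \<Longrightarrow> supp (p - p')"
  using l_pos by (auto simp: supp_def smul_def cst_def zop_def)

lemma ev_add: "ev (p + p') = ev p + ev p'"
  by (simp add: ev_def distrib_left sum.distrib)

lemma ev_diff: "ev (p - p') = ev p - ev p'"
  by (simp add: ev_def right_diff_distrib sum_subtractf)

lemma ev_cst: "ev (cst a) = a"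
proof -
  have "ev (cst a) = (\<Sum>j<l. if j = 0 then a else 0)"
    unfolding ev_def by (rule sum.cong) (auto simp: cst_def xprod_def)
  also have "\<dots> = a" using l_pos by (subst sum.delta) auto
  finally show ?thesis .
qed

lemma zop_smul: "(\<And>j. q j * a = a * q j) \<Longrightarrow> zop (smul a p) = smul a (zop p)"
  by (auto simp: zop_def smul_def fun_eq_iff distrib_left) (metis mult.assoc)+

lemma xprod_commute: "a * x = x * a \<Longrightarrow> (\<And>j. q j * a = a * q j) \<Longrightarrow> xprod j * a = a * xprod j"
  unfolding xprod_def by (rule commutes_prod_list) (auto simp: left_diff_distrib right_diff_distrib)

lemma ev_smul:
  assumes "a * x = x * a" "\<And>j. q j * a = a * q j"
  shows "ev (smul a p) = a * ev p"
  using xprod_commute[OF assms] by (simp add: ev_def smul_def sum_distrib_left flip: mult.assoc)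

lemma xprod_Suc: "xprod (Suc j) = xprod j * (x - q (Suc j))"
  by (simp add: xprod_def)

lemma x_xprod: "x * xprod j = xprod j * x"
  by (rule xprod_commute[symmetric]) (simp_all add: c_gen)

lemma x_xprod_assoc: "x * (xprod j * a) = xprod j * (x * a)"
  by (metis x_xprod mult.assoc)

text \<open>The top term of the shifted sum is \<open>xprod l\<close> times a coefficient, and
  \<open>xprod l\<close> is f(x) = 0 by the cyclotomic relation of A. So substitution respects the
  passage to A[z]/(f); that relation is present for K >= 1.\<close>

lemma ev_zop:
  assumes "1 \<le> K"
  shows "ev (zop p) = x * ev p"
proof -
  have l: "xprod l = 0" using cyclotomic[OF assms] by (simp add: xprod_def)
  obtain n where n: "l = Suc n" using l_pos by (cases l) auto
  have "ev (zop p) = (\<Sum>j<l. xprod j * (if j = 0 then 0 else p (j - 1))) + (\<Sum>j<l. xprod j * (q (Suc j) * p j))"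
    by (simp add: ev_def zop_def distrib_left sum.distrib)
  also have "(\<Sum>j<l. xprod j * (if j = 0 then 0 else p (j - 1))) = (\<Sum>j<l. xprod (Suc j) * p j)"
    unfolding n sum.lessThan_Suc_shift[of _ n] sum.lessThan_Suc[of "\<lambda>j. xprod (Suc j) * p j"]
    using l by (simp add: n)
  also have "(\<Sum>j<l. xprod (Suc j) * p j) + (\<Sum>j<l. xprod j * (q (Suc j) * p j)) = (\<Sum>j<l. x * (xprod j * p j))"
    by (simp add: xprod_Suc x_xprod_assoc mult.assoc left_diff_distrib right_diff_distrib flip: sum.distrib)
  finally show ?thesis by (simp add: ev_def sum_distrib_left)
qed

text \<open>For y = L_2 one has s_1 y = x s_1 + 1 and y s_1 = s_1 x + 1, and y commutes with every
  polynomial in x. Moving y from the left of \<open>xprod j\<close> to its right gives the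
  identity.\<close>

lemma x_S_xprod_S:
  assumes "2 \<le> K"
  shows "x * (S 1 * (xprod j * (S 1 * a))) = S 1 * (xprod j * (S 1 * (x * a))) + S 1 * (xprod j * a) - xprod j * (S 1 * a)"
proof -
  let ?y = "\<phi> (LGen 2)"
  have y: "xprod j * ?y = ?y * xprod j"
    using L_L[of 1 2] assms by (intro xprod_commute) (auto simp: c_gen)
  have 1: "S 1 * ?y = x * S 1 + 1" and 2: "?y * S 1 = S 1 * x + 1"
    using S_L_Suc[of 1] L_Suc_S[of 1] assms by (simp_all add: numeral_2_eq_2)
  have "(x * S 1 + 1) * xprod j * S 1 = S 1 * (?y * xprod j) * S 1"
    by (simp only: 1[symmetric] mult.assoc)
  also have "\<dots> = S 1 * xprod j * (?y * S 1)"
    by (simp only: y[symmetric] mult.assoc)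
  also have "\<dots> = S 1 * xprod j * S 1 * x + S 1 * xprod j"
    unfolding 2 by (simp add: distrib_left mult.assoc)
  finally have "(x * S 1 * xprod j * S 1 + xprod j * S 1) * a = (S 1 * xprod j * S 1 * x + S 1 * xprod j) * a"
    by (simp add: distrib_right mult.assoc)
  then show ?thesis by (simp add: distrib_right mult.assoc eq_diff_eq)
qed

lemma x_S_ev_S:
  assumes "2 \<le> K"
  shows "x * (S 1 * ev (smul (S 1) p)) = S 1 * ev (smul (S 1 * x) p) + S 1 * ev p - ev (smul (S 1) p)"
  using x_S_xprod_S[OF assms]
  by (simp add: ev_def smul_def sum_distrib_left mult.assoc sum.distrib sum_subtractf)

text \<open>\<open>w i\<close> is s_{i-1}...s_1, the element of A that s_i...s_2 turns into when it
  is moved to the right across s_1...s_K. The variant \<open>w' i\<close> is s_{i-1}...s_2, which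
  commutes with x.\<close>

fun w :: "nat \<Rightarrow> 'a" where
  "w 0 = 1" | "w (Suc 0) = 1" | "w (Suc (Suc i)) = S (Suc i) * w (Suc i)"

fun w' :: "nat \<Rightarrow> 'a" where
  "w' 0 = 1" | "w' (Suc 0) = 1" | "w' (Suc (Suc 0)) = 1"
| "w' (Suc (Suc (Suc i))) = S (Suc (Suc i)) * w' (Suc (Suc i))"

lemma w_Suc: "1 \<le> i \<Longrightarrow> w (Suc i) = S i * w i"
  by (cases i) auto

lemma w'_Suc: "2 \<le> i \<Longrightarrow> w' (Suc i) = S i * w' i"
  by (cases i rule: w'.cases) auto

lemma w_w': "2 \<le> i \<Longrightarrow> w i = w' i * S 1"
  by (induction i rule: dec_induct) (auto simp: w_Suc w'_Suc mult.assoc numeral_2_eq_2)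

lemma q_w': "q j * w' i = w' i * q j"
  by (induction i rule: w'.induct) (auto simp: c_comm_assoc mult.assoc)

lemma w'_x: "2 \<le> i \<Longrightarrow> i \<le> K \<Longrightarrow> w' i * x = x * w' i"
proof (induction i rule: dec_induct)
  case (step i)
  then show ?case using S_L[of i 1] by (auto simp: w'_Suc intro!: commutes_mult)
qed (simp add: numeral_2_eq_2)

lemma S_w: "i \<le> m \<Longrightarrow> Suc m \<le> K \<Longrightarrow> 1 \<le> i \<Longrightarrow> S (m + 1) * w i = w i * S (m + 1)" if "m + 1 < K" for m
proof (induction i rule: w.induct)
  case (3 i)
  then show ?case using S_far[of "Suc i" "m + 1"] that by (auto intro!: commutes_mult[symmetric])
qed auto

text \<open>A single braid move at s_m s_{m-1} s_m, all other letters commute. It is needed because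
  s_m acts by \<open>S m\<close> at a position i > m but by \<open>S (m - 1)\<close> at position 0,
  and L_1 links these positions through \<open>w i\<close>.\<close>

lemma w_S: "2 \<le> m \<Longrightarrow> m + 1 \<le> i \<Longrightarrow> i \<le> K \<Longrightarrow> w i * S m = S (m - 1) * w i"
proof (rotate_tac 1, induction i rule: dec_induct)
  case base
  have m: "w (m + 1) = S m * S (m - 1) * w (m - 1)"
    using base w_Suc[of m] w_Suc[of "m - 1"] by (simp add: mult.assoc)
  have "w (m + 1) * S m = S m * S (m - 1) * (w (m - 1) * S m)" unfolding m by (simp add: mult.assoc)
  also have "w (m - 1) * S m = S m * w (m - 1)"
    using S_w[of "m - 1" "m - 1"] base by simp
  also have "S m * S (m - 1) * (S m * w (m - 1)) = (S m * S (m - 1) * S m) * w (m - 1)"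
    by (simp add: mult.assoc)
  also have "S m * S (m - 1) * S m = S (m - 1) * S m * S (m - 1)"
    using S_braid[of "m - 1"] base by simp
  finally show ?case by (simp only: m mult.assoc)
next
  case (step i)
  have "w (Suc i) * S m = S i * (S (m - 1) * w i)"
    using step w_Suc[of i] by (simp add: mult.assoc)
  also have "\<dots> = S (m - 1) * (S i * w i)"
    using S_far[of "m - 1" i] step by (simp flip: mult.assoc)
  finally show ?case using step w_Suc[of i] by simp
qed

subsection \<open>The operators\<close>

text \<open>The module has positions $0, \dots, K$; position \<open>i\<close> with polynomial $p(z)$ is the formal element
  $s_i \cdots s_1\, p(L_1)\, s_1 \cdots s_K$ of $H_{K+1}$ as a right module over $A$. Reading off the
  left multiplications by $s_m$ and $L_1$ gives \<open>Sop\<close> and \<open>Xop\<close>. Outside of the range of indices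
  the operators act by a character, so that the relations hold on the whole type.\<close>

definition Sop :: "nat \<Rightarrow> (nat \<Rightarrow> nat \<Rightarrow> 'a) \<Rightarrow> nat \<Rightarrow> nat \<Rightarrow> 'a" where
  "Sop m v = (\<lambda>i j. if K < i \<or> l \<le> j then v i j
     else if i = m then v (m - 1) j else if i = m - 1 then v m j
     else if i < m then S (m - 1) * v i j else S m * v i j)"

text \<open>Coefficients from A stand to the right of s_1...s_K. For i >= 1, the rules L_1 s_1 = s_1
  L_2 - 1 and L_2 s_1 = s_1 L_1 + 1 split the product of L_1 with the element at position i into
  three terms: one at position i with coefficients multiplied by x, and two at position 0, namely
  the constant p(x) and -p. The latter two are multiplied by \<open>w i\<close>, since s_i...s_2 has
  to cross s_1...s_K.\<close>

definition Xop :: "(nat \<Rightarrow> nat \<Rightarrow> 'a) \<Rightarrow> nat \<Rightarrow> nat \<Rightarrow> 'a" where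
  "Xop v = (\<lambda>i j. if K < i \<or> l \<le> j then q 1 * v i j
     else if i = 0 then zop (v 0) j + (\<Sum>i=1..K. smul (w i) (cst (ev (v i)) - v i) j)
     else x * v i j)"

definition SE :: "nat \<Rightarrow> (nat \<Rightarrow> nat \<Rightarrow> 'a) endo" where
  "SE m = (if 1 \<le> m \<and> m \<le> K then Endo (Sop m) else 1)"

definition XE :: "(nat \<Rightarrow> nat \<Rightarrow> 'a) endo" where "XE = Endo Xop"

definition cE :: "'r \<Rightarrow> (nat \<Rightarrow> nat \<Rightarrow> 'a) endo" where
  "cE a = Endo (\<lambda>v i j. c a * v i j)"

fun LE :: "nat \<Rightarrow> (nat \<Rightarrow> nat \<Rightarrow> 'a) endo" where
  "LE 0 = 1" | "LE (Suc 0) = XE" | "LE (Suc (Suc i)) = SE (Suc i) * LE (Suc i) * SE (Suc i) + SE (Suc i)"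

definition \<phi>E :: "gen \<Rightarrow> (nat \<Rightarrow> nat \<Rightarrow> 'a) endo" where
  "\<phi>E g = (case g of SGen m \<Rightarrow> SE m | LGen m \<Rightarrow> LE m)"

lemma app_SE: "1 \<le> m \<Longrightarrow> m \<le> K \<Longrightarrow> app (SE m) = Sop m"
proof -
  assume "1 \<le> m" "m \<le> K"
  moreover have "app (Endo (Sop m)) = Sop m"
    by (rule app_Endo) (auto simp: Sop_def fun_eq_iff distrib_left)
  ultimately show ?thesis by (simp add: SE_def)
qed

lemma app_XE: "app XE = Xop"
proof -
  have "zop (p + p') j = zop p j + zop p' j" for p p' j
    by (auto simp: zop_def distrib_left)
  moreover have "smul a (cst (ev (p + p')) - (p + p')) j
      = smul a (cst (ev p) - p) j + smul a (cst (ev p') - p') j" for a p p' j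
    by (simp add: ev_add cst_add smul_def algebra_simps)
  ultimately have "Xop (v + v') = Xop v + Xop v'" for v v'
    by (auto simp: Xop_def fun_eq_iff distrib_left sum.distrib)
  then show ?thesis unfolding XE_def by (rule app_Endo)
qed

lemma app_cE: "app (cE a) v = (\<lambda>i j. c a * v i j)"
  unfolding cE_def by (subst app_Endo) (auto simp: fun_eq_iff distrib_left)

definition b :: "nat \<Rightarrow> (nat \<Rightarrow> 'a) \<Rightarrow> nat \<Rightarrow> nat \<Rightarrow> 'a" where
  "b i p = (\<lambda>i'. if i' = i then p else 0)"

lemma b_add: "b i (p + p') = b i p + b i p'"
  by (auto simp: b_def fun_eq_iff)

lemma b_diff: "b i (p - p') = b i p - b i p'"
  by (auto simp: b_def fun_eq_iff)

lemma b_0 [simp]: "b i 0 = 0"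
  by (auto simp: b_def fun_eq_iff)

lemma SE_b:
  assumes "1 \<le> m" "m \<le> K" "i \<le> K" "supp p"
  shows "app (SE m) (b i p) = (if i = m then b (m - 1) p else if i = m - 1 then b m p
     else if i < m then b i (smul (S (m - 1)) p) else b i (smul (S m) p))"
  unfolding app_SE[OF assms(1,2)] using assms by (auto simp: Sop_def b_def supp_def smul_def fun_eq_iff)

lemma ev_0 [simp]: "ev 0 = 0"
  by (simp add: ev_def)

lemma zop_0 [simp]: "zop 0 = 0"
  by (simp add: zop_def fun_eq_iff)

lemma cst_0 [simp]: "cst 0 = 0"
  by (simp add: cst_def fun_eq_iff)

lemma smul_0 [simp]: "smul a 0 = 0"
  by (simp add: smul_def fun_eq_iff)

lemma XE_b_0: "supp p \<Longrightarrow> app XE (b 0 p) = b 0 (zop p)"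
  unfolding app_XE by (auto simp: Xop_def b_def supp_def fun_eq_iff zop_def)

lemma XE_b:
  assumes "1 \<le> i" "i \<le> K" "supp p"
  shows "app XE (b i p) = b i (smul x p) + b 0 (smul (w i) (cst (ev p) - p))"
proof -
  have *: "(\<Sum>i'=1..K. smul (w i') (cst (ev (b i p i')) - b i p i') j) = smul (w i) (cst (ev p) - p) j" for j
  proof -
    have "(\<Sum>i'=1..K. smul (w i') (cst (ev (b i p i')) - b i p i') j)
      = (\<Sum>i'=1..K. if i' = i then smul (w i) (cst (ev p) - p) j else 0)"
      by (rule sum.cong) (auto simp: b_def)
    then show ?thesis using assms by simp
  qed
  have **: "supp (smul (w i) (cst (ev p) - p))" using assms by simp
  have z: "zop (b i p 0) = 0" using assms by (simp add: b_def)
  show ?thesis unfolding app_XE Xop_def * z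
    using assms ** unfolding supp_def by (auto simp: fun_eq_iff b_def smul_def)
qed

lemma cE_b: "app (cE a) (b i p) = b i (smul (c a) p)"
  by (auto simp: app_cE b_def smul_def fun_eq_iff)

text \<open>Every vector is a finite sum of vectors \<open>b i p\<close> and one that vanishes on
  the range of indices that matters. On the latter the operators act by a character, so the second
  premise is easy in each application.\<close>

lemma endo_eq_on_basis:
  assumes b: "\<And>i p. i \<le> K \<Longrightarrow> supp p \<Longrightarrow> app f (b i p) = app g (b i p)"
    and tail: "\<And>v. (\<And>i j. i \<le> K \<Longrightarrow> j < l \<Longrightarrow> v i j = 0) \<Longrightarrow> app f v = app g v"
  shows "f = g"
proof (rule endo_eqI)
  fix v :: "nat \<Rightarrow> nat \<Rightarrow> 'a"
  let ?p = "\<lambda>i j. if j < l then v i j else 0"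
  let ?t = "\<lambda>i j. if i \<le> K \<and> j < l then 0 else v i j"
  have v: "v = (\<Sum>i\<le>K. b i (?p i)) + ?t"
  proof (intro ext)
    fix i j
    have sum_app: "sum h A i j = (\<Sum>i'\<in>A. h i' i j)" for h :: "nat \<Rightarrow> nat \<Rightarrow> nat \<Rightarrow> 'a" and A
      by (induction A rule: infinite_finite_induct) auto
    have "(\<Sum>i'\<le>K. b i' (?p i') i j) = (\<Sum>i'\<le>K. if i' = i then ?p i j else 0)"
      by (rule sum.cong) (auto simp: b_def)
    then show "v i j = ((\<Sum>i\<le>K. b i (?p i)) + ?t) i j"
      by (auto simp: sum_app)
  qed
  have "supp (?p i)" for i by (simp add: supp_def)
  then have "app f (\<Sum>i\<le>K. b i (?p i)) = app g (\<Sum>i\<le>K. b i (?p i))"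
    by (simp add: app_sum b)
  moreover have "app f ?t = app g ?t" by (rule tail) auto
  ultimately show "app f v = app g v" by (subst (1 2) v) (simp add: app_add)
qed

lemma SE_tail: "(\<And>i j. i \<le> K \<Longrightarrow> j < l \<Longrightarrow> v i j = 0) \<Longrightarrow> 1 \<le> m \<Longrightarrow> m \<le> K \<Longrightarrow> app (SE m) v = v"
  by (auto simp: app_SE Sop_def fun_eq_iff)

lemma XE_tail:
  assumes "\<And>i j. i \<le> K \<Longrightarrow> j < l \<Longrightarrow> v i j = 0"
  shows "app XE v = app (cE (u 1)) v"
proof -
  have "zop (v 0) = 0" using assms by (auto simp: zop_def fun_eq_iff)
  moreover have "smul (w i) (cst (ev (v i)) - v i) j = 0" if "i \<le> K" "j < l" for i j
    using assms[of i] that by (simp add: ev_def smul_def cst_def)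
  ultimately show ?thesis using assms by (auto simp: app_XE Xop_def app_cE fun_eq_iff)
qed

lemma cE_tail: "(\<And>i j. i \<le> K \<Longrightarrow> j < l \<Longrightarrow> v i j = 0) \<Longrightarrow> i \<le> K \<Longrightarrow> j < l \<Longrightarrow> app (cE a) v i j = 0"
  by (simp add: app_cE)

end

lemma prod_list_rev_commuting:
  fixes xs :: "'a::monoid_mult list"
  assumes "\<And>x y. x \<in> set xs \<Longrightarrow> y \<in> set xs \<Longrightarrow> x * y = y * x"
  shows "prod_list (rev xs) = prod_list xs"
  using assms
proof (induction xs)
  case (Cons x xs)
  have "prod_list xs * x = x * prod_list xs"
    by (rule commutes_prod_list) (use Cons.prems in auto)
  with Cons show ?case by simp
qed simp

context induced_module
begin

subsection \<open>Verification of the relations\<close>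

lemma cE_SE: "cE a * SE m = SE m * cE a"
proof (cases "1 \<le> m \<and> m \<le> K")
  case True
  show ?thesis
  proof (rule endo_eqI)
    fix v
    show "app (cE a * SE m) v = app (SE m * cE a) v"
      using True by (auto simp: app_cE app_SE Sop_def fun_eq_iff c_comm_assoc)
  qed
qed (auto simp: SE_def)

lemma cE_XE: "cE a * XE = XE * cE a"
proof (rule endo_eqI)
  fix v
  have q: "c a * (q j * y) = q j * (c a * y)" for j y by (metis c_comm mult.assoc)
  have z: "zop (\<lambda>j. c a * p j) j = c a * zop p j" for p j
    by (auto simp: zop_def distrib_left q)
  have xp: "xprod j * c a = c a * xprod j" for j
    by (rule xprod_commute) (auto simp: c_gen c_comm)
  have e: "ev (\<lambda>j. c a * p j) = c a * ev p" for p
    by (simp add: ev_def sum_distrib_left mult.assoc[symmetric] xp)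
  have w: "w i * (c a * y) = c a * (w i * y)" for i y
  proof -
    have "w i * c a = c a * w i"
      by (induction i rule: w.induct) (auto simp: c_comm_assoc mult.assoc)
    then show ?thesis by (simp flip: mult.assoc)
  qed
  have t: "smul (w i) (cst (ev (\<lambda>j. c a * p j)) - (\<lambda>j. c a * p j)) j = c a * smul (w i) (cst (ev p) - p) j" for i p j
    by (auto simp: e smul_def cst_def right_diff_distrib w)
  show "app (cE a * XE) v = app (XE * cE a) v"
    by (auto simp: app_cE app_XE Xop_def fun_eq_iff c_comm_assoc z t q distrib_left sum_distrib_left)
qed

lemma SE_SE: "1 \<le> m \<Longrightarrow> m \<le> K \<Longrightarrow> SE m * SE m = 1"
proof (rule endo_eq_on_basis)
  fix i p assume *: "1 \<le> m" "m \<le> K" "i \<le> K" "supp p"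
  consider "i < m - 1" | "i = m - 1" | "i = m" | "m < i" by linarith
  then show "app (SE m * SE m) (b i p) = app 1 (b i p)"
    by cases (use * in \<open>simp_all add: SE_b smul_smul S_S\<close>)
qed (simp add: SE_tail)

lemma SE_far: "1 \<le> m \<Longrightarrow> m + 1 < n \<Longrightarrow> n \<le> K \<Longrightarrow> SE m * SE n = SE n * SE m"
proof (rule endo_eq_on_basis)
  fix i p assume *: "1 \<le> m" "m + 1 < n" "n \<le> K" "i \<le> K" "supp p"
  have **: "m - 1 < n" "m - 1 \<noteq> n - 1" "m \<noteq> n - 1" "n - 1 \<noteq> m" "n \<noteq> m - 1" "n - 1 \<noteq> n"
    "\<not> n - 1 < m" "n - 1 \<noteq> m - 1" "\<not> n < m" "n \<noteq> m" "m \<noteq> n" "m < n" "m - 1 \<noteq> n"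
    using * by auto
  consider "i < m - 1" | "i = m - 1" | "i = m" | "m < i" "i < n - 1" | "i = n - 1" | "i = n" | "n < i"
    by linarith
  then show "app (SE m * SE n) (b i p) = app (SE n * SE m) (b i p)"
  proof cases
    case 1
    then have "i < m" "i < n" "i \<noteq> n - 1" using * by auto
    with 1 show ?thesis using * S_far[of "m - 1" "n - 1"] by (simp add: SE_b smul_smul)
  next
    case 4
    then have "i < n" "i \<noteq> m - 1" by auto
    with 4 show ?thesis using * S_far[of m "n - 1"] by (simp add: SE_b smul_smul)
  next
    case 7
    then have "m < i" "i \<noteq> m - 1" "i \<noteq> n - 1" using * by auto
    with 7 show ?thesis using * S_far[of m n] by (simp add: SE_b smul_smul)
  qed (use * ** in \<open>simp_all add: SE_b\<close>)
qed (simp add: SE_tail)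

lemma SE_braid: "1 \<le> m \<Longrightarrow> m + 1 \<le> K \<Longrightarrow> SE m * SE (m + 1) * SE m = SE (m + 1) * SE m * SE (m + 1)"
proof (rule endo_eq_on_basis)
  fix i p assume *: "1 \<le> m" "m + 1 \<le> K" "i \<le> K" "supp p"
  have **: "m - 1 \<noteq> m" "m + 1 \<noteq> m - 1" "m - 1 < m" "m - 1 < m + 1" "m \<noteq> m - 1" "\<not> m + 1 < m" "m - 1 \<noteq> m + 1"
    using * by auto
  consider "i < m - 1" | "i = m - 1" | "i = m" | "i = m + 1" | "m + 1 < i" by linarith
  then show "app (SE m * SE (m + 1) * SE m) (b i p) = app (SE (m + 1) * SE m * SE (m + 1)) (b i p)"
  proof cases
    case 1
    then have "i < m" "i < m + 1" by auto
    with 1 show ?thesis using * S_braid[of "m - 1"] by (simp add: SE_b smul_smul mult.assoc)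
  next
    case 5
    then have "i \<noteq> m - 1" by auto
    with 5 show ?thesis using * S_braid[of m] by (simp add: SE_b smul_smul mult.assoc)
  qed (use * ** in \<open>simp_all add: SE_b\<close>)
qed (simp add: SE_tail)

lemma SE_XE: "2 \<le> m \<Longrightarrow> m \<le> K \<Longrightarrow> SE m * XE = XE * SE m"
proof (rule endo_eq_on_basis)
  fix i p assume *: "2 \<le> m" "m \<le> K" "i \<le> K" "supp p"
  have **: "1 \<le> m" "m - Suc 0 \<noteq> 0" "0 < m" "0 \<noteq> m - 1" using * by auto
  have q: "q j * S n = S n * q j" for j n by (simp add: c_gen)
  consider "i = 0" | "1 \<le> i" "i < m - 1" | "1 \<le> i" "i = m - 1" | "i = m" | "m < i" by linarith
  then show "app (SE m * XE) (b i p) = app (XE * SE m) (b i p)"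
  proof cases
    case 1
    then show ?thesis using * ** zop_smul[of "S (m - 1)" p] by (simp add: SE_b XE_b_0 q)
  next
    case 2
    then have "i < m" by auto
    have A: "S (m - 1) * x = x * S (m - 1)" using S_L[of "m - 1" 1] * 2 by simp
    have B: "w i * S (m - 1) = S (m - 1) * w i"
      using S_w[of "m - 2" i] * 2 by (simp add: numeral_2_eq_2 Suc_diff_Suc)
    have C: "ev (smul (S (m - 1)) p) = S (m - 1) * ev p"
      by (rule ev_smul[OF A]) (simp add: q)
    have "app (SE m) (app XE (b i p)) = b i (smul (S (m - 1) * x) p)
        + b 0 (smul (S (m - 1) * w i) (cst (ev p) - p))"
      using * ** 2 \<open>i < m\<close> by (simp add: SE_b XE_b app_add smul_smul)
    also have "smul (S (m - 1) * w i) (cst (ev p) - p) = smul (w i) (cst (S (m - 1) * ev p) - smul (S (m - 1)) p)"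
      unfolding B[symmetric] by (simp add: smul_diff smul_cst smul_smul mult.assoc)
    also have "b i (smul (S (m - 1) * x) p) + b 0 \<dots> = app XE (app (SE m) (b i p))"
      using * ** 2 \<open>i < m\<close> C by (simp add: SE_b XE_b smul_smul A[simplified])
    finally show ?thesis by simp
  next
    case 3
    have w: "w m = S (m - 1) * w (m - 1)" using w_Suc[of "m - 1"] * by simp
    have m: "m - 1 \<noteq> m" "m - 1 \<le> K" "1 \<le> m - 1" "m - 1 \<noteq> 0" using * by auto
    have "app (SE m) (app XE (b (m - 1) p)) = b m (smul x p)
        + b 0 (smul (S (m - 1) * w (m - 1)) (cst (ev p) - p))"
      unfolding XE_b[OF m(3,2) *(4)] app_add using * ** m by (simp only: SE_b supp_simps smul_smul) simp
    also have "\<dots> = app XE (app (SE m) (b (m - 1) p))"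
      unfolding w[symmetric] using * ** m XE_b[of m p] by (simp only: SE_b) simp
    finally show ?thesis using 3 by simp
  next
    case 4
    have w: "S (m - 1) * w m = w (m - 1)"
      using w_Suc[of "m - 1"] S_S_assoc[of "m - 1" "w (m - 1)"] * by simp
    have m: "m - 1 \<noteq> m" "m - 1 \<le> K" "1 \<le> m - 1" "m - 1 \<noteq> 0" using * by auto
    have "app (SE m) (app XE (b m p)) = b (m - 1) (smul x p)
        + b 0 (smul (S (m - 1) * w m) (cst (ev p) - p))"
      unfolding XE_b[OF **(1) *(2) *(4)] app_add using * ** m by (simp only: SE_b supp_simps smul_smul) simp
    also have "\<dots> = app XE (app (SE m) (b m p))"
      unfolding w using * ** m XE_b[of "m - 1" p] by (simp only: SE_b) simp
    finally show ?thesis using 4 by simp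
  next
    case 5
    have A: "S m * x = x * S m" using S_L[of m 1] * 5 by simp
    have B: "w i * S m = S (m - 1) * w i" using w_S[of m i] * 5 by simp
    have C: "ev (smul (S m) p) = S m * ev p"
      by (rule ev_smul[OF A]) (simp add: q)
    have i: "1 \<le> i" "i \<noteq> m - 1" "1 \<le> m" "\<not> i < m" "i \<noteq> m" "m \<noteq> 0" using * 5 by auto
    have "app (SE m) (app XE (b i p)) = b i (smul (S m * x) p)
        + b 0 (smul (S (m - 1) * w i) (cst (ev p) - p))"
      using * ** 5 i by (simp add: SE_b XE_b app_add smul_smul)
    also have "smul (S (m - 1) * w i) (cst (ev p) - p) = smul (w i) (cst (S m * ev p) - smul (S m) p)"
      unfolding B[symmetric] by (simp add: smul_diff smul_cst smul_smul mult.assoc)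
    also have "b i (smul (S m * x) p) + b 0 \<dots> = app XE (app (SE m) (b i p))"
      using * ** 5 i C by (simp add: SE_b XE_b smul_smul A)
    finally show ?thesis by simp
  qed
next
  fix v :: "nat \<Rightarrow> nat \<Rightarrow> 'a" assume *: "2 \<le> m" "m \<le> K" and v: "\<And>i j. i \<le> K \<Longrightarrow> j < l \<Longrightarrow> v i j = 0"
  have "1 \<le> m" using * by simp
  with * v show "app (SE m * XE) v = app (XE * SE m) v"
    by (simp add: SE_tail XE_tail cE_tail)
qed

text \<open>At positions i >= 2 the operators of s_1 and L_1 have the diagonal entries
  \<open>S 1\<close> and x, so this is the diagonal entry of the operator of L_2 there. It equals
  the element L_2 of A, which is available since i <= K.\<close>

definition x2 :: 'a where "x2 = S 1 * x * S 1 + S 1"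

lemma x2_L: "2 \<le> K \<Longrightarrow> x2 = \<phi> (LGen 2)"
  using L_rec[of 1] by (simp add: x2_def numeral_2_eq_2)

lemma q_x2: "q j * x2 = x2 * q j"
  unfolding x2_def by (intro commutes_add[symmetric] commutes_mult) (simp_all add: c_gen)

lemma x_x2: "2 \<le> K \<Longrightarrow> x2 * x = x * x2"
  using L_L[of 1 2] by (simp add: x2_L)

lemma w_x2:
  assumes "2 \<le> i" "i \<le> K"
  shows "w i * x2 = x * w i + w' i"
proof -
  have "S 1 * x2 = x * S 1 + 1"
    using S_L_Suc[of 1] assms by (simp add: x2_L numeral_2_eq_2)
  then have "w' i * (S 1 * x2) = w' i * x * S 1 + w' i"
    by (simp add: distrib_left mult.assoc)
  then show ?thesis using assms by (simp add: w_w' w'_x mult.assoc)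
qed

definition L2 :: "(nat \<Rightarrow> nat \<Rightarrow> 'a) endo" where "L2 = SE 1 * XE * SE 1 + SE 1"

lemma L2_b_0: "1 \<le> K \<Longrightarrow> supp p \<Longrightarrow> app L2 (b 0 p) = b 0 (smul x p) + b 1 (cst (ev p))"
  by (simp add: L2_def SE_b XE_b app_add) (simp add: b_diff)

lemma L2_b_1: "1 \<le> K \<Longrightarrow> supp p \<Longrightarrow> app L2 (b 1 p) = b 1 (zop p) + b 0 p"
  by (simp add: L2_def SE_b XE_b_0 app_add)

lemma L2_b:
  assumes "2 \<le> i" "i \<le> K" "supp p"
  shows "app L2 (b i p) = b i (smul x2 p) + b 1 (smul (w i) (cst (ev (smul (S 1) p)) - smul (S 1) p))"
proof -
  have "1 \<le> K" "1 \<le> i" "\<not> i = 1" "\<not> i < 1" "\<not> i = 0" using assms by auto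
  with assms show ?thesis
    by (simp add: L2_def SE_b XE_b app_add smul_smul x2_def smul_add_left mult.assoc b_add add_ac)
qed

text \<open>Starting from position i, both operators reach only positions 0, 1 and i. For i <= 1 the
  comparison rests on substitution turning multiplication by z into multiplication by x; for i >= 2
  it rests on the commutation of L_1 and L_2 in A.\<close>

lemma XE_L2: "1 \<le> K \<Longrightarrow> XE * L2 = L2 * XE"
proof (rule endo_eq_on_basis)
  fix i p assume *: "1 \<le> K" "i \<le> K" "supp p"
  have zx: "zop (smul x p) = smul x (zop p)" by (rule zop_smul) (simp add: c_gen)
  consider "i = 0" | "i = 1" | "2 \<le> i" by linarith
  then show "app (XE * L2) (b i p) = app (L2 * XE) (b i p)"
  proof cases
    case 1
    then show ?thesis using *
      by (simp add: L2_b_0 XE_b_0 XE_b app_add zx ev_zop smul_cst ev_cst)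
  next
    case 2
    have "app (L2 * XE) (b 1 p) = app L2 (b 1 (smul x p)) + app L2 (b 0 (cst (ev p) - p))"
      using * by (simp add: XE_b app_add)
    also have "\<dots> = b 1 (zop (smul x p)) + b 0 (smul x p)
        + (b 0 (smul x (cst (ev p) - p)) + b 1 (cst (ev (cst (ev p) - p))))"
      using * L2_b_1[of "smul x p"] L2_b_0[of "cst (ev p) - p"] by simp
    also have "\<dots> = b 1 (smul x (zop p)) + b 0 (cst (x * ev p))"
      by (simp add: zx ev_diff ev_cst smul_diff b_diff smul_cst)
    finally have 1: "app (L2 * XE) (b 1 p) = b 1 (smul x (zop p)) + b 0 (cst (x * ev p))" .
    have "app (XE * L2) (b 1 p) = app XE (b 1 (zop p)) + app XE (b 0 p)"
      using * L2_b_1[of p] by (simp add: app_add)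
    also have "\<dots> = b 1 (smul x (zop p)) + b 0 (cst (x * ev p))"
      using * XE_b[of 1 "zop p"] by (simp add: XE_b_0 ev_zop b_diff)
    finally show ?thesis using 1 2 by simp
  next
    case 3
    \<comment> \<open>\<open>r\<close> is the entry at position 1 of L_2 applied to
      \<open>b i p\<close>, and \<open>r0\<close> is the entry at position 0 of L_1 applied to
      \<open>b i p\<close>. The facts A, B and C below compare the two sides at positions i, 0 and 1
      respectively.\<close>
    define e1 where "e1 = ev (smul (S 1) p)"
    define r where "r = smul (w i) (cst e1 - smul (S 1) p)"
    define r0 where "r0 = smul (w i) (cst (ev p) - p)"
    have K: "2 \<le> K" and i: "1 \<le> i" "i \<le> K" using 3 * by auto
    have supp: "supp r" "supp r0" using * by (simp_all add: r_def r0_def)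
    have w'S: "w i * S 1 = w' i"
      using S_S[of 1] K 3 by (simp add: w_w' mult.assoc)
    have w'x: "w' i * x = x * w' i" using w'_x 3 i by simp
    have q': "q j * w' i = w' i * q j" for j by (rule q_w')
    have ew': "ev (smul (w' i) p') = w' i * ev p'" for p' by (rule ev_smul[OF w'x q'])
    have ev_r: "ev r = w i * e1 - w' i * ev p"
      by (simp add: r_def smul_diff smul_cst ev_diff ev_cst smul_smul w'S[simplified] ew')
    have ev_r0: "ev r0 = w i * ev p - w' i * e1"
    proof -
      have "ev (smul (w i) p) = w' i * e1"
        using 3 by (simp add: w_w' e1_def flip: smul_smul ew')
      then show ?thesis by (simp add: r0_def smul_diff smul_cst ev_diff ev_cst)
    qed
    have ev_x2: "ev (smul x2 p) = x2 * ev p"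
      by (rule ev_smul) (use x_x2 K q_x2 in auto)
    have A: "smul x (smul x2 p) = smul x2 (smul x p)"
      using x_x2[OF K] by (simp add: smul_smul)
    have B: "smul (w i) (cst (ev (smul x2 p)) - smul x2 p) + (cst (ev r) - r) = smul x r0"
    proof -
      have 1: "smul (w i) (cst (ev (smul x2 p)) - smul x2 p)
          = cst ((x * w i + w' i) * ev p) - smul (x * w i + w' i) p"
        using w_x2[of i] 3 i by (simp add: ev_x2 smul_diff smul_cst smul_smul flip: mult.assoc)
      have r: "r = cst (w i * e1) - smul (w' i) p"
        using w'S by (simp add: r_def smul_diff smul_cst smul_smul)
      have r': "cst (ev r) - r = smul (w' i) p - cst (w' i * ev p)"
        unfolding ev_r by (subst r) (simp add: cst_diff)
      have 2: "smul x r0 = cst (x * w i * ev p) - smul (x * w i) p"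
        by (simp add: r0_def smul_diff smul_cst smul_smul mult.assoc)
      show ?thesis
        unfolding r' 1 2 by (simp add: cst_add distrib_right smul_add_left)
    qed
    have C: "smul x r = smul (w i) (cst (ev (smul (S 1) (smul x p))) - smul (S 1) (smul x p)) + cst (ev r0)"
    proof -
      have "smul x r = cst (x * w i * e1) - smul (x * w' i) p"
        using w'S by (simp add: r_def smul_diff smul_cst smul_smul mult.assoc)
      also have "x * w i * e1 = w' i * (x * (S 1 * e1))"
        using 3 by (simp add: w_w' w'x flip: mult.assoc)
      also have "\<dots> = w' i * S 1 * ev (smul (S 1 * x) p) + w' i * S 1 * ev p - w' i * e1"
        unfolding e1_def x_S_ev_S[OF K] by (simp add: distrib_left right_diff_distrib mult.assoc)
      also have "\<dots> = w i * ev (smul (S 1 * x) p) + ev r0"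
        using 3 by (simp add: w_w' ev_r0)
      finally have "smul x r = cst (w i * ev (smul (S 1 * x) p) + ev r0) - smul (x * w' i) p" .
      moreover have "smul (w i) (smul (S 1) (smul x p)) = smul (x * w' i) p"
        using w'S w'x by (simp add: smul_smul flip: mult.assoc)
      ultimately show ?thesis
        by (simp add: smul_diff smul_cst cst_add smul_smul)
    qed
    have "app (XE * L2) (b i p) = app XE (b i (smul x2 p)) + app XE (b 1 r)"
      using 3 i * by (simp add: L2_b app_add r_def e1_def)
    also have "\<dots> = b i (smul x (smul x2 p)) + b 0 (smul (w i) (cst (ev (smul x2 p)) - smul x2 p))
        + (b 1 (smul x r) + b 0 (cst (ev r) - r))"
      using XE_b[of i "smul x2 p"] XE_b[of 1 r] K i supp * by simp
    also have "\<dots> = b i (smul x2 (smul x p)) + b 1 (smul x r)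
        + b 0 (smul (w i) (cst (ev (smul x2 p)) - smul x2 p) + (cst (ev r) - r))"
      unfolding A by (simp add: b_add add_ac)
    also have "\<dots> = b i (smul x2 (smul x p))
        + b 1 (smul (w i) (cst (ev (smul (S 1) (smul x p))) - smul (S 1) (smul x p)) + cst (ev r0))
        + b 0 (smul x r0)"
      by (simp only: B C)
    also have "\<dots> = app L2 (b i (smul x p)) + app L2 (b 0 r0)"
      using L2_b[of i "smul x p"] L2_b_0[of r0] 3 K i supp * by (simp add: b_add add_ac)
    also have "\<dots> = app (L2 * XE) (b i p)"
      using i * by (simp add: XE_b app_add r0_def)
    finally show ?thesis .
  qed
next
  fix v :: "nat \<Rightarrow> nat \<Rightarrow> 'a" assume *: "1 \<le> K" and v: "\<And>i j. i \<le> K \<Longrightarrow> j < l \<Longrightarrow> v i j = 0"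
  then show "app (XE * L2) v = app (L2 * XE) v"
    by (simp add: L2_def SE_tail XE_tail cE_tail app_add)
qed

end

context induced_module
begin

definition gE :: "nat \<Rightarrow> (nat \<Rightarrow> nat \<Rightarrow> 'a) endo" where "gE j = XE - cE (u j)"

definition fE :: "(nat \<Rightarrow> nat \<Rightarrow> 'a) endo" where "fE = prod_list (map gE [1..<Suc l])"

definition unit_poly :: "nat \<Rightarrow> 'a \<Rightarrow> nat \<Rightarrow> 'a" where "unit_poly j a = (\<lambda>j'. if j' = j then a else 0)"

lemma supp_unit_poly [simp]: "j < l \<Longrightarrow> supp (unit_poly j a)"
  by (simp add: supp_def unit_poly_def)

lemma cE_cE: "cE a * cE a' = cE a' * cE a"
  by (rule endo_eqI) (auto simp: app_cE fun_eq_iff mult.assoc[symmetric] c_comm)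

lemma fE_commute: "t * XE = XE * t \<Longrightarrow> (\<And>a. t * cE a = cE a * t) \<Longrightarrow> fE * t = t * fE"
  unfolding fE_def gE_def by (rule commutes_prod_list) (auto intro!: commutes_diff)

lemma gE_gE: "gE i * gE j = gE j * gE i"
  unfolding gE_def
  by (intro commutes_diff commutes_diff[symmetric]) (simp_all add: cE_XE cE_cE)

lemma fE_gE: "fE * gE j = gE j * fE"
  by (rule fE_commute) (auto simp: gE_def cE_XE cE_cE intro!: commutes_diff)

text \<open>\<open>unit_poly j\<close> is the coefficient sequence of (z - q_1)...(z - q_j), which
  the next factor turns into its successor, and into f = 0 for j + 1 = l. Applied one after the
  other, all factors together therefore kill the constants.\<close>

lemma gE_unit:
  assumes "j < l"
  shows "app (gE (Suc j)) (b 0 (unit_poly j a)) = b 0 (if Suc j < l then unit_poly (Suc j) a else 0)"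
  using assms by (simp add: gE_def XE_b_0 cE_b flip: b_diff)
    (auto simp: b_def fun_eq_iff zop_def unit_poly_def smul_def)

lemma GE_unit:
  "j \<le> l \<Longrightarrow> app (prod_list (map gE (rev [1..<Suc j]))) (b 0 (unit_poly 0 a))
     = b 0 (if j < l then unit_poly j a else 0)"
proof (induction j)
  case (Suc j)
  then show ?case using gE_unit[of j a] by simp
qed (use l_pos in simp)

lemma fE_rev: "fE = prod_list (map gE (rev [1..<Suc l]))"
  unfolding fE_def rev_map[symmetric]
  by (rule prod_list_rev_commuting[symmetric]) (auto simp: gE_gE)

text \<open>The vector is the image of a constant under the first j factors of f(L_1), and these
  commute with f(L_1), which kills the constant.\<close>

lemma fE_unit: "j < l \<Longrightarrow> app fE (b 0 (unit_poly j a)) = 0"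
proof -
  assume j: "j < l"
  have 0: "app fE (b 0 (unit_poly 0 a)) = 0"
    unfolding fE_rev using GE_unit[of l a] by simp
  have "fE * prod_list (map gE (rev [1..<Suc j])) = prod_list (map gE (rev [1..<Suc j])) * fE"
    by (rule commutes_prod_list[symmetric]) (auto simp: fE_gE)
  then have "app fE (app (prod_list (map gE (rev [1..<Suc j]))) (b 0 (unit_poly 0 a)))
      = app (prod_list (map gE (rev [1..<Suc j]))) (app fE (b 0 (unit_poly 0 a)))"
    by (metis app_simps(6))
  then show ?thesis using GE_unit[of j a] j 0 by simp
qed

lemma supp_expand: "supp p \<Longrightarrow> b i p = (\<Sum>j<l. b i (unit_poly j (p j)))"
proof -
  assume p: "supp p"
  have sum_app: "sum h A i' j' = (\<Sum>j\<in>A. h j i' j')" for h :: "nat \<Rightarrow> nat \<Rightarrow> nat \<Rightarrow> 'a" and A i' j'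
    by (induction A rule: infinite_finite_induct) auto
  have "b i p i' j' = (\<Sum>j<l. b i (unit_poly j (p j)) i' j')" for i' j'
  proof -
    have "(\<Sum>j<l. b i (unit_poly j (p j)) i' j') = (\<Sum>j<l. if j = j' then (if i' = i then p j' else 0) else 0)"
      by (rule sum.cong) (auto simp: b_def unit_poly_def)
    then show ?thesis using p by (auto simp: b_def supp_def)
  qed
  then show ?thesis by (simp add: fun_eq_iff sum_app)
qed

lemma fE_b_0: "supp p \<Longrightarrow> app fE (b 0 p) = 0"
  by (subst supp_expand) (simp_all add: app_sum fE_unit)

text \<open>Substitution leaves a constant unchanged, so the contribution of L_1 to position 0
  cancels and only left multiplication by x remains.\<close>

lemma gE_list_cst:
  assumes "1 \<le> K"
  shows "app (prod_list (map gE js)) (b 1 (cst a)) = b 1 (cst (prod_list (map (\<lambda>j. x - q j) js) * a))"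
proof (induction js)
  case (Cons j js)
  have "app (gE j) (b 1 (cst a')) = b 1 (cst ((x - q j) * a'))" for a'
  proof -
    have "app XE (b 1 (cst a')) = b 1 (cst (x * a'))"
      using XE_b[of 1 "cst a'"] assms by (simp add: ev_cst smul_cst)
    then show ?thesis
      by (simp add: gE_def cE_b smul_cst left_diff_distrib cst_diff b_diff)
  qed
  with Cons show ?case by (simp add: mult.assoc)
qed simp

lemma fE_L2: "1 \<le> K \<Longrightarrow> fE * L2 = L2 * fE"
  using XE_L2 by (intro fE_commute)
    (auto simp: L2_def cE_XE cE_SE intro!: commutes_add commutes_mult)

text \<open>At position 1, multiplication by z is L_2 up to a term at position 0, where f(L_1) is
  already known to vanish. As L_2 commutes with f(L_1), the claim passes from each basis polynomial
  to the next, starting from the constants, on which f(L_1) acts by f(x) = 0.\<close>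

lemma fE_b_1:
  assumes K: "1 \<le> K" and p: "supp p"
  shows "app fE (b 1 p) = 0"
proof -
  have zop: "app fE (b 1 (zop p)) = app L2 (app fE (b 1 p))" if "supp p" for p
  proof -
    have "app fE (b 1 (zop p)) = app fE (app L2 (b 1 p) - b 0 p)"
      using L2_b_1[OF K that] by simp
    also have "\<dots> = app fE (app L2 (b 1 p))" by (simp add: app_diff fE_b_0 that)
    also have "\<dots> = app L2 (app fE (b 1 p))"
      using fE_L2[OF K] by (metis app_simps(6))
    finally show ?thesis .
  qed
  have fE_cE: "app fE (app (cE a) v) = app (cE a) (app fE v)" for a v
    using fE_commute[of "cE a"] by (metis app_simps(6) cE_XE cE_cE)
  have "app fE (b 1 (unit_poly j a)) = 0" if "j < l" for j a
    using that
  proof (induction j)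
    case 0
    have "unit_poly 0 a = cst a" by (simp add: unit_poly_def cst_def)
    then show ?case using cyclotomic[OF K] gE_list_cst[OF K, of "[1..<Suc l]" a]
      by (simp add: fE_def del: upt_Suc)
  next
    case (Suc j)
    have "unit_poly (Suc j) a = zop (unit_poly j a) - smul (q (Suc j)) (unit_poly j a)"
      using Suc.prems by (auto simp: unit_poly_def zop_def smul_def fun_eq_iff)
    then have "b 1 (unit_poly (Suc j) a) = b 1 (zop (unit_poly j a)) - app (cE (u (Suc j))) (b 1 (unit_poly j a))"
      by (simp add: b_diff cE_b)
    moreover have "app fE (b 1 (unit_poly j a)) = 0" "supp (unit_poly j a)"
      using Suc.IH Suc.prems by (metis Suc_lessD, simp)
    ultimately show ?case by (simp only: app_diff zop fE_cE app_0 diff_self)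
  qed
  then show ?thesis using p by (subst supp_expand) (simp_all add: app_sum)
qed

text \<open>Position i + 1 is reached from position i by s_{i+1}, which commutes with L_1 when i >=
  1. From 0 to 1 this fails, hence the separate argument with L_2 there.\<close>

lemma fE_b: "i \<le> K \<Longrightarrow> supp p \<Longrightarrow> app fE (b i p) = 0"
proof (induction i)
  case (Suc i)
  show ?case
  proof (cases "i = 0")
    case True
    then show ?thesis using fE_b_1 Suc.prems by simp
  next
    case False
    have "b (Suc i) p = app (SE (Suc i)) (b i p)"
      using SE_b[of "Suc i" i p] Suc.prems False by simp
    moreover have "fE * SE (Suc i) = SE (Suc i) * fE"
      using SE_XE[of "Suc i"] Suc.prems False by (intro fE_commute) (auto simp: cE_SE)
    then have "app fE (app (SE (Suc i)) (b i p)) = app (SE (Suc i)) (app fE (b i p))"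
      by (metis app_simps(6))
    moreover have "app fE (b i p) = 0" using Suc.IH Suc.prems by (metis Suc_leD)
    ultimately show ?thesis by (simp only: app_0)
  qed
qed (simp add: fE_b_0)

lemma fE_0: "fE = 0"
proof (rule endo_eq_on_basis)
  fix i p assume "i \<le> K" "supp p"
  then show "app fE (b i p) = app 0 (b i p)" by (simp add: fE_b)
next
  fix v :: "nat \<Rightarrow> nat \<Rightarrow> 'a" assume v: "\<And>i j. i \<le> K \<Longrightarrow> j < l \<Longrightarrow> v i j = 0"
  \<comment> \<open>Outside the range L_1 acts as q_1, so the factor with index 1 kills the vector;
    in the reversed product it is the one applied before all others.\<close>
  have "app (gE 1) v = 0" using XE_tail[OF v] by (simp add: gE_def)
  moreover have "fE = prod_list (map gE (rev [Suc 1..<Suc l])) * gE 1"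
    unfolding fE_rev using l_pos by (subst upt_conv_Cons) (simp_all del: upt_Suc)
  ultimately show "app fE v = app 0 v" by (simp only: app_simps app_0)
qed

theorem induced_relations:
  "hecke_relations (\<lambda>i. \<phi>E (SGen i)) (\<lambda>i. \<phi>E (LGen i)) (\<lambda>j. cE (u j)) l (Suc K)"
proof (rule hecke_relationsI)
  show "prod_list (map (\<lambda>j. \<phi>E (LGen 1) - cE (u j)) [1..<Suc l]) = 0"
    using fE_0 by (simp add: fE_def gE_def[abs_def] \<phi>E_def del: upt_Suc)
next
  fix i assume "1 \<le> i" "i < Suc K"
  then show "\<phi>E (SGen i) * \<phi>E (SGen i) = 1" by (simp add: \<phi>E_def SE_SE)
next
  fix i j assume "1 \<le> i" "i + 1 < j" "j < Suc K"
  then show "\<phi>E (SGen i) * \<phi>E (SGen j) = \<phi>E (SGen j) * \<phi>E (SGen i)"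
    using SE_far[of i j] by (simp add: \<phi>E_def)
next
  fix i assume "1 \<le> i" "i + 1 < Suc K"
  then show "\<phi>E (SGen i) * \<phi>E (SGen (i + 1)) * \<phi>E (SGen i)
    = \<phi>E (SGen (i + 1)) * \<phi>E (SGen i) * \<phi>E (SGen (i + 1))"
    using SE_braid[of i] by (simp add: \<phi>E_def)
next
  fix i assume "2 \<le> i" "i < Suc K"
  then show "\<phi>E (SGen i) * \<phi>E (LGen 1) = \<phi>E (LGen 1) * \<phi>E (SGen i)"
    using SE_XE[of i] by (simp add: \<phi>E_def)
next
  assume "2 \<le> Suc K"
  then show "\<phi>E (LGen 1) * \<phi>E (LGen 2) = \<phi>E (LGen 2) * \<phi>E (LGen 1)"
    using XE_L2 by (simp add: \<phi>E_def L2_def numeral_2_eq_2)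
next
  fix i :: nat assume "1 \<le> i" "i < Suc K"
  then show "\<phi>E (LGen (i + 1)) = \<phi>E (SGen i) * \<phi>E (LGen i) * \<phi>E (SGen i) + \<phi>E (SGen i)"
    by (cases i) (simp_all add: \<phi>E_def)
next
  fix i j
  show "cE (u j) * \<phi>E (SGen i) = \<phi>E (SGen i) * cE (u j)" by (simp add: \<phi>E_def cE_SE)
next
  fix j
  show "cE (u j) * \<phi>E (LGen 1) = \<phi>E (LGen 1) * cE (u j)" by (simp add: \<phi>E_def cE_XE)
next
  fix i j show "cE (u i) * cE (u j) = cE (u j) * cE (u i)" by (rule cE_cE)
qed

sublocale E: evaluation cE \<phi>E
proof
  show "cE 1 = 1" by (rule endo_eqI) (simp add: app_cE)
  show "cE (a + a') = cE a + cE a'" for a a'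
    by (rule endo_eqI) (simp add: app_cE c_add distrib_right fun_eq_iff)
  show "cE (a * a') = cE a * cE a'" for a a'
    by (rule endo_eqI) (simp add: app_cE c_mult mult.assoc fun_eq_iff)
  have LE: "cE a * LE i = LE i * cE a" for a i
    by (induction i rule: LE.induct)
      (auto simp: cE_XE cE_SE intro!: commutes_add[symmetric] commutes_mult)
  show "cE a * \<phi>E g = \<phi>E g * cE a" for a g
    by (cases g) (simp_all add: \<phi>E_def cE_SE LE)
qed

sublocale R: hecke_relations "\<lambda>i. \<phi>E (SGen i)" "\<lambda>i. \<phi>E (LGen i)" "\<lambda>j. cE (u j)" l "Suc K"
  by (rule induced_relations)

subsection \<open>The coefficient functional\<close>

text \<open>\<open>b K (cst 1)\<close> is the formal element s_K...s_1 s_1...s_K, that is, the unit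
  of H_{l,K+1}. The entry with index l - 1 is the coefficient of z^{l-1}, because the basis
  polynomials are monic with increasing degrees.\<close>

definition coeff :: "(word \<Rightarrow>\<^sub>0 'r) \<Rightarrow> 'a" where
  "coeff h = app (E.eval_free h) (b K (cst 1)) K (l - 1)"

lemma coeff_add: "coeff (h + h') = coeff h + coeff h'"
  by (simp add: coeff_def E.eval_add)

lemma coeff_ideal: "h \<in> rel_ideal l u (Suc K) \<Longrightarrow> coeff h = 0"
  unfolding coeff_def using E.eval_rel_ideal[OF induced_relations] by simp

lemma LE_rec: "1 \<le> i \<Longrightarrow> LE (Suc i) = SE i * LE i * SE i + SE i"
  by (cases i) auto

lemma L_position_K:
  "1 \<le> i \<Longrightarrow> i \<le> K \<Longrightarrow> j < l \<Longrightarrow> app (LE i) v K j = \<phi> (LGen i) * v K j"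
proof (induction i arbitrary: v rule: dec_induct)
  case base
  then show ?case by (simp add: app_XE Xop_def)
next
  case (step i)
  have "K \<noteq> i" "K \<noteq> i - 1" "\<not> K < i" "1 \<le> i" "i \<le> K" using step by auto
  then have S: "app (SE i) v' K j = S i * v' K j" for v'
    using step.prems by (simp add: app_SE Sop_def)
  show ?case using step L_rec[of i]
    by (simp add: LE_rec S distrib_right mult.assoc)
qed

text \<open>The s_i with i < K do not exchange position K with another one, and L_1 carries vectors
  from other positions only into position 0. So generators of A act on the entry at K by left
  multiplication.\<close>

lemma eval_position_K:
  assumes "y \<in> carrier (free_alg K)" "j < l"
  shows "app (E.eval_free y) v K j = eval_free y * v K j"
  using assms(1)
proof (induction y arbitrary: v rule: free_alg_induct)
  case (const a)
  then show ?case by (simp add: E.eval_const eval_const app_cE)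
next
  case (s i)
  then have "K \<noteq> i" "K \<noteq> i - 1" "\<not> K < i" "1 \<le> i" "i \<le> K" by auto
  then show ?case using assms(2) by (simp only: E.eval_s eval_s) (simp add: \<phi>E_def app_SE Sop_def)
next
  case (L i)
  then show ?case using assms(2) by (simp only: E.eval_L eval_L) (simp add: \<phi>E_def L_position_K)
qed (simp_all add: E.eval_add eval_add E.eval_mult eval_mult distrib_right mult.assoc)

lemma L_cst:
  "1 \<le> i \<Longrightarrow> i \<le> K \<Longrightarrow> app (LE i) (b K (cst a)) = b K (cst (\<phi> (LGen i) * a))"
proof (induction i arbitrary: a rule: dec_induct)
  case base
  then show ?case by (simp add: XE_b ev_cst smul_cst)
next
  case (step i)
  have "K \<noteq> i" "K \<noteq> i - 1" "\<not> K < i" "1 \<le> i" "i \<le> K" using step by auto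
  then have S: "app (SE i) (b K (cst a')) = b K (cst (S i * a'))" for a'
    by (simp add: SE_b smul_cst)
  have "app (LE (Suc i)) (b K (cst a)) = b K (cst (\<phi> (LGen (Suc i)) * a))"
    using step L_rec[of i] by (simp add: LE_rec S distrib_right mult.assoc cst_add b_add)
  then show ?case .
qed

text \<open>This realizes A inside the module as A applied to the unit: on constants the
  contribution of L_1 to position 0 cancels.\<close>

lemma eval_cst:
  assumes "y \<in> carrier (free_alg K)"
  shows "app (E.eval_free y) (b K (cst a)) = b K (cst (eval_free y * a))"
  using assms
proof (induction y arbitrary: a rule: free_alg_induct)
  case (const a)
  then show ?case by (simp add: E.eval_const eval_const cE_b smul_cst)
next
  case (s i)
  then have "K \<noteq> i" "K \<noteq> i - 1" "\<not> K < i" "1 \<le> i" "i \<le> K" by auto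
  then show ?case by (simp only: E.eval_s eval_s) (simp add: \<phi>E_def SE_b smul_cst)
next
  case (L i)
  then show ?case by (simp only: E.eval_L eval_L) (simp add: \<phi>E_def L_cst)
qed (simp_all add: E.eval_add eval_add E.eval_mult eval_mult distrib_right mult.assoc cst_add b_add)

text \<open>The right factor from A keeps the vector a constant at position K, s_K moves it to
  position K - 1, and the left factor only multiplies the entry at K, which is now 0.\<close>

lemma coeff_HsH:
  assumes "1 \<le> K" "y \<in> carrier (free_alg K)" "y' \<in> carrier (free_alg K)"
  shows "coeff (y * s_free K * y') = 0"
proof -
  have "app (SE K) (b K (cst a)) = b (K - 1) (cst a)" for a
    using assms(1) by (simp add: SE_b)
  moreover have "K \<noteq> K - Suc 0" using assms(1) by simp
  ultimately show ?thesis using assms l_pos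
    by (simp add: coeff_def E.eval_mult eval_position_K eval_cst E.eval_s) (simp add: \<phi>E_def b_def)
qed

definition W :: "nat \<Rightarrow> (nat \<Rightarrow> nat \<Rightarrow> 'a) set" where
  "W r = {v. (\<forall>i\<ge>r. v i = 0) \<and> (\<forall>i. supp (v i))}"

lemma W_add: "v \<in> W r \<Longrightarrow> v' \<in> W r \<Longrightarrow> v + v' \<in> W r"
  by (simp add: W_def)

lemma W_mono: "v \<in> W r \<Longrightarrow> r \<le> r' \<Longrightarrow> v \<in> W r'"
  by (simp add: W_def)

lemma supp_0 [simp]: "supp 0"
  by (simp add: supp_def)

lemma b_W: "supp p \<Longrightarrow> i < r \<Longrightarrow> b i p \<in> W r"
  by (simp add: W_def b_def)

lemma W_split:
  assumes "v \<in> W (Suc r)"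
  obtains v' where "v' \<in> W r" "v = v' + b r (v r)" "supp (v r)"
proof
  show "v(r := 0) \<in> W r" using assms by (auto simp: W_def le_less_Suc_eq not_less_eq_eq)
  show "v = v(r := 0) + b r (v r)" by (auto simp: b_def fun_eq_iff)
  show "supp (v r)" using assms by (simp add: W_def)
qed

lemma SE_apply:
  assumes "1 \<le> m" "m \<le> K" "i \<le> K" "\<And>i. supp (v i)"
  shows "app (SE m) v i = (if i = m then v (m - 1) else if i = m - 1 then v m
     else if i < m then smul (S (m - 1)) (v i) else smul (S m) (v i))"
  using assms unfolding app_SE[OF assms(1,2)] by (auto simp: Sop_def fun_eq_iff smul_def supp_def)

lemma SE_W:
  assumes "1 \<le> m" "m \<le> K" "v \<in> W r" "r \<noteq> m" "r \<le> Suc K"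
  shows "app (SE m) v \<in> W r"
proof -
  have v: "\<And>i. supp (v i)" "\<And>i. r \<le> i \<Longrightarrow> v i = 0" using assms(3) by (auto simp: W_def)
  have "app (SE m) v i = 0" if "r \<le> i" for i
  proof (cases "i \<le> K")
    case True
    then show ?thesis using that assms v(2) by (auto simp: SE_apply[OF assms(1,2) True v(1)])
  next
    case False
    then show ?thesis using that assms v by (auto simp: app_SE Sop_def fun_eq_iff)
  qed
  moreover have "supp (app (SE m) v i)" for i
    using v by (cases "i \<le> K") (auto simp: app_SE[OF assms(1,2)] Sop_def supp_def)
  ultimately show ?thesis by (simp add: W_def)
qed

text \<open>The third claim makes the second one inductive. A part p of the vector at position m - 1
  is moved by s_m to position m; L_m returns \<open>cst a' - p\<close> at m - 1; s_m moves this to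
  m, and there the summand s_m in L_{m+1} = s_m L_m s_m + s_m contributes p. What remains at
  position m is constant, so it cannot disturb the coefficients of positive degree.\<close>

lemma L_triangular:
  assumes "1 \<le> m" "m \<le> Suc K"
  shows "(\<forall>p. supp p \<longrightarrow> app (LE m) (b (m - 1) p) - b (m - 1) (zop p) \<in> W (m - 1))
     \<and> (\<forall>t \<in> W (m - 1). app (LE m) t \<in> W m \<and> (\<exists>a. app (LE m) t (m - 1) = cst a))
     \<and> (m \<le> K \<longrightarrow> (\<forall>p. supp p \<longrightarrow> app (LE m) (b m p) \<in> W (m + 1)
          \<and> (\<exists>a. app (LE m) (b m p) (m - 1) = cst a - p)))"
  using assms
proof (induction m rule: dec_induct)
  case base
  have W0: "t = 0" if "t \<in> W 0" for t using that by (auto simp: W_def fun_eq_iff)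
  have 1: "app XE (b 0 p) - b 0 (zop p) \<in> W 0" if "supp p" for p
    using that by (simp add: XE_b_0 W_def)
  have 2: "app XE t \<in> W 1 \<and> (\<exists>a. app XE t 0 = cst a)" if "t \<in> W 0" for t
  proof -
    have "app XE t = 0" using W0[OF that] by (metis app_0)
    then show ?thesis by (auto simp: W_def intro: exI[of _ 0])
  qed
  have "app XE (b 1 p) \<in> W 2 \<and> (\<exists>a. app XE (b 1 p) 0 = cst a - p)" if "1 \<le> K" "supp p" for p
  proof -
    have X: "app XE (b 1 p) = b 1 (smul x p) + b 0 (cst (ev p) - p)"
      using XE_b[of 1 p] that by simp
    have "app XE (b 1 p) 0 = cst (ev p) - p" unfolding X by (simp add: b_def)
    moreover have "app XE (b 1 p) \<in> W 2" unfolding X using that by (intro W_add b_W) auto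
    ultimately show ?thesis by blast
  qed
  with 1 2 have "(\<forall>p. supp p \<longrightarrow> app (LE 1) (b (1 - 1) p) - b (1 - 1) (zop p) \<in> W (1 - 1))
     \<and> (\<forall>t \<in> W (1 - 1). app (LE 1) t \<in> W 1 \<and> (\<exists>a. app (LE 1) t (1 - 1) = cst a))
     \<and> (1 \<le> K \<longrightarrow> (\<forall>p. supp p \<longrightarrow> app (LE 1) (b 1 p) \<in> W (1 + 1)
          \<and> (\<exists>a. app (LE 1) (b 1 p) (1 - 1) = cst a - p)))"
    by (simp add: numeral_2_eq_2)
  then show ?case .
next
  case (step m)
  then have m: "1 \<le> m" "m \<le> K" by auto
  note IH = step.IH[OF m(2)[THEN le_SucI]]
  have IH1: "app (LE m) (b (m - 1) p) - b (m - 1) (zop p) \<in> W (m - 1)" if "supp p" for p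
    using IH that by blast
  have IH2: "app (LE m) t \<in> W m" "\<exists>a. app (LE m) t (m - 1) = cst a" if "t \<in> W (m - 1)" for t
    using IH that by blast+
  have IH3: "app (LE m) (b m p) \<in> W (m + 1)" "\<exists>a. app (LE m) (b m p) (m - 1) = cst a - p" if "supp p" for p
    using IH that m by blast+
  have LE: "app (LE (Suc m)) v = app (SE m) (app (LE m) (app (SE m) v)) + app (SE m) v" for v
    using m by (simp add: LE_rec)
  have Sm: "app (SE m) v \<in> W (m - 1)" if "v \<in> W (m - 1)" for v
    using SE_W[OF m that] m by auto
  have Sb: "app (SE m) (b m p) = b (m - 1) p" "app (SE m) (b (m - 1) p) = b m p" if "supp p" for p
    using that m by (auto simp: SE_b)
  have 1: "app (LE (Suc m)) (b m p) - b m (zop p) \<in> W m" if p: "supp p" for p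
  proof -
    let ?t = "app (LE m) (b (m - 1) p) - b (m - 1) (zop p)"
    have "app (LE (Suc m)) (b m p) = app (SE m) (b (m - 1) (zop p) + ?t) + b (m - 1) p"
      using p by (simp add: LE Sb)
    also have "\<dots> = b m (zop p) + (app (SE m) ?t + b (m - 1) p)"
      using Sb(2)[OF supp_simps(3)[of p]] unfolding app_add by (simp add: add.assoc)
    finally show ?thesis
      using W_mono[OF Sm[OF IH1[OF p]], of m] p m by (simp add: W_add b_W)
  qed
  have 2: "app (LE (Suc m)) t \<in> W (Suc m) \<and> (\<exists>a. app (LE (Suc m)) t m = cst a)" if t: "t \<in> W m" for t
  proof -
    obtain t' where t': "t' \<in> W (m - 1)" "t = t' + b (m - 1) (t (m - 1))" and p: "supp (t (m - 1))"
      using W_split[of t "m - 1"] t m by (auto simp: W_def)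
    define p where "p = t (m - 1)"
    have p: "supp p" using p by (simp add: p_def)
    have t: "t = t' + b (m - 1) p" using t' by (simp add: p_def)
    let ?v = "app (LE m) (app (SE m) t')" and ?v' = "app (LE m) (b m p)"
    have eq: "app (LE (Suc m)) t = app (SE m) ?v + app (SE m) t' + app (SE m) ?v' + b m p"
      unfolding t LE app_add Sb(2)[OF p] by (simp only: add_ac)
    have v: "?v \<in> W m" using IH2(1) Sm t' by blast
    have v': "?v' \<in> W (m + 1)" using IH3(1) p by blast
    have suppW: "supp (w i)" if "w \<in> W r" for w r i using that by (simp add: W_def)
    obtain a where a: "?v (m - 1) = cst a" using IH2(2)[OF Sm[OF t'(1)]] by blast
    obtain a' where a': "?v' (m - 1) = cst a' - p" using IH3(2)[OF p] by blast
    have "app (SE m) ?v m = cst a" using m v suppW a by (subst SE_apply) auto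
    moreover have "app (SE m) t' m = 0" using Sm[OF t'(1)] by (simp add: W_def)
    moreover have "app (SE m) ?v' m = cst a' - p" using m v' suppW a' by (subst SE_apply) auto
    ultimately have "app (LE (Suc m)) t m = cst (a + a')"
      unfolding eq by (simp add: b_def cst_add)
    moreover have "app (SE m) ?v \<in> W (Suc m)"
      using SE_W[OF m W_mono[OF v, of "Suc m"]] m by simp
    moreover have "app (SE m) ?v' \<in> W (Suc m)"
      using SE_W[OF m v'] m by simp
    moreover have "app (SE m) t' \<in> W (Suc m)" using W_mono[OF Sm[OF t'(1)], of "Suc m"] by simp
    ultimately show ?thesis unfolding eq using p by (auto intro!: W_add b_W)
  qed
  have 3: "app (LE (Suc m)) (b (Suc m) p) \<in> W (Suc m + 1) \<and> (\<exists>a. app (LE (Suc m)) (b (Suc m) p) m = cst a - p)"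
    if mK: "Suc m \<le> K" and p: "supp p" for p
  proof -
    define p' where "p' = smul (S m) p"
    have p': "supp p'" using p by (simp add: p'_def)
    have S: "app (SE m) (b (Suc m) p) = b (Suc m) p'"
      using m mK p SE_b[of m "Suc m" p] by (auto simp: p'_def)
    let ?v = "app (LE m) (b m p')"
    have v: "?v \<in> W (m + 1)" using IH3(1) p' by blast
    obtain a where a: "?v (m - 1) = cst a - p'" using IH3(2)[OF p'] by blast
    have supp: "supp (?v i)" for i using v by (simp add: W_def)
    \<comment> \<open>L_m commutes with s_{m+1} by the relations already verified for the operators,
      so its effect at position m + 1 can be read off from the induction hypothesis for position
      m.\<close>
    have "SE (Suc m) * LE m = LE m * SE (Suc m)"
      using R.S_L[of "Suc m" m] m mK by (simp add: \<phi>E_def)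
    moreover have "b (Suc m) p' = app (SE (Suc m)) (b m p')"
      using m mK p' by (simp add: SE_b)
    ultimately have "app (LE m) (b (Suc m) p') = app (SE (Suc m)) ?v"
      by (metis app_simps(6))
    then have eq: "app (LE (Suc m)) (b (Suc m) p) = app (SE m) (app (SE (Suc m)) ?v) + b (Suc m) p'"
      by (simp add: LE S)
    let ?v' = "app (SE (Suc m)) ?v"
    have v': "?v' \<in> W (Suc m + 1)"
      using SE_W[of "Suc m" ?v "Suc m + 1"] W_mono[OF v, of "Suc m + 1"] mK by simp
    have supp': "supp (?v' i)" for i using v' by (simp add: W_def)
    have "?v' (m - 1) = smul (S m) (cst a - p')"
      using m mK a supp by (subst SE_apply) auto
    then have "app (SE m) ?v' m = cst (S m * a) - p"
      using m mK supp' S_S[of m] by (subst SE_apply) (auto simp: smul_diff smul_cst p'_def smul_smul)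
    moreover have "app (SE m) ?v' \<in> W (Suc m + 1)"
      using SE_W[OF m v'] mK by simp
    moreover have "b (Suc m) p' \<in> W (Suc m + 1)" using p' by (simp add: b_W)
    moreover have "b (Suc m) p' m = 0" by (simp add: b_def)
    ultimately show ?thesis unfolding eq by (auto intro!: W_add)
  qed
  have "(\<forall>p. supp p \<longrightarrow> app (LE (Suc m)) (b (Suc m - 1) p) - b (Suc m - 1) (zop p) \<in> W (Suc m - 1))
     \<and> (\<forall>t \<in> W (Suc m - 1). app (LE (Suc m)) t \<in> W (Suc m) \<and> (\<exists>a. app (LE (Suc m)) t (Suc m - 1) = cst a))
     \<and> (Suc m \<le> K \<longrightarrow> (\<forall>p. supp p \<longrightarrow> app (LE (Suc m)) (b (Suc m) p) \<in> W (Suc m + 1)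
          \<and> (\<exists>a. app (LE (Suc m)) (b (Suc m) p) (Suc m - 1) = cst a - p)))"
    using 1 2 3 by simp
  then show ?case .
qed

text \<open>Each further factor L_{K+1} multiplies the entry at position K by z and adds a constant,
  by \<open>L_triangular\<close>. So this entry stays monic and its degree goes up by one.\<close>

lemma L_power:
  "j < l \<Longrightarrow> app (LE (Suc K) ^ j) (b K (cst 1)) \<in> W (Suc K)
     \<and> app (LE (Suc K) ^ j) (b K (cst 1)) K j = 1
     \<and> (\<forall>j'>j. app (LE (Suc K) ^ j) (b K (cst 1)) K j' = 0)"
proof (induction j)
  case 0
  then show ?case by (simp add: b_W) (simp add: b_def cst_def)
next
  case (Suc j)
  define v where "v = app (LE (Suc K) ^ j) (b K (cst 1))"
  have v: "v \<in> W (Suc K)" "v K j = 1" "\<And>j'. j' > j \<Longrightarrow> v K j' = 0"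
    using Suc by (auto simp: v_def)
  obtain v' where v': "v' \<in> W K" "v = v' + b K (v K)" "supp (v K)" using W_split[OF v(1)] .
  let ?t = "app (LE (Suc K)) (b K (v K)) - b K (zop (v K))"
  have tri: "?t \<in> W K" "app (LE (Suc K)) v' \<in> W (Suc K)" "\<exists>a. app (LE (Suc K)) v' K = cst a"
    using L_triangular[of "Suc K"] v' by auto
  then obtain a where a: "app (LE (Suc K)) v' K = cst a" by blast
  have eq: "app (LE (Suc K) ^ Suc j) (b K (cst 1)) = app (LE (Suc K)) v' + (?t + b K (zop (v K)))"
    using v'(2) by (simp flip: v_def app_add)
  have "app (LE (Suc K) ^ Suc j) (b K (cst 1)) \<in> W (Suc K)"
    unfolding eq using tri(2) W_mono[OF tri(1), of "Suc K"] v'(3) by (intro W_add b_W) auto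
  moreover have "app (LE (Suc K) ^ Suc j) (b K (cst 1)) K = cst a + zop (v K)"
    unfolding eq using tri(1) a by (simp add: W_def b_def)
  ultimately show ?case using Suc.prems v by (auto simp: cst_def zop_def)
qed

lemma coeff_power:
  assumes "y \<in> carrier (free_alg K)" "j < l"
  shows "coeff (y * L_free (Suc K) ^ j) = (if j = l - 1 then eval_free y else 0)"
proof -
  have "coeff (y * L_free (Suc K) ^ j) = eval_free y * app (LE (Suc K) ^ j) (b K (cst 1)) K (l - 1)"
    using assms by (simp add: coeff_def E.eval_mult E.eval_power E.eval_L \<phi>E_def eval_position_K)
  then show ?thesis using L_power[OF assms(2)] assms(2) by auto
qed

end

section \<open>The algebras as factors of one ring, and the uniqueness of the top
  coefficient\<close>

section \<open>All the algebras in one ring\<close>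

text \<open>The product of all algebras \<open>hecke l u k\<close> is a type of class \<open>ring_1\<close>, in which one can
  calculate with the type class operations. In the factors other than the one of interest, the
  generators are given values of a one-dimensional representation.\<close>

typedef (overloaded) 'r hprod = "{f :: nat \<times> (nat \<Rightarrow> 'r::comm_ring_1) \<times> nat \<Rightarrow> (word \<Rightarrow>\<^sub>0 'r) set.
    \<forall>l u k. f (l, u, k) \<in> carrier (hecke l u k)}"
  morphisms component Hprod
proof (rule exI, rule CollectI, intro allI)
  fix l k :: nat and u :: "nat \<Rightarrow> 'r"
  show "(case (l, u, k) of (l, u, k) \<Rightarrow> proj l u k 0) \<in> carrier (hecke l u k)" by simp
qed

lemma component_closed [simp]: "component x (l, u, k) \<in> carrier (hecke l u k)"
  using component[of x] by blast

lemma hprod_eqI: "(\<And>l u k. component x (l, u, k) = component y (l, u, k)) \<Longrightarrow> x = y"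
  by (metis component_inject ext prod_cases3)

definition hprod :: "(nat \<Rightarrow> (nat \<Rightarrow> 'r) \<Rightarrow> nat \<Rightarrow> (word \<Rightarrow>\<^sub>0 'r) set) \<Rightarrow> 'r::comm_ring_1 hprod" where
  "hprod f = Hprod (\<lambda>(l, u, k). f l u k)"

lemma component_hprod:
  assumes "\<And>l u k. f l u k \<in> carrier (hecke l u k)"
  shows "component (hprod f) (l, u, k) = f l u k"
  unfolding hprod_def by (subst Hprod_inverse) (use assms in auto)

text \<open>Supplies 0 distinct from 1 in the product of all algebras. For k = 0 there are no
  relators; by contrast, for l = 0 and k >= 1 the cyclotomic relator is the empty product 1 and the
  factor collapses.\<close>

lemma hecke_0_nontrivial: "\<one>\<^bsub>hecke l u 0\<^esub> \<noteq> \<zero>\<^bsub>hecke l u 0\<^esub>"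
proof -
  have "ideal {0} (free_alg 0 :: (word \<Rightarrow>\<^sub>0 'a::comm_ring_1) ring)"
    by (rule free_alg_idealI) auto
  then have "rel_ideal l u 0 \<subseteq> {0}"
    by (rule rel_ideal_minimal) (auto simp: relators_def)
  then have "proj l u 0 1 \<noteq> proj l u 0 0"
    by (auto simp: proj_eq_iff)
  then show ?thesis by (simp add: proj_0 proj_1)
qed

instantiation hprod :: (comm_ring_1) ring_1
begin

definition zero_hprod :: "'a hprod" where "0 = hprod (\<lambda>l u k. \<zero>\<^bsub>hecke l u k\<^esub>)"
definition one_hprod :: "'a hprod" where "1 = hprod (\<lambda>l u k. \<one>\<^bsub>hecke l u k\<^esub>)"
definition plus_hprod :: "'a hprod \<Rightarrow> 'a hprod \<Rightarrow> 'a hprod" where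
  "x + y = hprod (\<lambda>l u k. component x (l, u, k) \<oplus>\<^bsub>hecke l u k\<^esub> component y (l, u, k))"
definition times_hprod :: "'a hprod \<Rightarrow> 'a hprod \<Rightarrow> 'a hprod" where
  "x * y = hprod (\<lambda>l u k. component x (l, u, k) \<otimes>\<^bsub>hecke l u k\<^esub> component y (l, u, k))"
definition uminus_hprod :: "'a hprod \<Rightarrow> 'a hprod" where
  "- x = hprod (\<lambda>l u k. \<ominus>\<^bsub>hecke l u k\<^esub> component x (l, u, k))"
definition minus_hprod :: "'a hprod \<Rightarrow> 'a hprod \<Rightarrow> 'a hprod" where
  "x - y = hprod (\<lambda>l u k. component x (l, u, k) \<ominus>\<^bsub>hecke l u k\<^esub> component y (l, u, k))"

lemma component_simps:
  "component (0::'a hprod) (l, u, k) = \<zero>\<^bsub>hecke l u k\<^esub>"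
  "component (1::'a hprod) (l, u, k) = \<one>\<^bsub>hecke l u k\<^esub>"
  "component (x + y) (l, u, k) = component x (l, u, k) \<oplus>\<^bsub>hecke l u k\<^esub> component y (l, u, k)"
  "component (x * y) (l, u, k) = component x (l, u, k) \<otimes>\<^bsub>hecke l u k\<^esub> component y (l, u, k)"
  "component (- x) (l, u, k) = \<ominus>\<^bsub>hecke l u k\<^esub> component x (l, u, k)"
  "component (x - y) (l, u, k) = component x (l, u, k) \<ominus>\<^bsub>hecke l u k\<^esub> component y (l, u, k)"
proof -
  note ring.ring_simprules[OF ring_hecke]
  note this [simp]
  show "component (0::'a hprod) (l, u, k) = \<zero>\<^bsub>hecke l u k\<^esub>"
    "component (1::'a hprod) (l, u, k) = \<one>\<^bsub>hecke l u k\<^esub>"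
    "component (x + y) (l, u, k) = component x (l, u, k) \<oplus>\<^bsub>hecke l u k\<^esub> component y (l, u, k)"
    "component (x * y) (l, u, k) = component x (l, u, k) \<otimes>\<^bsub>hecke l u k\<^esub> component y (l, u, k)"
    "component (- x) (l, u, k) = \<ominus>\<^bsub>hecke l u k\<^esub> component x (l, u, k)"
    "component (x - y) (l, u, k) = component x (l, u, k) \<ominus>\<^bsub>hecke l u k\<^esub> component y (l, u, k)"
    unfolding zero_hprod_def one_hprod_def plus_hprod_def times_hprod_def uminus_hprod_def minus_hprod_def
    by (subst component_hprod; simp)+
qed

instance
proof
  have "component (0::'a hprod) (0, u, 0) \<noteq> component 1 (0, u, 0)" for u
    using hecke_0_nontrivial[of 0 u] by (simp add: component_simps)
  then show "(0::'a hprod) \<noteq> 1" by metis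
qed (rule hprod_eqI, simp add: component_simps ring.ring_simprules[OF ring_hecke]
      monoid.r_one[OF ring.is_monoid[OF ring_hecke]] a_minus_def)+

end

definition const_hprod :: "'r::comm_ring_1 \<Rightarrow> 'r hprod" where
  "const_hprod c = hprod (\<lambda>l u k. proj l u k (const c))"

definition elem_at :: "nat \<Rightarrow> (nat \<Rightarrow> 'r) \<Rightarrow> nat \<Rightarrow> (word \<Rightarrow>\<^sub>0 'r) \<Rightarrow> 'r \<Rightarrow> 'r::comm_ring_1 hprod" where
  "elem_at l u k x c = hprod (\<lambda>l' u' k'.
     if (l', u', k') = (l, u, k) \<and> x \<in> carrier (free_alg k) then proj l u k x else proj l' u' k' (const c))"

lemma component_const: "component (const_hprod c) (l, u, k) = proj l u k (const c)"
  unfolding const_hprod_def by (rule component_hprod) simp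

lemma component_at:
  "component (elem_at l u k x c) (l', u', k') =
     (if (l', u', k') = (l, u, k) \<and> x \<in> carrier (free_alg k) then proj l u k x else proj l' u' k' (const c))"
  unfolding elem_at_def by (subst component_hprod) auto

text \<open>In the factors other than (l, u, k) this is the character that sends s_i to 1 and L_i to
  u_1 + (i - 1): the rule for L_{i+1} becomes addition of 1, and f vanishes at u_1.\<close>

definition gen_at :: "nat \<Rightarrow> (nat \<Rightarrow> 'r) \<Rightarrow> nat \<Rightarrow> gen \<Rightarrow> 'r::comm_ring_1 hprod" where
  "gen_at l u k g = (case g of SGen i \<Rightarrow> elem_at l u k (s_free i) 1
     | LGen i \<Rightarrow> elem_at l u k (L_free i) (u 1 + of_nat (i - 1)))"

lemma proj_const_commute:
  "x \<in> carrier (free_alg k) \<Longrightarrow>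
    proj l u k (const c) \<otimes>\<^bsub>hecke l u k\<^esub> proj l u k x = proj l u k x \<otimes>\<^bsub>hecke l u k\<^esub> proj l u k (const c)"
  by (simp add: const_central flip: proj_mult)

lemma at_commute: "const_hprod a * elem_at l u k x c = elem_at l u k x c * const_hprod a"
  by (rule hprod_eqI, unfold component_simps component_const component_at)
    (auto intro!: proj_const_commute)

lemma evaluation_hprod: "evaluation const_hprod (gen_at l u k)"
proof
  show "const_hprod (1::'a) = 1"
    by (rule hprod_eqI) (simp add: component_simps component_const proj_1)
  show "const_hprod (a + b) = const_hprod a + const_hprod b" for a b :: 'a
    by (rule hprod_eqI) (simp add: component_simps component_const const_add proj_add)
  show "const_hprod (a * b) = const_hprod a * const_hprod b" for a b :: 'a
    by (rule hprod_eqI) (simp add: component_simps component_const const_mult proj_mult)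
  show "const_hprod a * gen_at l u k g = gen_at l u k g * const_hprod a" for a g
    by (cases g) (simp_all add: gen_at_def at_commute)
qed

lemma hprod_eqI_at:
  assumes "component x (l, u, k) = component y (l, u, k)"
    and "\<And>l' u' k'. (l', u', k') \<noteq> (l, u, k) \<Longrightarrow> component x (l', u', k') = component y (l', u', k')"
  shows "x = y"
  using assms by (intro hprod_eqI) metis

interpretation hprod: evaluation const_hprod "gen_at l u k" for l u k
  by (rule evaluation_hprod)

lemma component_eval:
  assumes "x \<in> carrier (free_alg k)"
  shows "component (hprod.eval_free l u k x) (l, u, k) = proj l u k x"
  using assms
proof (induction x rule: free_alg_induct)
  case (const a)
  then show ?case by (simp add: hprod.eval_const component_const)
next
  case (s i)
  then show ?case by (simp only: hprod.eval_s) (simp add: gen_at_def component_at)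
next
  case (L i)
  then show ?case by (simp only: hprod.eval_L) (simp add: gen_at_def component_at)
qed (simp_all add: hprod.eval_add hprod.eval_mult component_simps proj_add proj_mult)

text \<open>\<open>G\<close> is represented by \<open>x\<close> in the factor of interest and by the
  scalar \<open>c\<close> in all others. An identity in the product then splits into a membership in
  the ideal and an identity of scalars (\<open>const_at_eqI\<close>).\<close>

definition const_at :: "nat \<Rightarrow> (nat \<Rightarrow> 'r) \<Rightarrow> nat \<Rightarrow> 'r::comm_ring_1 hprod \<Rightarrow> (word \<Rightarrow>\<^sub>0 'r) \<Rightarrow> 'r \<Rightarrow> bool" where
  "const_at l u k G x c \<longleftrightarrow> x \<in> carrier (free_alg k) \<and> component G (l, u, k) = proj l u k x
     \<and> (\<forall>l' u' k'. (l', u', k') \<noteq> (l, u, k) \<longrightarrow> component G (l', u', k') = proj l' u' k' (const c))"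

lemma const_at_intros:
  "1 \<le> i \<Longrightarrow> i < k \<Longrightarrow> const_at l u k (gen_at l u k (SGen i)) (s_free i) 1"
  "1 \<le> i \<Longrightarrow> i \<le> k \<Longrightarrow> const_at l u k (gen_at l u k (LGen i)) (L_free i) (u 1 + of_nat (i - 1))"
  "const_at l u k (const_hprod a) (const a) a"
  "const_at l u k G x a \<Longrightarrow> const_at l u k G' y b \<Longrightarrow> const_at l u k (G * G') (x * y) (a * b)"
  "const_at l u k G x a \<Longrightarrow> const_at l u k G' y b \<Longrightarrow> const_at l u k (G + G') (x + y) (a + b)"
  "const_at l u k G x a \<Longrightarrow> const_at l u k G' y b \<Longrightarrow> const_at l u k (G - G') (x - y) (a - b)"
  "const_at l u k 1 1 1"
  "const_at l u k 0 0 0"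
  using const_add[of a "- b"]
  by (auto simp: const_at_def gen_at_def component_at component_const component_simps proj_mult proj_add
      proj_diff const_mult const_add proj_1 proj_0 const_uminus)

lemma const_at_eqI:
  assumes "const_at l u k G x a" "const_at l u k G' y b" "x - y \<in> rel_ideal l u k" "a = b"
  shows "G = G'"
  using assms unfolding const_at_def
  by (intro hprod_eqI_at[of _ l u k]) (auto simp: proj_eq_iff)

lemma const_at_prod_list:
  assumes "\<And>j. j \<in> set js \<Longrightarrow> const_at l u k (G j) (x j) (a j)"
  shows "const_at l u k (prod_list (map G js)) (prod_list (map x js)) (prod_list (map a js))"
  using assms by (induction js) (auto intro: const_at_intros)

lemma relatorsI:
  "1 \<le> k \<Longrightarrow> prod_list (map (\<lambda>j. L_free 1 - const (u j)) [1..<Suc l]) \<in> relators l u k"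
  "1 \<le> i \<Longrightarrow> i < k \<Longrightarrow> s_free i * s_free i - 1 \<in> relators l u k"
  "1 \<le> i \<Longrightarrow> i + 1 < j \<Longrightarrow> j < k \<Longrightarrow> s_free i * s_free j - s_free j * s_free i \<in> relators l u k"
  "1 \<le> i \<Longrightarrow> i + 1 < k \<Longrightarrow> s_free i * s_free (i + 1) * s_free i
     - s_free (i + 1) * s_free i * s_free (i + 1) \<in> relators l u k"
  "1 \<le> i \<Longrightarrow> i \<le> k \<Longrightarrow> 1 \<le> j \<Longrightarrow> j \<le> k \<Longrightarrow>
     L_free i * L_free j - L_free j * L_free i \<in> relators l u k"
  "1 \<le> i \<Longrightarrow> i < k \<Longrightarrow> 1 \<le> j \<Longrightarrow> j \<le> k \<Longrightarrow> j \<noteq> i \<Longrightarrow> j \<noteq> i + 1 \<Longrightarrow>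
     s_free i * L_free j - L_free j * s_free i \<in> relators l u k"
  "1 \<le> i \<Longrightarrow> i < k \<Longrightarrow> L_free (i + 1) - (s_free i * L_free i * s_free i + s_free i) \<in> relators l u k"
  unfolding relators_def by (simp del: upt_Suc) blast+

theorem hprod_relations:
  assumes "1 \<le> l"
  shows "hecke_relations (\<lambda>i. gen_at l u k (SGen i)) (\<lambda>i. gen_at l u k (LGen i)) (\<lambda>j. const_hprod (u j)) l k"
proof
  have rel: "G = G'" if "const_at l u k G x a" "const_at l u k G' y b" "x - y \<in> relators l u k" "a = b"
    for G G' x y a b
    using const_at_eqI[OF that(1,2) relators_in_ideal[OF that(3)] that(4)] .
  {
    assume "1 \<le> k"
    then have "const_at l u k (prod_list (map (\<lambda>j. gen_at l u k (LGen 1) - const_hprod (u j)) [1..<Suc l]))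
      (prod_list (map (\<lambda>j. L_free 1 - const (u j)) [1..<Suc l]))
      (prod_list (map (\<lambda>j. u 1 + of_nat (1 - 1) - u j) [1..<Suc l]))"
      by (intro const_at_prod_list const_at_intros) auto
    \<comment> \<open>The factor with j = 1 is zero at the character; it occurs since l >=
      1.\<close>
    moreover have "prod_list (map (\<lambda>j. u 1 + of_nat (1 - 1) - u j) [1..<Suc l]) = 0"
      using assms by (subst upt_conv_Cons) (auto simp del: upt_Suc)
    ultimately show "prod_list (map (\<lambda>j. gen_at l u k (LGen 1) - const_hprod (u j)) [1..<Suc l]) = 0"
      using \<open>1 \<le> k\<close> relatorsI(1)[of k u l]
      by (intro rel[OF _ const_at_intros(8)]) (simp_all del: upt_Suc)
  }
  {
    fix i assume i: "1 \<le> i" "i < k"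
    show "gen_at l u k (SGen i) * gen_at l u k (SGen i) = 1"
      by (rule rel[OF const_at_intros(4)[OF const_at_intros(1)[OF i] const_at_intros(1)[OF i]] const_at_intros(7)])
        ((rule relatorsI; use i in simp), simp)
    have L: "const_at l u k (gen_at l u k (LGen i)) (L_free i) (u 1 + of_nat (i - 1))"
      "const_at l u k (gen_at l u k (LGen (i + 1))) (L_free (i + 1)) (u 1 + of_nat (i + 1 - 1))"
      by (rule const_at_intros(2); use i in simp)+
    show "gen_at l u k (LGen (i + 1)) = gen_at l u k (SGen i) * gen_at l u k (LGen i) * gen_at l u k (SGen i)
      + gen_at l u k (SGen i)"
      by (rule rel[OF L(2) const_at_intros(5)[OF const_at_intros(4)[OF const_at_intros(4)[OF
          const_at_intros(1)[OF i] L(1)] const_at_intros(1)[OF i]] const_at_intros(1)[OF i]]])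
        ((rule relatorsI; use i in simp), use i in \<open>simp add: of_nat_diff\<close>)
  }
  {
    fix i j assume i: "1 \<le> i" "i + 1 < j" "j < k"
    then have S: "const_at l u k (gen_at l u k (SGen i)) (s_free i) 1"
      "const_at l u k (gen_at l u k (SGen j)) (s_free j) 1"
      by (auto intro!: const_at_intros)
    show "gen_at l u k (SGen i) * gen_at l u k (SGen j) = gen_at l u k (SGen j) * gen_at l u k (SGen i)"
      by (rule rel[OF const_at_intros(4)[OF S] const_at_intros(4)[OF S(2,1)]])
        ((rule relatorsI; use i in simp), simp)
  }
  {
    fix i assume i: "1 \<le> i" "i + 1 < k"
    then have S: "const_at l u k (gen_at l u k (SGen i)) (s_free i) 1"
      "const_at l u k (gen_at l u k (SGen (i + 1))) (s_free (i + 1)) 1"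
      by (auto intro!: const_at_intros)
    show "gen_at l u k (SGen i) * gen_at l u k (SGen (i + 1)) * gen_at l u k (SGen i)
      = gen_at l u k (SGen (i + 1)) * gen_at l u k (SGen i) * gen_at l u k (SGen (i + 1))"
      by (rule rel[OF const_at_intros(4)[OF const_at_intros(4)[OF S] S(1)]
            const_at_intros(4)[OF const_at_intros(4)[OF S(2,1)] S(2)]])
        ((rule relatorsI; use i in simp), simp)
  }
  {
    fix i j assume i: "1 \<le> i" "i \<le> k" "1 \<le> j" "j \<le> k"
    then have L: "const_at l u k (gen_at l u k (LGen i)) (L_free i) (u 1 + of_nat (i - 1))"
      "const_at l u k (gen_at l u k (LGen j)) (L_free j) (u 1 + of_nat (j - 1))"
      by (simp_all only: const_at_intros(2))
    show "gen_at l u k (LGen i) * gen_at l u k (LGen j) = gen_at l u k (LGen j) * gen_at l u k (LGen i)"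
      by (rule rel[OF const_at_intros(4)[OF L] const_at_intros(4)[OF L(2,1)]])
        ((rule relatorsI; use i in simp), simp add: mult.commute)
  }
  {
    fix i j assume i: "1 \<le> i" "i < k" "1 \<le> j" "j \<le> k" "j \<noteq> i" "j \<noteq> i + 1"
    then have L: "const_at l u k (gen_at l u k (SGen i)) (s_free i) 1"
      "const_at l u k (gen_at l u k (LGen j)) (L_free j) (u 1 + of_nat (j - 1))"
      by (simp_all only: const_at_intros(1,2))
    show "gen_at l u k (SGen i) * gen_at l u k (LGen j) = gen_at l u k (LGen j) * gen_at l u k (SGen i)"
      by (rule rel[OF const_at_intros(4)[OF L] const_at_intros(4)[OF L(2,1)]])
        ((rule relatorsI; use i in simp), simp)
  }
  show "const_hprod (u j) * gen_at l u k (SGen i) = gen_at l u k (SGen i) * const_hprod (u j)" for i j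
    by (rule hprod.c_gen)
  show "const_hprod (u j) * gen_at l u k (LGen i) = gen_at l u k (LGen i) * const_hprod (u j)" for i j
    by (rule hprod.c_gen)
  show "const_hprod (u i) * const_hprod (u j) = const_hprod (u j) * const_hprod (u i)" for i j
    by (metis hprod.c_mult mult.commute)
qed

section \<open>Uniqueness in the definition of the descending map\<close>

text \<open>The functional \<open>coef\<close> lives on the free algebra, so elements of
  \<open>HsH\<close> are lifted there along the generation of the additive group. With the zero
  functional the same lemma shows that \<open>HsH\<close> lies in the carrier.\<close>

lemma HsH_coeff:
  fixes u :: "nat \<Rightarrow> 'r::comm_ring_1"
  assumes "h \<in> HsH l u k" "1 \<le> k"
    and add: "\<And>x y. coef (x + y) = coef x + (coef y :: 'b::ring)"
    and HsH: "\<And>a b. 2 \<le> k \<Longrightarrow> a \<in> carrier (free_alg (k - 1)) \<Longrightarrow> b \<in> carrier (free_alg (k - 1)) \<Longrightarrow>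
      coef (a * s_free (k - 1) * b) = 0"
  shows "\<exists>x. x \<in> carrier (free_alg k) \<and> h = proj l u k x \<and> coef x = 0"
proof -
  interpret ring "hecke l u k" by (rule ring_hecke)
  have coef0: "coef 0 = 0" using add[of 0 0] by simp
  have coefm: "coef (- x) = - coef x" for x
    using add[of x "- x"] coef0 by (simp add: eq_neg_iff_add_eq_0 add.commute)
  have eng: "\<exists>x. x \<in> carrier (free_alg k) \<and> incl l u k a \<otimes>\<^bsub>hecke l u k\<^esub> hs l u k (k - 1)
      \<otimes>\<^bsub>hecke l u k\<^esub> incl l u k b = proj l u k x \<and> coef x = 0"
    if ab: "2 \<le> k" "a \<in> carrier (hecke l u (k - 1))" "b \<in> carrier (hecke l u (k - 1))" for a b
  proof -
    from ab obtain x y where xy: "x \<in> carrier (free_alg (k - 1))" "a = proj l u (k - 1) x"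
      "y \<in> carrier (free_alg (k - 1))" "b = proj l u (k - 1) y"
      unfolding carrier_hecke by blast
    have "x \<in> carrier (free_alg k)" "y \<in> carrier (free_alg k)" "(s_free (k - 1) :: word \<Rightarrow>\<^sub>0 'r) \<in> carrier (free_alg k)"
      using xy free_alg_mono[of _ "k - 1" k] ab(1) by auto
    then show ?thesis using xy HsH[OF ab(1) xy(1,3)]
      by (intro exI[of _ "x * s_free (k - 1) * y"]) (simp add: incl_proj[simplified] hs_def proj_mult)
  qed
  from assms(1) show ?thesis unfolding HsH_def
  proof (induction h rule: generate.induct)
    case one
    then show ?case by (intro exI[of _ 0]) (simp add: coef0 proj_0)
  next
    case (incl h)
    then show ?case using eng by blast
  next
    case (inv h)
    then obtain x where "x \<in> carrier (free_alg k)" "h = proj l u k x" "coef x = 0"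
      using eng by blast
    then show ?case
      by (intro exI[of _ "- x"]) (auto simp: coefm proj_uminus a_inv_def)
  next
    case (eng h1 h2)
    then obtain x y where "x \<in> carrier (free_alg k)" "h1 = proj l u k x" "coef x = 0"
      "y \<in> carrier (free_alg k)" "h2 = proj l u k y" "coef y = 0" by blast
    then show ?case by (intro exI[of _ "x + y"]) (auto simp: add proj_add)
  qed
qed

text \<open>A decomposition of h lifts to an element of the free algebra on which
  \<open>coeff\<close>, taken over A = H_{l,k-1}, has the top coefficient as its value. Lifts of the
  same h differ by an element of the ideal, where \<open>coeff\<close> vanishes, so all
  decompositions share that coefficient.\<close>

theorem descend_eqI:
  fixes u :: "nat \<Rightarrow> 'r::comm_ring_1"
  assumes "1 \<le> l" "1 \<le> k" "h' \<in> HsH l u k" "\<And>i. i < l \<Longrightarrow> p i \<in> carrier (hecke l u (k - 1))"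
    and "h = h' \<oplus>\<^bsub>hecke l u k\<^esub> (\<Oplus>\<^bsub>hecke l u k\<^esub>i \<in> {..<l}.
              incl l u k (p i) \<otimes>\<^bsub>hecke l u k\<^esub> hL l u k k [^]\<^bsub>hecke l u k\<^esub> (i::nat))"
  shows "descend l u k h = p (l - 1)"
proof -
  obtain K where K: "k = Suc K" using assms(2) by (cases k) auto
  interpret evaluation const_hprod "gen_at l u K" by (rule evaluation_hprod)
  interpret hecke_relations "\<lambda>i. gen_at l u K (SGen i)" "\<lambda>i. gen_at l u K (LGen i)"
      "\<lambda>j. const_hprod (u j)" l K
    by (rule hprod_relations[OF assms(1)])
  interpret induced_module const_hprod "gen_at l u K" u l K
    by unfold_locales (rule assms(1))
  have coef: "\<exists>x. x \<in> carrier (free_alg k) \<and> h = proj l u k x \<and> component (coeff x) (l, u, K) = p (l - 1)"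
    if h': "h' \<in> HsH l u k" and p: "\<And>i. i < l \<Longrightarrow> p i \<in> carrier (hecke l u (k - 1))"
      and h: "h = h' \<oplus>\<^bsub>hecke l u k\<^esub> (\<Oplus>\<^bsub>hecke l u k\<^esub>i \<in> {..<l}.
              incl l u k (p i) \<otimes>\<^bsub>hecke l u k\<^esub> hL l u k k [^]\<^bsub>hecke l u k\<^esub> (i::nat))" for h' p
  proof -
    obtain x where x: "x \<in> carrier (free_alg k)" "h' = proj l u k x" "coeff x = 0"
      using HsH_coeff[OF h' assms(2), of coeff] coeff_add coeff_HsH by (auto simp: K)
    have "\<forall>i. \<exists>y. i < l \<longrightarrow> y \<in> carrier (free_alg K) \<and> p i = proj l u K y"
      using p unfolding carrier_hecke by (auto simp: K)
    then obtain y where y: "\<And>i. i < l \<Longrightarrow> y i \<in> carrier (free_alg K)" "\<And>i. i < l \<Longrightarrow> p i = proj l u K (y i)"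
      by metis
    have y': "i < l \<Longrightarrow> y i \<in> carrier (free_alg k)" for i
      using y(1) free_alg_mono[of "y i" K k] by (simp add: K)
    have L: "(L_free k :: word \<Rightarrow>\<^sub>0 'r) \<in> carrier (free_alg k)" using K by simp
    let ?z = "\<Sum>i<l. y i * L_free k ^ i"
    interpret H: ring "hecke l u k" by (rule ring_hecke)
    have z: "?z \<in> carrier (free_alg k)"
      by (rule free_alg_sum_closed, rule free_alg_closed(5)) (use y' L in auto)
    have "proj l u k ?z = (\<Oplus>\<^bsub>hecke l u k\<^esub>i \<in> {..<l}. proj l u k (y i * L_free k ^ i))"
      using y' L by (intro proj_sum) auto
    also have "\<dots> = (\<Oplus>\<^bsub>hecke l u k\<^esub>i \<in> {..<l}.
              incl l u k (p i) \<otimes>\<^bsub>hecke l u k\<^esub> hL l u k k [^]\<^bsub>hecke l u k\<^esub> i)"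
    proof (rule H.finsum_cong')
      fix i assume "i \<in> {..<l}"
      then show "proj l u k (y i * L_free k ^ i) = incl l u k (p i) \<otimes>\<^bsub>hecke l u k\<^esub> hL l u k k [^]\<^bsub>hecke l u k\<^esub> i"
        using y y' L incl_proj[of "y i" k l u] by (simp add: proj_mult proj_power hL_def K)
      next
      show "(\<lambda>i. incl l u k (p i) \<otimes>\<^bsub>hecke l u k\<^esub> hL l u k k [^]\<^bsub>hecke l u k\<^esub> i) \<in> {..<l} \<rightarrow> carrier (hecke l u k)"
        using y y' L incl_proj[of "y _" k l u]
        by (auto simp: hL_def K intro!: H.m_closed[unfolded K] H.nat_pow_closed[unfolded K])
    qed simp
    finally have "h = proj l u k (x + ?z)" using x z by (simp add: h proj_add)
    moreover have "coeff (x + ?z) = hprod.eval_free l u K (y (l - 1))"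
    proof -
      have sum: "coeff (sum f A) = (\<Sum>i\<in>A. coeff (f i))" for f and A :: "nat set"
      proof (induction A rule: infinite_finite_induct)
        case (infinite A)
        then show ?case using coeff_add[of 0 0] by simp
      next
        case empty
        then show ?case using coeff_add[of 0 0] by simp
      qed (simp add: coeff_add)
      have "coeff ?z = (\<Sum>i<l. if i = l - 1 then hprod.eval_free l u K (y i) else 0)"
        unfolding sum K using y by (intro sum.cong) (auto simp: coeff_power)
      then show ?thesis using assms(1) x by (simp add: coeff_add)
    qed
    moreover have "component (hprod.eval_free l u K (y (l - 1))) (l, u, K) = p (l - 1)"
      using y assms(1) by (simp add: component_eval)
    ultimately show ?thesis using x z by (intro exI[of _ "x + ?z"]) auto
  qed
  have diff: "component (coeff x) (l, u, K) = component (coeff y) (l, u, K)"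
    if "x \<in> carrier (free_alg k)" "y \<in> carrier (free_alg k)" "proj l u k x = proj l u k y" for x y
  proof -
    have "coeff (x - y) = 0" using that by (intro coeff_ideal) (simp add: proj_eq_iff K)
    then show ?thesis using coeff_add[of "x - y" y] by simp
  qed
  show ?thesis unfolding descend_def p_coeff_def
  proof (rule the_equality)
    show "\<exists>h' pa. h' \<in> HsH l u k \<and> (\<forall>i<l. pa i \<in> carrier (hecke l u (k - 1))) \<and>
       h = h' \<oplus>\<^bsub>hecke l u k\<^esub> (\<Oplus>\<^bsub>hecke l u k\<^esub>i\<in>{..<l}.
          incl l u k (pa i) \<otimes>\<^bsub>hecke l u k\<^esub> hL l u k k [^]\<^bsub>hecke l u k\<^esub> i) \<and>
       p (l - 1) = pa (l - 1)"
      using assms by blast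
  next
    fix c
    assume "\<exists>h' pa. h' \<in> HsH l u k \<and> (\<forall>i<l. pa i \<in> carrier (hecke l u (k - 1))) \<and>
       h = h' \<oplus>\<^bsub>hecke l u k\<^esub> (\<Oplus>\<^bsub>hecke l u k\<^esub>i\<in>{..<l}.
          incl l u k (pa i) \<otimes>\<^bsub>hecke l u k\<^esub> hL l u k k [^]\<^bsub>hecke l u k\<^esub> i) \<and>
       c = pa (l - 1)"
    then obtain h'' p' where *: "h'' \<in> HsH l u k" "\<And>i. i < l \<Longrightarrow> p' i \<in> carrier (hecke l u (k - 1))"
       "h = h'' \<oplus>\<^bsub>hecke l u k\<^esub> (\<Oplus>\<^bsub>hecke l u k\<^esub>i\<in>{..<l}.
          incl l u k (p' i) \<otimes>\<^bsub>hecke l u k\<^esub> hL l u k k [^]\<^bsub>hecke l u k\<^esub> i)"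
       "c = p' (l - 1)" by blast
    from coef[OF *(1-3)] coef[OF assms(3-5)] show "c = p (l - 1)"
      using diff *(4) by metis
  qed
qed

section \<open>Normal forms for words in the Coxeter generators\<close>

section \<open>Words in the Coxeter generators\<close>

lemma word_perm_append: "word_perm (is @ js) = word_perm js \<circ> word_perm is"
  by (induction "is") (auto simp: o_assoc)

definition zperm :: "nat \<Rightarrow> nat \<Rightarrow> nat \<Rightarrow> nat" where
  "zperm b n x = (if x = b then n else if b < x \<and> x \<le> n then x - 1 else x)"

lemma word_perm_upt: "b \<le> n \<Longrightarrow> word_perm [b..<n] = zperm b n"
proof (induction n rule: dec_induct)
  case base
  then show ?case by (auto simp: zperm_def fun_eq_iff)
next
  case (step n)
  have "Transposition.transpose n (Suc n) \<circ> zperm b n = zperm b (Suc n)"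
    using step by (auto simp: zperm_def fun_eq_iff Transposition.transpose_def)
  with step show ?case by (simp add: word_perm_append)
qed

lemma word_perm_permutes: "set is \<subseteq> {1..<n} \<Longrightarrow> word_perm is permutes {1..n}"
  by (induction "is") (auto simp: permutes_id intro!: permutes_compose permutes_swap_id)

lemma word_perm_bij: "bij (word_perm is)"
  by (induction "is") (simp_all only: word_perm.simps bij_id bij_comp bij_transpose)

lemma zperm_permutes: "1 \<le> b \<Longrightarrow> b \<le> n \<Longrightarrow> zperm b n permutes {1..n}"
  using word_perm_permutes[of "[b..<n]" n] by (auto simp: word_perm_upt)

lemma word_perm_fixes: "set is \<subseteq> {1..<n} \<Longrightarrow> n < x \<Longrightarrow> word_perm is x = x"
  using permutes_not_in[OF word_perm_permutes[of "is" n]] by simp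

text \<open>If w sends b to n, then splitting off the cycle of the word \<open>[b..<n]\<close>,
  which also sends b to n, leaves a permutation that fixes n.\<close>

lemma word_perm_surj:
  "w permutes {1..n} \<Longrightarrow> \<exists>is. set is \<subseteq> {1..<n} \<and> word_perm is = w"
proof (induction n arbitrary: w)
  case 0
  then show ?case by (intro exI[of _ "[]"]) simp
next
  case (Suc n)
  define b where "b = inv_into UNIV w (Suc n)"
  have b: "w b = Suc n" "b \<in> {1..Suc n}"
    using permutes_inverses(1)[OF Suc.prems] permutes_in_image[OF permutes_inv[OF Suc.prems], of "Suc n"]
    by (auto simp: b_def)
  have z: "zperm b (Suc n) permutes {1..Suc n}" using b by (intro zperm_permutes) auto
  define v where "v = w \<circ> inv_into UNIV (zperm b (Suc n))"
  have v: "v permutes {1..Suc n}"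
    unfolding v_def by (rule permutes_compose[OF permutes_inv[OF z] Suc.prems])
  have "inv_into UNIV (zperm b (Suc n)) (Suc n) = b"
    using permutes_inv_eq[OF z, of "Suc n" b] by (simp add: zperm_def)
  then have "v (Suc n) = Suc n" by (simp add: v_def b)
  then have "v permutes {1..n}"
    by (intro permutes_superset[OF v]) (auto simp: le_Suc_eq)
  then obtain js where js: "set js \<subseteq> {1..<n}" "word_perm js = v" using Suc.IH by blast
  have "v \<circ> zperm b (Suc n) = w"
    by (simp add: v_def o_assoc[symmetric] permutes_inv_o[OF z])
  then have "word_perm ([b..<Suc n] @ js) = w"
    using b js by (simp add: word_perm_append word_perm_upt del: upt_Suc)
  moreover have "set ([b..<Suc n] @ js) \<subseteq> {1..<Suc n}" using b js by auto
  ultimately show ?case by blast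
qed

text \<open>An arbitrary word for the permutation, reduced or not; by \<open>wordS_unique\<close>
  the choice does not affect its value in the algebra.\<close>

definition perm_word :: "nat \<Rightarrow> (nat \<Rightarrow> nat) \<Rightarrow> nat list" where
  "perm_word n w = (SOME is. set is \<subseteq> {1..<n} \<and> word_perm is = w)"

lemma perm_word:
  assumes "w permutes {1..n}"
  shows "set (perm_word n w) \<subseteq> {1..<n}" "word_perm (perm_word n w) = w"
  using someI_ex[OF word_perm_surj[OF assms]] unfolding perm_word_def by auto

context hecke_relations
begin

definition wordS :: "nat list \<Rightarrow> 'a" where "wordS is = prod_list (map S is)"

lemma wordS_simps [simp]: "wordS [] = 1" "wordS (i # is) = S i * wordS is"
  "wordS (is @ js) = wordS is * wordS js"
  by (simp_all add: wordS_def)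

lemma wordS_commute: "(\<And>i. i \<in> set is \<Longrightarrow> S i * a = a * S i) \<Longrightarrow> wordS is * a = a * wordS is"
  unfolding wordS_def by (rule commutes_prod_list) auto

lemma wordS_upt: "b < n \<Longrightarrow> wordS [b..<n] = S b * wordS [Suc b..<n]"
  by (simp add: upt_conv_Cons)

lemma S_wordS_upt_greater:
  assumes "n \<le> k" "1 \<le> b" "b < i" "i < n"
  shows "S i * wordS [b..<n] = wordS [b..<n] * S (i - 1)"
proof -
  have "[b..<n] = [b..<i - 1] @ [i - 1, i] @ [Suc i..<n]"
    using assms upt_add_eq_append[of b "i - 1" "n - (i - 1)"] upt_conv_Cons[of "i - 1" n] upt_conv_Cons[of i n]
    by simp
  then have w: "wordS [b..<n] = wordS [b..<i - 1] * (S (i - 1) * S i) * wordS [Suc i..<n]"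
    by (simp add: mult.assoc)
  have 1: "wordS [b..<i - 1] * S i = S i * wordS [b..<i - 1]"
    using assms by (intro wordS_commute S_far) auto
  have 2: "wordS [Suc i..<n] * S (i - 1) = S (i - 1) * wordS [Suc i..<n]"
    using assms by (intro wordS_commute) (auto intro!: S_far[symmetric])
  have "S i * wordS [b..<n] = wordS [b..<i - 1] * (S i * S (i - 1) * S i) * wordS [Suc i..<n]"
    unfolding w by (simp only: mult.assoc[symmetric] 1)
  also have "S i * S (i - 1) * S i = S (i - 1) * S i * S (i - 1)"
    using S_braid[of "i - 1"] assms by simp
  also have "wordS [b..<i - 1] * (S (i - 1) * S i * S (i - 1)) * wordS [Suc i..<n]
      = wordS [b..<i - 1] * (S (i - 1) * S i) * (S (i - 1) * wordS [Suc i..<n])"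
    by (simp only: mult.assoc)
  also have "\<dots> = wordS [b..<n] * S (i - 1)"
    unfolding w 2[symmetric] by (simp only: mult.assoc)
  finally show ?thesis .
qed

text \<open>The words \<open>[b..<n]\<close> represent the cosets of the symmetric group on n - 1
  letters. A letter put in front either changes b by one or passes through to the right, by moves
  valid for ring elements and for permutations alike.\<close>

lemma word_normal_form:
  assumes "n \<le> k" "1 \<le> n" "set is \<subseteq> {1..<n}"
  shows "\<exists>b js. 1 \<le> b \<and> b \<le> n \<and> set js \<subseteq> {1..<n - 1} \<and> wordS is = wordS ([b..<n] @ js)
     \<and> word_perm is = word_perm ([b..<n] @ js)"
  using assms(3)
proof (induction "is")
  case Nil
  then show ?case using assms by (intro exI[of _ n] exI[of _ "[]"]) auto
next
  case (Cons i "is")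
  then obtain b js where b: "1 \<le> b" "b \<le> n" and js: "set js \<subseteq> {1..<n - 1}"
    and w: "wordS is = wordS ([b..<n] @ js)" and p: "word_perm is = word_perm ([b..<n] @ js)"
    by auto
  have i: "1 \<le> i" "i < n" "i < k" using Cons.prems assms by auto
  consider "Suc i = b" | "i = b" | "b < i" | "Suc i < b" by linarith
  then show ?case
  proof cases
    case 1
    then have "[i..<n] = i # [b..<n]" using i by (simp add: upt_conv_Cons)
    then show ?thesis using i b js w p
      by (intro exI[of _ i] exI[of _ js]) (simp add: word_perm_append mult.assoc)
  next
    case 2
    then have b': "[b..<n] = b # [Suc b..<n]" using i by (simp add: upt_conv_Cons)
    have "wordS (i # is) = wordS ([Suc b..<n] @ js)"
      using 2 i w b' by (simp add: mult.assoc S_S_assoc)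
    moreover have "word_perm (i # is) = word_perm ([Suc b..<n] @ js)"
      using 2 p b' by (simp add: word_perm_append o_assoc[symmetric])
    ultimately show ?thesis using i 2 js by (intro exI[of _ "Suc b"] exI[of _ js]) auto
  next
    case 3
    have "wordS (i # is) = wordS ([b..<n] @ (i - 1) # js)"
      using S_wordS_upt_greater[OF assms(1) b(1) 3 i(2)] w by (simp add: mult.assoc[symmetric])
    moreover have "zperm b n \<circ> Transposition.transpose i (Suc i)
        = Transposition.transpose (i - 1) (Suc (i - 1)) \<circ> zperm b n"
      using 3 b i by (auto simp: zperm_def fun_eq_iff Transposition.transpose_def)
    then have "word_perm (i # is) = word_perm ([b..<n] @ (i - 1) # js)"
      using p b 3 by (simp add: word_perm_append word_perm_upt o_assoc[symmetric])
    ultimately show ?thesis using 3 i b js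
      by (intro exI[of _ b] exI[of _ "(i - 1) # js"]) auto
  next
    case 4
    have "wordS [b..<n] * S i = S i * wordS [b..<n]"
      using 4 i assms by (intro wordS_commute S_far[symmetric]) auto
    then have "wordS (i # is) = wordS ([b..<n] @ i # js)"
      using w by (simp add: mult.assoc[symmetric])
    moreover have "zperm b n \<circ> Transposition.transpose i (Suc i)
        = Transposition.transpose i (Suc i) \<circ> zperm b n"
      using 4 b i by (auto simp: zperm_def fun_eq_iff Transposition.transpose_def)
    then have "word_perm (i # is) = word_perm ([b..<n] @ i # js)"
      using p b by (simp add: word_perm_append word_perm_upt o_assoc[symmetric])
    ultimately show ?thesis using 4 i b js
      by (intro exI[of _ b] exI[of _ "i # js"]) auto
  qed
qed

lemma normal_form_position:
  assumes "1 \<le> b" "b \<le> n" "set js \<subseteq> {1..<n - 1}"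
  shows "word_perm ([b..<n] @ js) x = n \<longleftrightarrow> x = b"
proof -
  have "word_perm js n = n"
    using word_perm_fixes[OF assms(3)] assms(1,2) by simp
  then have "word_perm ([b..<n] @ js) b = n"
    using assms by (simp add: word_perm_append word_perm_upt zperm_def)
  then show ?thesis using word_perm_bij[of "[b..<n] @ js"] by (metis bij_pointE)
qed

text \<open>In the normal form b is the point sent to n, so the permutation determines it;
  cancelling the cycle leaves the same question for n - 1. Thus the map from generators to ring
  elements is well defined on permutations.\<close>

lemma wordS_unique:
  assumes "n \<le> k" "set is \<subseteq> {1..<n}" "set js \<subseteq> {1..<n}" "word_perm is = word_perm js"
  shows "wordS is = wordS js"
  using assms
proof (induction n arbitrary: "is" js)
  case (Suc n)
  obtain b is' where b: "1 \<le> b" "b \<le> Suc n" "set is' \<subseteq> {1..<Suc n - 1}"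
      "wordS is = wordS ([b..<Suc n] @ is')" "word_perm is = word_perm ([b..<Suc n] @ is')"
    using word_normal_form[of "Suc n" "is"] Suc.prems by auto
  obtain b' js' where b': "1 \<le> b'" "b' \<le> Suc n" "set js' \<subseteq> {1..<Suc n - 1}"
      "wordS js = wordS ([b'..<Suc n] @ js')" "word_perm js = word_perm ([b'..<Suc n] @ js')"
    using word_normal_form[of "Suc n" js] Suc.prems by auto
  have "b = b'"
    using normal_form_position[OF b(1-3), of b] normal_form_position[OF b'(1-3), of b] b(5) b'(5) Suc.prems(4)
    by simp
  have "word_perm is = word_perm is' \<circ> zperm b (Suc n)"
    by (simp only: b(5) word_perm_append word_perm_upt[OF b(2)])
  moreover have "word_perm js = word_perm js' \<circ> zperm b' (Suc n)"
    by (simp only: b'(5) word_perm_append word_perm_upt[OF b'(2)])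
  ultimately have "word_perm is' \<circ> zperm b (Suc n) = word_perm js' \<circ> zperm b (Suc n)"
    using \<open>b = b'\<close> Suc.prems(4) by (simp only:)
  then have "word_perm is' = word_perm js'"
    using permutes_surj[OF zperm_permutes[OF b(1,2)]] by (metis surj_fun_eq image_eqI UNIV_I)
  then have "wordS is' = wordS js'" using Suc.IH[of is' js'] b(3) b'(3) Suc.prems(1) by auto
  then show ?case using b(4) b'(4) \<open>b = b'\<close> by simp
qed simp

section \<open>Degrees in the last Jucys-Murphy element, and leading terms\<close>

section \<open>Filtrations by the degree in the last Jucys-Murphy element\<close>

text \<open>The image of H_{k-1}, with the parameters as scalars: the subring generated by them and
  by the generators with smaller indices.\<close>

inductive_set Sub :: "'a set" where
  Sub_1: "1 \<in> Sub"
| Sub_q: "q j \<in> Sub"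
| Sub_S: "1 \<le> i \<Longrightarrow> i < k - 1 \<Longrightarrow> S i \<in> Sub"
| Sub_L: "1 \<le> i \<Longrightarrow> i \<le> k - 1 \<Longrightarrow> L i \<in> Sub"
| Sub_add: "a \<in> Sub \<Longrightarrow> b \<in> Sub \<Longrightarrow> a + b \<in> Sub"
| Sub_diff: "a \<in> Sub \<Longrightarrow> b \<in> Sub \<Longrightarrow> a - b \<in> Sub"
| Sub_mult: "a \<in> Sub \<Longrightarrow> b \<in> Sub \<Longrightarrow> a * b \<in> Sub"

text \<open>\<open>V d\<close> is $H_{k-1} s_{k-1} H_{k-1} + \sum_{j<d} H_{k-1} L_k^j$, and \<open>T d\<close> is
  $\sum_{j<d} R S_k H_{k-1} L_k^j$. The latter is stable under left multiplication by $S_k$.\<close>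

inductive_set V :: "nat \<Rightarrow> 'a set" for d where
  V_0: "0 \<in> V d"
| V_HsH: "2 \<le> k \<Longrightarrow> a \<in> Sub \<Longrightarrow> b \<in> Sub \<Longrightarrow> a * S (k - 1) * b \<in> V d"
| V_power: "a \<in> Sub \<Longrightarrow> j < d \<Longrightarrow> a * L k ^ j \<in> V d"
| V_add: "x \<in> V d \<Longrightarrow> y \<in> V d \<Longrightarrow> x + y \<in> V d"

inductive_set T :: "nat \<Rightarrow> 'a set" for d where
  T_0: "0 \<in> T d"
| T_word: "set is \<subseteq> {1..<k} \<Longrightarrow> a \<in> Sub \<Longrightarrow> j < d \<Longrightarrow> wordS is * a * L k ^ j \<in> T d"
| T_add: "x \<in> T d \<Longrightarrow> y \<in> T d \<Longrightarrow> x + y \<in> T d"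

lemma Sub_0: "0 \<in> Sub"
  using Sub_diff[OF Sub_1 Sub_1] by simp

lemma Sub_uminus: "a \<in> Sub \<Longrightarrow> - a \<in> Sub"
  using Sub_diff[OF Sub_0] by force

lemma Sub_prod_list: "(\<And>x. x \<in> set xs \<Longrightarrow> x \<in> Sub) \<Longrightarrow> prod_list xs \<in> Sub"
  by (induction xs) (auto intro: Sub_1 Sub_mult)

lemma Sub_wordS: "set is \<subseteq> {1..<k - 1} \<Longrightarrow> wordS is \<in> Sub"
  unfolding wordS_def using Sub_S by (intro Sub_prod_list) force

lemma Sub_L_k:
  assumes "1 \<le> k" "a \<in> Sub"
  shows "a * L k = L k * a"
  using assms(2)
proof induction
  case (Sub_S i)
  then show ?case using S_L[of i k] by simp
next
  case (Sub_L i)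
  then show ?case using L_L[of i k] by simp
next
  case (Sub_q j)
  then show ?case using q_L assms(1) by simp
qed (auto simp: distrib_left distrib_right left_diff_distrib right_diff_distrib intro!: commutes_mult)

lemma Sub_L_k_power: "1 \<le> k \<Longrightarrow> a \<in> Sub \<Longrightarrow> a * L k ^ j = L k ^ j * a"
  by (rule commutes_power[OF Sub_L_k])

lemma V_mono: "x \<in> V d \<Longrightarrow> d \<le> d' \<Longrightarrow> x \<in> V d'"
  by (induction rule: V.induct) (blast intro: V.intros less_le_trans)+

lemma V_left: "x \<in> V d \<Longrightarrow> c \<in> Sub \<Longrightarrow> c * x \<in> V d"
proof (induction rule: V.induct)
  case (V_HsH a b)
  then show ?case using V.V_HsH[of "c * a" b] by (simp add: mult.assoc Sub_mult)
next
  case (V_power a j)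
  then show ?case using V.V_power[of "c * a" j] by (simp add: mult.assoc Sub_mult)
qed (auto simp: distrib_left intro: V.intros)

lemma V_uminus: "x \<in> V d \<Longrightarrow> - x \<in> V d"
  using V_left[OF _ Sub_uminus[OF Sub_1]] by force

lemma V_diff: "x \<in> V d \<Longrightarrow> y \<in> V d \<Longrightarrow> x - y \<in> V d"
  using V_add[OF _ V_uminus] by force

lemma V_sum: "(\<And>x. x \<in> A \<Longrightarrow> f x \<in> V d) \<Longrightarrow> sum f A \<in> V d"
  by (induction A rule: infinite_finite_induct) (auto intro: V_0 V_add)

lemma V_right: "1 \<le> k \<Longrightarrow> x \<in> V d \<Longrightarrow> c \<in> Sub \<Longrightarrow> x * c \<in> V d"
proof (rotate_tac 1, induction rule: V.induct)
  case (V_HsH a b)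
  then show ?case using V.V_HsH[of a "b * c"] by (simp add: mult.assoc Sub_mult)
next
  case (V_power a j)
  have "a * L k ^ j * c = a * c * L k ^ j"
    using V_power Sub_L_k_power[of c j] by (simp add: mult.assoc)
  then show ?case using V.V_power[of "a * c" j] V_power by (simp add: Sub_mult)
qed (auto simp: distrib_right intro: V.intros)

lemma V_L: "1 \<le> k \<Longrightarrow> x \<in> V d \<Longrightarrow> x * L k \<in> V (Suc d)"
proof (rotate_tac 1, induction rule: V.induct)
  case (V_HsH a b)
  have "a * S (k - 1) * b * L k = a * (S (k - 1) * L k) * b"
    using Sub_L_k[of b] V_HsH by (simp add: mult.assoc)
  \<comment> \<open>The correction 1 leaves a term of degree 0 in L_k, which is why d has to become
    d + 1 even for elements of the first summand.\<close>
  also have "S (k - 1) * L k = L (k - 1) * S (k - 1) + 1"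
    using S_L_Suc[of "k - 1"] V_HsH by simp
  also have "a * (L (k - 1) * S (k - 1) + 1) * b = a * L (k - 1) * S (k - 1) * b + a * b * L k ^ 0"
    by (simp add: distrib_left distrib_right mult.assoc)
  also have "\<dots> \<in> V (Suc d)"
    using V_HsH by (intro V.intros Sub_mult Sub_L) auto
  finally show ?case .
next
  case (V_power a j)
  have "a * L k ^ j * L k = a * L k ^ Suc j" by (simp only: power_Suc2 mult.assoc)
  then show ?case using V.V_power[of a "Suc j" "Suc d"] V_power by simp
qed (auto simp: distrib_right intro: V.intros)

lemma V_L_q: "1 \<le> k \<Longrightarrow> x \<in> V d \<Longrightarrow> x * (L k - q j) \<in> V (Suc d)"
  using V_diff[OF V_L[of x d] V_mono[OF V_right[of x d "q j"], of "Suc d"]]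
  by (simp add: right_diff_distrib Sub_q)

lemma T_mono: "x \<in> T d \<Longrightarrow> d \<le> d' \<Longrightarrow> x \<in> T d'"
  by (induction rule: T.induct) (blast intro: T.intros less_le_trans)+

lemma T_left: "x \<in> T d \<Longrightarrow> set is \<subseteq> {1..<k} \<Longrightarrow> wordS is * x \<in> T d"
proof (induction rule: T.induct)
  case (T_word js a j)
  then show ?case using T.T_word[of "is @ js" a j] by (simp add: mult.assoc)
qed (auto simp: distrib_left intro: T.intros)

lemma T_right: "1 \<le> k \<Longrightarrow> x \<in> T d \<Longrightarrow> c \<in> Sub \<Longrightarrow> x * c \<in> T d"
proof (rotate_tac 1, induction rule: T.induct)
  case (T_word js a j)
  have "wordS js * a * L k ^ j * c = wordS js * (a * c) * L k ^ j"
    using T_word Sub_L_k_power[of c j] by (simp add: mult.assoc)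
  then show ?case using T.T_word[of js "a * c" j] T_word by (simp add: Sub_mult)
qed (auto simp: distrib_right intro: T.intros)

lemma T_uminus: "1 \<le> k \<Longrightarrow> x \<in> T d \<Longrightarrow> - x \<in> T d"
  using T_right[OF _ _ Sub_uminus[OF Sub_1]] by force

lemma T_diff: "1 \<le> k \<Longrightarrow> x \<in> T d \<Longrightarrow> y \<in> T d \<Longrightarrow> x - y \<in> T d"
  using T_add[OF _ T_uminus] by force

lemma T_sum: "(\<And>x. x \<in> A \<Longrightarrow> f x \<in> T d) \<Longrightarrow> sum f A \<in> T d"
  by (induction A rule: infinite_finite_induct) (auto intro: T_0 T_add)

lemma T_L: "x \<in> T d \<Longrightarrow> x * L k \<in> T (Suc d)"
proof (induction rule: T.induct)
  case (T_word js a j)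
  have "wordS js * a * L k ^ j * L k = wordS js * a * L k ^ Suc j" by (simp only: power_Suc2 mult.assoc)
  then show ?case using T.T_word[of js a "Suc j" "Suc d"] T_word by simp
qed (auto simp: distrib_right intro: T.intros)

lemma T_L_power: "x \<in> T d \<Longrightarrow> x * L k ^ j \<in> T (d + j)"
  by (induction j) (use T_L in \<open>auto simp: power_Suc2 mult.assoc[symmetric] simp del: power_Suc\<close>)

lemma T_L_q: "1 \<le> k \<Longrightarrow> x \<in> T d \<Longrightarrow> x * (L k - q j) \<in> T (Suc d)"
  using T_diff[OF _ T_L[of x d] T_mono[OF T_right[of x d "q j"], of "Suc d"]]
  by (simp add: right_diff_distrib Sub_q)

text \<open>If the permutation moves k, its normal form has b < k and contains s_{k-1} exactly once,
  at the end of \<open>[b..<k]\<close>. If it fixes k, then b = k and that letter is absent.\<close>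

lemma word_in_V:
  assumes "1 \<le> k" "set is \<subseteq> {1..<k}" "word_perm is k \<noteq> k" "a \<in> Sub"
  shows "wordS is * a \<in> V 0"
proof -
  obtain b js where b: "1 \<le> b" "b \<le> k" "set js \<subseteq> {1..<k - 1}"
      "wordS is = wordS ([b..<k] @ js)" "word_perm is = word_perm ([b..<k] @ js)"
    using word_normal_form[of k "is"] assms by auto
  have "b \<noteq> k" using normal_form_position[OF b(1-3), of k] b(5) assms(3) by auto
  then have k: "2 \<le> k" "b \<le> k - 1" using b by auto
  then have "[b..<k] = [b..<k - 1] @ [k - 1]" using upt_Suc_append[of b "k - 1"] by simp
  then have "wordS is * a = wordS [b..<k - 1] * S (k - 1) * (wordS js * a)"
    unfolding b(4) by (simp add: mult.assoc)
  also have "\<dots> \<in> V 0"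
    using k b assms by (intro V_HsH Sub_wordS Sub_mult) auto
  finally show ?thesis .
qed

lemma word_in_Sub:
  assumes "1 \<le> k" "set is \<subseteq> {1..<k}" "word_perm is k = k"
  shows "wordS is \<in> Sub"
proof -
  obtain b js where b: "1 \<le> b" "b \<le> k" "set js \<subseteq> {1..<k - 1}"
      "wordS is = wordS ([b..<k] @ js)" "word_perm is = word_perm ([b..<k] @ js)"
    using word_normal_form[of k "is"] assms by auto
  have "b = k" using normal_form_position[OF b(1-3), of k] b(5) assms(3) by auto
  then show ?thesis using b Sub_wordS by simp
qed

lemma V_L_power: "1 \<le> k \<Longrightarrow> x \<in> V d \<Longrightarrow> x * L k ^ j \<in> V (d + j)"
  by (induction j) (use V_L in \<open>auto simp: power_Suc2 mult.assoc[symmetric] simp del: power_Suc\<close>)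

text \<open>A word fixing k is absorbed into the coefficient from H_{k-1}. Any other word puts its
  product with the coefficient into \<open>V 0\<close>, and L_k^j then raises the degree bound by j,
  which is less than d.\<close>

lemma T_subset_V: "1 \<le> k \<Longrightarrow> x \<in> T d \<Longrightarrow> x \<in> V d"
proof (rotate_tac 1, induction rule: T.induct)
  case (T_word "is" a j)
  show ?case
  proof (cases "word_perm is k = k")
    case True
    then show ?thesis using T_word by (intro V_power Sub_mult word_in_Sub)
  next
    case False
    then have "wordS is * a * L k ^ j \<in> V (0 + j)"
      using T_word by (intro V_L_power word_in_V)
    then show ?thesis by (rule V_mono) (use T_word in simp)
  qed
qed (auto intro: V.intros)

section \<open>Moving the products of Jucys-Murphy elements across a cycle\<close>

definition U :: "nat \<Rightarrow> nat \<Rightarrow> 'a" where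
  "U a j = prod_list (map (\<lambda>i. L i - q j) [1..<Suc a])"

lemma U_Suc: "U (Suc a) j = U a j * (L (Suc a) - q j)"
  by (simp add: U_def)

text \<open>The product is symmetric in L_i and L_{i+1}, and s_i commutes with their sum and their
  product: the corrections +1 and -1 in \<open>S_L_Suc\<close> and \<open>L_Suc_S\<close>
  cancel.\<close>

lemma S_L_pair:
  assumes "1 \<le> i" "i < k"
  shows "S i * ((L i - q j) * (L (Suc i) - q j)) = (L i - q j) * (L (Suc i) - q j) * S i"
proof -
  have a: "S i * L (Suc i) = L i * S i + 1" and b: "S i * L i = L (Suc i) * S i - 1"
    using S_L_Suc[OF assms] L_Suc_S[OF assms] by simp_all
  have LL: "L (Suc i) * L i = L i * L (Suc i)" using L_L[of i "Suc i"] assms by simp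
  have qS: "S i * q j = q j * S i" using q_S assms by simp
  have qL: "L i * q j = q j * L i" "L (Suc i) * q j = q j * L (Suc i)" using q_L assms by simp_all
  have 1: "S i * (L i * L (Suc i)) = L i * L (Suc i) * S i"
  proof -
    have "S i * (L i * L (Suc i)) = L (Suc i) * (S i * L (Suc i)) - L (Suc i)"
      unfolding mult.assoc[symmetric] b by (simp add: left_diff_distrib mult.assoc)
    also have "\<dots> = L (Suc i) * L i * S i" unfolding a by (simp add: distrib_left mult.assoc)
    finally show ?thesis by (simp add: LL)
  qed
  have 2: "S i * (q j * (L i + L (Suc i))) = q j * (L i + L (Suc i)) * S i"
  proof -
    have "S i * (q j * (L i + L (Suc i))) = q j * (S i * L i + S i * L (Suc i))"
      unfolding mult.assoc[symmetric] qS by (simp add: mult.assoc distrib_left)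
    then show ?thesis unfolding a b by (simp add: mult.assoc distrib_right add.commute)
  qed
  have 3: "S i * (q j * q j) = q j * q j * S i" by (metis qS mult.assoc)
  have "(L i - q j) * (L (Suc i) - q j) = L i * L (Suc i) - q j * (L i + L (Suc i)) + q j * q j"
    by (simp add: left_diff_distrib right_diff_distrib distrib_left qL)
  then show ?thesis
    by (simp only: 1 2 3 distrib_left[of "S i"] distrib_right[of _ _ "S i"]
        left_diff_distrib[of _ _ "S i"] right_diff_distrib[of "S i"])
qed

text \<open>For i distinct from a, either both or neither of L_i and L_{i+1} occur in
  \<open>U a j\<close>, so \<open>S_L_pair\<close> applies.\<close>

lemma U_S:
  assumes "1 \<le> i" "i < k" "a \<le> k" "i \<noteq> a"
  shows "U a j * S i = S i * U a j"
proof (cases "a < i")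
  case True
  show ?thesis unfolding U_def
    using True assms S_L q_S by (intro commutes_prod_list) (auto intro!: commutes_diff S_L[symmetric] q_S)
next
  case False
  then have "Suc i \<le> a" using assms by simp
  then show ?thesis using assms(3)
  proof (induction a rule: dec_induct)
    case base
    have "U i j = U (i - 1) j * (L i - q j)" using U_Suc[of "i - 1" j] assms by simp
    then have "U (Suc i) j * S i = U (i - 1) j * ((L i - q j) * (L (Suc i) - q j) * S i)"
      by (simp add: U_Suc mult.assoc)
    also have "\<dots> = U (i - 1) j * S i * ((L i - q j) * (L (Suc i) - q j))"
      unfolding S_L_pair[OF assms(1,2), symmetric] by (simp add: mult.assoc)
    also have "U (i - 1) j * S i = S i * U (i - 1) j"
      unfolding U_def using assms
      by (intro commutes_prod_list) (auto intro!: commutes_diff S_L[symmetric] q_S)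
    also have "S i * U (i - 1) j * ((L i - q j) * (L (Suc i) - q j)) = S i * U (Suc i) j"
      using U_Suc[of "i - 1" j] U_Suc[of i j] assms by (simp add: mult.assoc)
    finally show ?case .
  next
    case (step a)
    then show ?case unfolding U_Suc using assms
      by (intro commutes_mult) (auto intro!: commutes_diff S_L[symmetric] q_S)
  qed
qed

lemma U_U:
  assumes "a \<le> k" "a' \<le> k"
  shows "U a j * U a' j' = U a' j' * U a j"
  unfolding U_def using assms
  by (intro commutes_prod_list commutes_prod_list[symmetric])
    (auto intro!: commutes_diff commutes_diff[symmetric] L_L q_L q_L[symmetric] q_q)

lemma U_in_Sub: "a \<le> k - 1 \<Longrightarrow> U a j \<in> Sub"
  unfolding U_def using Sub_L by (intro Sub_prod_list) (force intro: Sub_diff Sub_q)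

lemma U_wordS: "set is \<subseteq> {1..<k} \<Longrightarrow> a \<le> k \<Longrightarrow> a \<notin> set is \<Longrightarrow> U a j * wordS is = wordS is * U a j"
  by (rule wordS_commute[symmetric]) (auto intro!: U_S[symmetric])

text \<open>The error is a combination of words in s_a, ..., s_{k-1}: each crossing of a letter
  drops that letter from the cycle and leaves a correction. It therefore commutes with products of
  L_1, ..., L_{a-1} shifted by scalars, and has degree 0 in L_k. The induction lowers a and carries
  the commutation for all smaller indices at once.\<close>

lemma L_cycle:
  assumes "1 \<le> a" "a \<le> k"
  shows "\<exists>E. (L a - q j) * wordS [a..<k] = wordS [a..<k] * (L k - q j) + E
     \<and> E * U (a - 1) j' = U (a - 1) j' * E
     \<and> (\<forall>is c. set is \<subseteq> {1..<k} \<longrightarrow> c \<in> Sub \<longrightarrow> wordS is * E * c \<in> T 1)"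
proof -
  have "\<exists>E. (L a - q j) * wordS [a..<k] = wordS [a..<k] * (L k - q j) + E
     \<and> (\<forall>a' j'. a' < a \<longrightarrow> E * U a' j' = U a' j' * E)
     \<and> (\<forall>is c. set is \<subseteq> {1..<k} \<longrightarrow> c \<in> Sub \<longrightarrow> wordS is * E * c \<in> T 1)"
    using assms(2,1)
  proof (induction a rule: inc_induct)
    case base
    then show ?case by (intro exI[of _ 0]) (simp add: T_0)
  next
    case (step a)
    let ?z = "wordS [Suc a..<k]"
    from step obtain E where E: "(L (Suc a) - q j) * ?z = ?z * (L k - q j) + E"
      "\<And>a' j'. a' < Suc a \<Longrightarrow> E * U a' j' = U a' j' * E"
      "\<And>is c. set is \<subseteq> {1..<k} \<Longrightarrow> c \<in> Sub \<Longrightarrow> wordS is * E * c \<in> T 1" by auto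
    have a: "1 \<le> a" "a < k" using step by auto
    have z: "wordS [a..<k] = S a * ?z" using wordS_upt a by simp
    have "L a * S a = S a * L (Suc a) - 1"
      using S_L_Suc[of a] a by simp
    then have "(L a - q j) * S a = S a * (L (Suc a) - q j) - 1"
      using q_S[of a j] a by (simp add: left_diff_distrib right_diff_distrib)
    then have "(L a - q j) * S a * ?z = (S a * (L (Suc a) - q j) - 1) * ?z" by simp
    then have "(L a - q j) * wordS [a..<k] = S a * ((L (Suc a) - q j) * ?z) - ?z"
      unfolding z by (simp only: left_diff_distrib[of _ 1] mult.assoc mult_1_left)
    also have "\<dots> = wordS [a..<k] * (L k - q j) + (S a * E - ?z)"
      unfolding E(1) z by (simp add: distrib_left mult.assoc)
    finally have 1: "(L a - q j) * wordS [a..<k] = wordS [a..<k] * (L k - q j) + (S a * E - ?z)" .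
    have 2: "(S a * E - ?z) * U a' j' = U a' j' * (S a * E - ?z)" if "a' < a" for a' j'
      using that a U_S[of a a' j'] U_wordS[of "[Suc a..<k]" a' j'] E(2)[of a' j']
      by (intro commutes_diff commutes_mult) auto
    have 3: "wordS is * (S a * E - ?z) * c \<in> T 1" if "set is \<subseteq> {1..<k}" "c \<in> Sub" for "is" c
    proof -
      have "wordS is * (S a * E - ?z) * c = wordS (is @ [a]) * E * c - wordS (is @ [Suc a..<k]) * c * L k ^ 0"
        by (simp add: left_diff_distrib right_diff_distrib mult.assoc)
      also have "\<dots> \<in> T 1" using that a by (intro T_diff T_word E(3)) auto
      finally show ?thesis .
    qed
    show ?case using 1 2 3 by blast
  qed
  then obtain E where "(L a - q j) * wordS [a..<k] = wordS [a..<k] * (L k - q j) + E"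
     "\<And>a' j'. a' < a \<Longrightarrow> E * U a' j' = U a' j' * E"
     "\<forall>is c. set is \<subseteq> {1..<k} \<longrightarrow> c \<in> Sub \<longrightarrow> wordS is * E * c \<in> T 1" by blast
  then show ?thesis using assms by (intro exI[of _ E]) auto
qed

lemma U_cycle_less: "1 \<le> b \<Longrightarrow> a < b \<Longrightarrow> b \<le> k \<Longrightarrow> U a j * wordS [b..<k] = wordS [b..<k] * U a j"
  by (rule U_wordS) auto

text \<open>Splitting the cycle at a, the whole product commutes with s_b...s_{a-1}, and its part
  below a commutes with s_a...s_{k-1}. Only the last factor L_a - q_j has to cross, and it becomes
  L_k - q_j by \<open>L_cycle\<close>.\<close>

lemma U_cycle:
  assumes "1 \<le> b" "b \<le> a" "a \<le> k"
  shows "U a j * wordS [b..<k] - wordS [b..<k] * U (a - 1) j * (L k - q j) \<in> T 1"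
proof -
  have a: "1 \<le> a" using assms by simp
  obtain E where E: "(L a - q j) * wordS [a..<k] = wordS [a..<k] * (L k - q j) + E"
     "E * U (a - 1) j = U (a - 1) j * E"
     "\<And>is c. set is \<subseteq> {1..<k} \<Longrightarrow> c \<in> Sub \<Longrightarrow> wordS is * E * c \<in> T 1"
    using L_cycle[OF a assms(3), of j j] by blast
  let ?y = "wordS [b..<a]" and ?z = "wordS [a..<k]"
  have split: "wordS [b..<k] = ?y * ?z"
    using upt_add_eq_append[of b a "k - a"] assms by (simp del: upt_Suc)
  have U: "U a j = U (a - 1) j * (L a - q j)" using U_Suc[of "a - 1" j] a by simp
  have 1: "U a j * ?y = ?y * U a j" using assms by (intro U_wordS) auto
  have 2: "U (a - 1) j * ?z = ?z * U (a - 1) j" using assms by (intro U_wordS) auto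
  have Lk: "(L k - q j) * U (a - 1) j = U (a - 1) j * (L k - q j)"
    using assms U_in_Sub[of "a - 1" j] Sub_L_k Sub_q[of j] q_L q_q
    unfolding U_def by (intro commutes_prod_list[symmetric])
      (auto intro!: commutes_diff commutes_diff[symmetric] L_L q_L q_L[symmetric] q_q)
  have "U a j * wordS [b..<k] = ?y * (U a j * ?z)"
    unfolding split by (simp only: mult.assoc[symmetric] 1)
  also have "\<dots> = ?y * (U (a - 1) j * (?z * (L k - q j) + E))"
    unfolding U by (simp only: mult.assoc E(1))
  also have "\<dots> = ?y * (?z * U (a - 1) j) * (L k - q j) + ?y * (E * U (a - 1) j)"
    unfolding E(2) 2[symmetric] by (simp only: distrib_left mult.assoc)
  finally have "U a j * wordS [b..<k] - wordS [b..<k] * U (a - 1) j * (L k - q j) = ?y * E * U (a - 1) j"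
    unfolding split by (simp add: mult.assoc)
  also have "\<dots> \<in> T 1" using assms by (intro E(3) U_in_Sub) auto
  finally show ?thesis .
qed

text \<open>With the word in normal form, the product either commutes with the cycle or releases a
  single factor L_k - q_j on crossing it. The degree in L_k therefore grows by at most one.\<close>

lemma U_T:
  assumes "1 \<le> k" "a \<le> k" "x \<in> T d"
  shows "U a j * x \<in> T (Suc d)"
  using assms(3)
proof induction
  case (T_word "is" c i)
  obtain b js where b: "1 \<le> b" "b \<le> k" "set js \<subseteq> {1..<k - 1}" "wordS is = wordS ([b..<k] @ js)"
    using word_normal_form[of k "is"] assms T_word by auto
  define c' where "c' = wordS js * c"
  have c': "c' \<in> Sub" using Sub_wordS[OF b(3)] T_word by (auto simp: c'_def intro: Sub_mult)
  have x: "U a j * (wordS is * c * L k ^ i) = U a j * wordS [b..<k] * c' * L k ^ i"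
    unfolding b(4) c'_def by (simp add: mult.assoc)
  have bk: "set [b..<k] \<subseteq> {1..<k}" using b by auto
  show ?case
  proof (cases "a < b")
    case True
    have "U a j * wordS [b..<k] * c' * L k ^ i = wordS [b..<k] * (U a j * c') * L k ^ i"
      using U_cycle_less[OF b(1) True b(2)] by (simp add: mult.assoc)
    also have "\<dots> \<in> T (Suc d)"
      using T_word True b c' bk by (intro T.T_word Sub_mult U_in_Sub) auto
    finally show ?thesis unfolding x .
  next
    case False
    define E where "E = U a j * wordS [b..<k] - wordS [b..<k] * U (a - 1) j * (L k - q j)"
    have E: "E \<in> T 1" unfolding E_def using False b assms by (intro U_cycle) auto
    have "U a j * wordS [b..<k] * c' * L k ^ i
        = wordS [b..<k] * (U (a - 1) j) * (L k - q j) * c' * L k ^ i + E * c' * L k ^ i"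
      by (simp add: E_def left_diff_distrib)
    also have "wordS [b..<k] * (U (a - 1) j) * (L k - q j) * c' * L k ^ i
       = wordS [b..<k] * (U (a - 1) j * c') * L k ^ Suc i - wordS [b..<k] * (U (a - 1) j * q j * c') * L k ^ i"
    proof -
      have "L k * (c' * y) = c' * (L k * y)" for y
        using Sub_L_k[OF assms(1) c'] by (metis mult.assoc)
      then show ?thesis by (simp add: left_diff_distrib right_diff_distrib mult.assoc)
    qed
    also have "\<dots> + E * c' * L k ^ i \<in> T (Suc d)"
      using T_word assms b c' bk T_mono[OF T_L_power[OF T_right[OF assms(1) E c'], of i], of "Suc d"]
      by (intro T_add T_diff T.T_word Sub_mult U_in_Sub Sub_q) auto
    finally show ?thesis unfolding x .
  qed
qed (auto simp: distrib_left intro: T.intros)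

text \<open>The list consists of the pairs (a_s, s), and \<open>UP\<close> is the corresponding u^+.
  When it crosses the cycle, \<open>QP\<close> collects the factors L_k - q_s that are released, and
  \<open>dec\<close> lowers each a_s by one.\<close>

definition UP :: "(nat \<times> nat) list \<Rightarrow> 'a" where
  "UP ps = prod_list (map (\<lambda>(a, j). U a j) ps)"

definition QP :: "(nat \<times> nat) list \<Rightarrow> 'a" where
  "QP ps = prod_list (map (\<lambda>(a, j). L k - q j) ps)"

definition dec :: "(nat \<times> nat) list \<Rightarrow> (nat \<times> nat) list" where
  "dec ps = map (\<lambda>(a, j). (a - 1, j)) ps"

lemma UP_simps [simp]: "UP [] = 1" "UP ((a, j) # ps) = U a j * UP ps"
  by (simp_all add: UP_def)

lemma QP_simps [simp]: "QP [] = 1" "QP ((a, j) # ps) = (L k - q j) * QP ps"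
  by (simp_all add: QP_def)

lemma dec_simps [simp]: "dec [] = []" "dec ((a, j) # ps) = (a - 1, j) # dec ps"
  by (simp_all add: dec_def)

lemma UP_dec_in_Sub: "(\<And>a j. (a, j) \<in> set ps \<Longrightarrow> a \<le> k) \<Longrightarrow> UP (dec ps) \<in> Sub"
proof (induction ps rule: list.induct)
  case (Cons p ps)
  obtain a j where p: "p = (a, j)" by (cases p)
  have "a \<le> k" using Cons.prems[of a j] p by simp
  then have "U (a - 1) j \<in> Sub" by (intro U_in_Sub) simp
  then show ?case using Cons p by (auto intro: Sub_mult)
qed (simp add: Sub_1)

lemma T_QP: "1 \<le> k \<Longrightarrow> x \<in> T d \<Longrightarrow> x * QP ps \<in> T (d + length ps)"
proof (induction ps arbitrary: x d)
  case (Cons p ps)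
  then show ?case using Cons.IH[of "x * (L k - q (snd p))" "Suc d"] T_L_q[of x d "snd p"]
    by (cases p) (simp add: mult.assoc)
qed simp

lemma V_QP: "1 \<le> k \<Longrightarrow> x \<in> V d \<Longrightarrow> x * QP ps \<in> V (d + length ps)"
proof (induction ps arbitrary: x d)
  case (Cons p ps)
  then show ?case using Cons.IH[of "x * (L k - q (snd p))" "Suc d"] V_L_q[of x d "snd p"]
    by (cases p) (simp add: mult.assoc)
qed simp

lemma QP_lead:
  assumes "1 \<le> k" "a \<in> Sub"
  shows "a * QP ps - a * L k ^ length ps \<in> V (length ps)"
  using assms(2)
proof (induction ps arbitrary: a)
  case (Cons p ps)
  obtain a' j where p: "p = (a', j)" by (cases p)
  have Lq: "QP ps * L k = L k * QP ps" "QP ps * q j = q j * QP ps"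
    unfolding QP_def using assms(1)
    by (intro commutes_prod_list; auto intro!: commutes_diff q_L q_q q_L[symmetric])+
  have "a * QP (p # ps) - a * L k ^ length (p # ps)
      = (a * QP ps - a * L k ^ length ps) * (L k - q j) + (- a * q j) * L k ^ length ps"
  proof -
    have "q j * L k ^ length ps = L k ^ length ps * q j"
      using q_L assms(1) by (intro commutes_power) simp
    then show ?thesis
      by (simp add: p left_diff_distrib right_diff_distrib mult.assoc Lq power_commutes)
  qed
  also have "\<dots> \<in> V (length (p # ps))"
    using V_L_q[OF assms(1) Cons.IH[OF Cons.prems], of j] Cons.prems
    by (auto intro!: V_add V_power Sub_mult Sub_uminus Sub_q simp del: mult_minus_left)
  finally show ?case .
qed (simp add: V_0)

lemma UP_T: "1 \<le> k \<Longrightarrow> (\<And>a j. (a, j) \<in> set ps \<Longrightarrow> a \<le> k) \<Longrightarrow> x \<in> T d \<Longrightarrow> UP ps * x \<in> T (d + length ps)"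
proof (induction ps rule: list.induct)
  case (Cons p ps)
  obtain a j where p: "p = (a, j)" by (cases p)
  then have "a \<le> k" "UP ps * x \<in> T (d + length ps)" using Cons.prems(2)[of a j] Cons by auto
  then show ?case using U_T[OF Cons.prems(1)] p by (simp add: mult.assoc)
qed simp

text \<open>The tail of the list crosses before its head. The error of the tail gains at most one
  degree from the head by \<open>U_T\<close>; the error of crossing the head has degree 0 and gains
  one degree for each factor in the \<open>QP\<close> of the tail.\<close>

lemma UP_cycle:
  assumes "1 \<le> m" "m \<le> k" "\<And>a j. (a, j) \<in> set ps \<Longrightarrow> m \<le> a \<and> a \<le> k"
  shows "UP ps * wordS [m..<k] - wordS [m..<k] * UP (dec ps) * QP ps \<in> T (length ps)"
  using assms(3)
proof (induction ps)
  case (Cons p ps)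
  have k: "1 \<le> k" using assms by simp
  obtain a j where p: "p = (a, j)" by (cases p)
  then have a: "m \<le> a" "a \<le> k" using Cons.prems[of a j] by auto
  have ps: "(a, j) \<in> set ps \<Longrightarrow> a \<le> k" for a j using Cons.prems[of a j] by simp
  let ?z = "wordS [m..<k]" and ?A = "UP (dec ps)" and ?B = "QP ps"
  define t where "t = UP ps * ?z - ?z * ?A * ?B"
  have t: "t \<in> T (length ps)" unfolding t_def using Cons by auto
  define e where "e = U a j * ?z - ?z * U (a - 1) j * (L k - q j)"
  have e: "e \<in> T 1" unfolding e_def using a assms by (intro U_cycle) auto
  have A: "?A \<in> Sub" using Cons.prems by (intro UP_dec_in_Sub) auto
  have LA: "(L k - q j) * ?A = ?A * (L k - q j)"
  proof -
    have "q j * ?A = ?A * q j"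
      unfolding UP_def dec_def U_def using Cons.prems
      by (intro commutes_prod_list[symmetric])
        (auto intro!: commutes_prod_list commutes_diff q_L[symmetric] q_q dest!: ps)
    then show ?thesis using Sub_L_k[OF k A] by (simp add: left_diff_distrib right_diff_distrib)
  qed
  have "UP (p # ps) * ?z = U a j * ?z * ?A * ?B + U a j * t"
    by (simp add: p t_def right_diff_distrib mult.assoc)
  also have "U a j * ?z * ?A * ?B = ?z * U (a - 1) j * ((L k - q j) * ?A) * ?B + e * ?A * ?B"
    by (simp add: e_def left_diff_distrib mult.assoc)
  also have "?z * U (a - 1) j * ((L k - q j) * ?A) * ?B = ?z * UP (dec (p # ps)) * QP (p # ps)"
    unfolding LA by (simp add: p mult.assoc)
  finally have "UP (p # ps) * ?z - ?z * UP (dec (p # ps)) * QP (p # ps) = e * ?A * ?B + U a j * t"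
    by simp
  also have "\<dots> \<in> T (length (p # ps))"
    using T_QP[OF k T_right[OF k e A], of ps] U_T[OF k a(2) t, of j] by (auto intro: T_add)
  finally show ?case .
qed (simp add: T_0)

text \<open>The factor with a < m commutes with the other factors and with the cycle, so it can be
  placed at the far right, where it lies in H_{k-1} and costs no degree. Only the remaining factors
  can raise the degree, which stays below the length of the list.\<close>

lemma UP_cycle_small:
  assumes "1 \<le> m" "m \<le> k" "\<And>a j. (a, j) \<in> set ps \<Longrightarrow> a \<le> k" "(a, j) \<in> set ps" "a < m"
  shows "UP ps * wordS [m..<k] \<in> T (length ps)"
  using assms(3,4)
proof (induction ps)
  case (Cons p ps)
  have k: "1 \<le> k" using assms by simp
  have z: "wordS [m..<k] \<in> T 1"
    using T_word[of "[m..<k]" 1 0 1] assms by (auto intro: Sub_1)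
  show ?case
  proof (cases "p = (a, j)")
    case True
    have "U a j * UP ps = UP ps * U a j"
      unfolding UP_def using Cons.prems assms(2,5)
      by (intro commutes_prod_list[symmetric]) (auto intro!: U_U)
    then have "UP (p # ps) * wordS [m..<k] = UP ps * wordS [m..<k] * U a j"
      using True U_cycle_less[OF assms(1,5,2), of j] by (simp add: mult.assoc)
    also have "\<dots> \<in> T (1 + length ps)"
      using assms Cons.prems by (intro T_right k UP_T z U_in_Sub) auto
    finally show ?thesis by simp
  next
    case False
    obtain a' j' where p: "p = (a', j')" by (cases p)
    then show ?thesis using False Cons U_T[OF k, of a' "UP ps * wordS [m..<k]" "length ps" j']
      by (simp add: mult.assoc) blast
  qed
qed simp

theorem murphy_lower:
  assumes "1 \<le> m" "m \<le> k" "\<And>a j. (a, j) \<in> set ps \<Longrightarrow> a \<le> k" "(a, j) \<in> set ps" "a < m"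
    and "set ds \<subseteq> {1..<k}" "\<And>w. w \<in> Y \<Longrightarrow> set (pw w) \<subseteq> {1..<k}" "set dt \<subseteq> {1..<k - 1}"
  shows "wordS ds * (\<Sum>w\<in>Y. wordS (pw w)) * UP ps * (wordS [m..<k] * wordS dt) \<in> V (length ps)"
proof -
  have k: "1 \<le> k" using assms by simp
  have "wordS ds * (\<Sum>w\<in>Y. wordS (pw w)) * UP ps * (wordS [m..<k] * wordS dt)
     = (\<Sum>w\<in>Y. wordS (ds @ pw w) * (UP ps * wordS [m..<k])) * wordS dt"
    by (simp add: sum_distrib_left sum_distrib_right mult.assoc)
  also have "\<dots> \<in> T (length ps)"
    using assms by (intro T_right k T_sum T_left UP_cycle_small Sub_wordS) auto
  finally show ?thesis by (rule T_subset_V[OF k])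
qed

text \<open>Words that fix k lie in H_{k-1}, and there \<open>QP\<close> may be replaced by its
  leading power of L_k. The other words lie in \<open>V 0\<close> and cannot reach degree
  \<open>length ps\<close> by multiplication with \<open>QP\<close>. The error from the crossing is
  estimated in \<open>T\<close> before it is transferred to \<open>V\<close>.\<close>

theorem murphy_lead:
  assumes "1 \<le> m" "m \<le> k" "\<And>a j. (a, j) \<in> set ps \<Longrightarrow> m \<le> a \<and> a \<le> k"
    and "set ds \<subseteq> {1..<k}" "finite Y" "\<And>w. w \<in> Y \<Longrightarrow> set (pw w) \<subseteq> {1..<k}" "set dt \<subseteq> {1..<k - 1}"
  defines "Y' \<equiv> {w \<in> Y. word_perm (ds @ pw w @ [m..<k]) k = k}"
  shows "wordS ds * (\<Sum>w\<in>Y. wordS (pw w)) * UP ps * (wordS [m..<k] * wordS dt)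
     - (\<Sum>w\<in>Y'. wordS (ds @ pw w @ [m..<k])) * UP (dec ps) * wordS dt * L k ^ length ps \<in> V (length ps)"
proof -
  have k: "1 \<le> k" using assms by simp
  let ?z = "wordS [m..<k]" and ?A = "UP (dec ps)" and ?r = "length ps"
  define t where "t = UP ps * ?z - ?z * ?A * QP ps"
  have t: "t \<in> T ?r" unfolding t_def using assms by (intro UP_cycle) auto
  have A: "?A \<in> Sub" using assms by (intro UP_dec_in_Sub) auto
  have dt: "wordS dt \<in> Sub" using assms by (intro Sub_wordS)
  define g where "g w = wordS (ds @ pw w @ [m..<k])" for w
  have word: "set (ds @ pw w @ [m..<k]) \<subseteq> {1..<k}" if "w \<in> Y" for w
    using assms that by auto
  have "wordS ds * (\<Sum>w\<in>Y. wordS (pw w)) * UP ps * (?z * wordS dt)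
     = (\<Sum>w\<in>Y. wordS (ds @ pw w) * (?z * ?A * QP ps + t)) * wordS dt"
    by (simp add: sum_distrib_left sum_distrib_right mult.assoc t_def)
  also have "\<dots> = (\<Sum>w\<in>Y. g w * ?A * QP ps) * wordS dt + (\<Sum>w\<in>Y. wordS (ds @ pw w) * t) * wordS dt"
    by (simp add: g_def distrib_left distrib_right sum.distrib mult.assoc)
  also have "(\<Sum>w\<in>Y. g w * ?A * QP ps) = (\<Sum>w\<in>Y'. g w * ?A * QP ps) + (\<Sum>w\<in>Y - Y'. g w * ?A * QP ps)"
    using assms(5) by (subst sum.subset_diff[of Y' Y]) (auto simp: Y'_def add.commute)
  also have "(\<Sum>w\<in>Y'. g w * ?A * QP ps)
      = (\<Sum>w\<in>Y'. g w * ?A * QP ps - g w * ?A * L k ^ ?r) + (\<Sum>w\<in>Y'. g w * ?A * L k ^ ?r)"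
    by (simp add: sum_subtractf)
  finally have eq: "wordS ds * (\<Sum>w\<in>Y. wordS (pw w)) * UP ps * (?z * wordS dt)
     = (\<Sum>w\<in>Y'. g w * ?A * QP ps - g w * ?A * L k ^ ?r) * wordS dt
       + (\<Sum>w\<in>Y'. g w * ?A * L k ^ ?r) * wordS dt
       + (\<Sum>w\<in>Y - Y'. g w * ?A * QP ps) * wordS dt + (\<Sum>w\<in>Y. wordS (ds @ pw w) * t) * wordS dt"
    by (simp add: distrib_right add.assoc)
  have "(\<Sum>w\<in>Y'. g w * ?A * L k ^ ?r) * wordS dt = (\<Sum>w\<in>Y'. g w) * ?A * wordS dt * L k ^ ?r"
    using Sub_L_k_power[OF k dt, of ?r] by (simp add: sum_distrib_right mult.assoc)
  moreover have "g w \<in> Sub" if "w \<in> Y'" for w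
    unfolding g_def by (rule word_in_Sub[OF k word]) (use that in \<open>auto simp: Y'_def\<close>)
  then have "(\<Sum>w\<in>Y'. g w * ?A * QP ps - g w * ?A * L k ^ ?r) * wordS dt \<in> V ?r"
    by (intro V_right[OF k V_sum dt] QP_lead k Sub_mult A)
  moreover have "(\<Sum>w\<in>Y - Y'. g w * ?A * QP ps) * wordS dt \<in> V ?r"
  proof (rule V_right[OF k V_sum dt])
    fix w assume "w \<in> Y - Y'"
    then have "g w * ?A \<in> V 0"
      unfolding g_def using word by (intro word_in_V k A) (auto simp: Y'_def)
    then show "g w * ?A * QP ps \<in> V ?r" using V_QP[OF k, of _ 0 ps] by simp
  qed
  moreover have "(\<Sum>w\<in>Y. wordS (ds @ pw w) * t) * wordS dt \<in> V ?r"
    using assms by (intro T_subset_V[OF k] T_right[OF k] T_sum T_left t dt) auto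
  ultimately show ?thesis unfolding eq g_def[symmetric] by (auto intro!: V_add)
qed

end

section \<open>Tableaux and the removal of the largest entry\<close>

section \<open>Initial tableaux\<close>

definition multicomposition :: "nat \<Rightarrow> nat \<Rightarrow> (nat \<Rightarrow> nat \<Rightarrow> nat) \<Rightarrow> bool" where
  "multicomposition l n lam \<longleftrightarrow> (\<forall>j. lam j 0 = 0 \<and> finite {r. lam j r \<noteq> 0})
     \<and> (\<forall>j. j \<notin> {1..l} \<longrightarrow> lam j = (\<lambda>_. 0)) \<and> (\<Sum>j = 1..l. psize (lam j)) = n"

lemma multipartition_composition: "lam \<in> multipartitions l n \<Longrightarrow> multicomposition l n lam"
proof -
  assume lam: "lam \<in> multipartitions l n"
  have "lam j 0 = 0 \<and> finite {r. lam j r \<noteq> 0}" for j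
    using lam by (cases "j \<in> {1..l}") (auto simp: multipartitions_def is_partition_def)
  then show ?thesis using lam by (auto simp: multicomposition_def multipartitions_def)
qed

definition row_offset :: "(nat \<Rightarrow> nat \<Rightarrow> nat) \<Rightarrow> nat \<Rightarrow> nat \<Rightarrow> nat" where
  "row_offset lam j r = partial_size lam j + (\<Sum>i = 1..<r. lam j i)"

lemma initial_tab_eq: "(r, c, j) \<in> diagram l lam \<Longrightarrow> initial_tab l lam (r, c, j) = row_offset lam j r + c"
  by (simp add: initial_tab_def row_offset_def)

lemma diagram_iff: "(r, c, j) \<in> diagram l lam \<longleftrightarrow> 1 \<le> j \<and> j \<le> l \<and> 1 \<le> r \<and> 1 \<le> c \<and> c \<le> lam j r"
  by (simp add: diagram_def)

lemma partial_size_step: "1 \<le> j \<Longrightarrow> j < j' \<Longrightarrow> partial_size lam j + psize (lam j) \<le> partial_size lam j'"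
proof -
  assume "1 \<le> j" "j < j'"
  then have "partial_size lam j + psize (lam j) = (\<Sum>i = 1..<Suc j. psize (lam i))"
    by (simp add: partial_size_def)
  also have "\<dots> \<le> partial_size lam j'"
    unfolding partial_size_def using \<open>j < j'\<close> by (intro sum_mono2) auto
  finally show ?thesis .
qed

lemma partial_size_mono: "j \<le> j' \<Longrightarrow> partial_size lam j \<le> partial_size lam j'"
  unfolding partial_size_def by (intro sum_mono2) auto

context
  fixes l n :: nat and lam :: "nat \<Rightarrow> nat \<Rightarrow> nat"
  assumes lam: "multicomposition l n lam"
begin

lemma row_sum_le: "1 \<le> r \<Longrightarrow> (\<Sum>i = 1..<r. lam j i) + lam j r \<le> psize (lam j)"
proof -
  assume "1 \<le> r"
  then have "(\<Sum>i = 1..<r. lam j i) + lam j r = (\<Sum>i = 1..<Suc r. lam j i)" by simp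
  also have "\<dots> = (\<Sum>i \<in> {1..<Suc r} \<inter> {i. lam j i \<noteq> 0}. lam j i)"
    by (rule sum.mono_neutral_right) auto
  also have "\<dots> \<le> psize (lam j)"
    unfolding psize_def using lam by (intro sum_mono2) (auto simp: multicomposition_def)
  finally show ?thesis .
qed

lemma row_offset_less:
  assumes "1 \<le> j" "1 \<le> r" "j < j' \<or> j = j' \<and> r < r'"
  shows "row_offset lam j r + lam j r \<le> row_offset lam j' r'"
  using assms(3)
proof
  assume "j < j'"
  then show ?thesis
    using partial_size_step[OF assms(1), of j' lam] row_sum_le[OF assms(2), of j]
    by (simp add: row_offset_def)
next
  assume *: "j = j' \<and> r < r'"
  have "(\<Sum>i = 1..<r. lam j i) + lam j r = (\<Sum>i = 1..<Suc r. lam j i)" using assms(2) by simp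
  also have "\<dots> \<le> (\<Sum>i = 1..<r'. lam j i)" using * by (intro sum_mono2) auto
  finally show ?thesis using * by (simp add: row_offset_def)
qed

lemma partial_size_le: "s \<le> Suc l \<Longrightarrow> partial_size lam s \<le> n"
proof -
  assume "s \<le> Suc l"
  then have "partial_size lam s \<le> partial_size lam (Suc l)" by (rule partial_size_mono)
  also have "\<dots> = n" using lam
    by (simp add: partial_size_def multicomposition_def atLeastLessThanSuc_atLeastAtMost)
  finally show ?thesis .
qed

lemma row_end_le: "1 \<le> j \<Longrightarrow> 1 \<le> r \<Longrightarrow> row_offset lam j r + lam j r \<le> partial_size lam (Suc j)"
  using row_offset_less[of j r "Suc j" 1] by (simp add: row_offset_def)

lemma initial_tab_range: "x \<in> diagram l lam \<Longrightarrow> initial_tab l lam x \<in> {1..n}"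
proof -
  assume x: "x \<in> diagram l lam"
  obtain r c j where [simp]: "x = (r, c, j)" by (cases x)
  have "1 \<le> j" "j \<le> l" "1 \<le> r" "1 \<le> c" "c \<le> lam j r" using x by (auto simp: diagram_iff)
  then show ?thesis
    using x row_end_le[of j r] partial_size_le[of "Suc j"] by (simp add: initial_tab_eq)
qed

lemma initial_tab_less:
  assumes "(r, c, j) \<in> diagram l lam" "(r', c', j') \<in> diagram l lam"
    and "j < j' \<or> j = j' \<and> (r < r' \<or> r = r' \<and> c < c')"
  shows "initial_tab l lam (r, c, j) < initial_tab l lam (r', c', j')"
  using assms row_offset_less[of j r j' r'] by (auto simp: initial_tab_eq diagram_iff)

lemma initial_tab_inj: "inj_on (initial_tab l lam) (diagram l lam)"
proof (rule inj_onI)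
  fix x y assume xy: "x \<in> diagram l lam" "y \<in> diagram l lam" "initial_tab l lam x = initial_tab l lam y"
  obtain r c j r' c' j' where [simp]: "x = (r, c, j)" "y = (r', c', j')" by (cases x; cases y) auto
  show "x = y"
    using xy initial_tab_less[of r c j r' c' j'] initial_tab_less[of r' c' j' r c j]
    by (cases j j' rule: linorder_cases; cases r r' rule: linorder_cases; cases c c' rule: linorder_cases) auto
qed

context
  fixes t :: "node \<Rightarrow> nat"
  assumes t: "bij_betw t (diagram l lam) {1..n}"
begin

text \<open>The given bijection \<open>t\<close> tells that the diagram has n nodes; an injection of
  it into {1..n} is then onto.\<close>

lemma initial_tab_bij: "bij_betw (initial_tab l lam) (diagram l lam) {1..n}"
proof -
  have "card (diagram l lam) = n" using bij_betw_same_card[OF t] by simp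
  then have "card (initial_tab l lam ` diagram l lam) = card {1..n}"
    using card_image[OF initial_tab_inj] by simp
  then have "initial_tab l lam ` diagram l lam = {1..n}"
    using initial_tab_range by (intro card_subset_eq) auto
  then show ?thesis using initial_tab_inj by (simp add: bij_betw_def)
qed

lemma tab_perm_ex:
  "\<exists>w. w permutes {1..n} \<and> (\<forall>x \<in> diagram l lam. t x = w (initial_tab l lam x))"
proof -
  let ?g = "inv_into (diagram l lam) (initial_tab l lam)"
  let ?w = "\<lambda>v. if v \<in> {1..n} then t (?g v) else v"
  have "bij_betw (t \<circ> ?g) {1..n} {1..n}"
    by (rule bij_betw_trans[OF bij_betw_inv_into[OF initial_tab_bij] t])
  then have "bij_betw ?w {1..n} {1..n}"
    by (subst bij_betw_cong[of _ _ "t \<circ> ?g"]) auto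
  then have "?w permutes {1..n}" by (intro bij_imp_permutes) auto
  moreover have "t x = ?w (initial_tab l lam x)" if "x \<in> diagram l lam" for x
    using that initial_tab_range inv_into_f_f[OF initial_tab_inj that] by simp
  ultimately show ?thesis by blast
qed

lemma tab_perm_eqI:
  assumes "w permutes {1..n}" "\<And>x. x \<in> diagram l lam \<Longrightarrow> t x = w (initial_tab l lam x)"
  shows "tab_perm l n lam t = w"
  unfolding tab_perm_def
proof (rule the_equality)
  fix w' assume w': "w' permutes {1..n} \<and> (\<forall>x\<in>diagram l lam. t x = w' (initial_tab l lam x))"
  show "w' = w"
  proof
    fix v
    show "w' v = w v"
    proof (cases "v \<in> {1..n}")
      case True
      then have "v \<in> initial_tab l lam ` diagram l lam"
        using initial_tab_bij by (simp add: bij_betw_def)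
      then obtain x where "x \<in> diagram l lam" "v = initial_tab l lam x" by (rule imageE)
      then show ?thesis using w' assms(2) by metis
    next
      case False
      then show ?thesis using w' assms(1) by (metis permutes_not_in)
    qed
  qed
qed (use assms in blast)

lemma tab_perm: "tab_perm l n lam t permutes {1..n}"
  "x \<in> diagram l lam \<Longrightarrow> t x = tab_perm l n lam t (initial_tab l lam x)"
proof -
  obtain w where w: "w permutes {1..n}" "\<And>x. x \<in> diagram l lam \<Longrightarrow> t x = w (initial_tab l lam x)"
    using tab_perm_ex by blast
  then have "tab_perm l n lam t = w" by (rule tab_perm_eqI)
  with w show "tab_perm l n lam t permutes {1..n}"
    "x \<in> diagram l lam \<Longrightarrow> t x = tab_perm l n lam t (initial_tab l lam x)" by auto
qed

lemma node_of: "v \<in> {1..n} \<Longrightarrow> node_of l lam t v \<in> diagram l lam"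
  "v \<in> {1..n} \<Longrightarrow> t (node_of l lam t v) = v"
  using t bij_betw_inv_into_right[OF t] bij_betwE[OF bij_betw_inv_into[OF t]]
  by (auto simp: node_of_def)

end

end

section \<open>Removing the largest entry\<close>

lemma StdD:
  assumes "t \<in> Std l n lam"
  shows "bij_betw t (diagram l lam) {1..n}"
  using assms by (auto simp: Std_def tableaux_def)

locale removal =
  fixes l n :: nat and lam :: "nat \<Rightarrow> nat \<Rightarrow> nat" and t :: "node \<Rightarrow> nat"
  assumes n: "1 \<le> n" and lam: "multicomposition l n lam" and t: "t \<in> Std l n lam"
begin

lemma tb: "bij_betw t (diagram l lam) {1..n}"
  by (rule StdD[OF t])

abbreviation "D \<equiv> diagram l lam"
abbreviation "ini \<equiv> initial_tab l lam"

definition x0 :: node where "x0 = node_of l lam t n"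
definition r0 where "r0 = fst x0"
definition c0 where "c0 = fst (snd x0)"
definition j0 where "j0 = snd (snd x0)"
definition m where "m = ini x0"

lemma x0: "x0 \<in> D" "t x0 = n" "x0 = (r0, c0, j0)"
  using node_of[OF lam tb, of n] n by (auto simp: x0_def r0_def c0_def j0_def)

lemma comp_of: "comp_of l lam t n = j0"
  by (simp add: comp_of_def j0_def x0_def split: prod.splits)

lemma x0_bounds: "1 \<le> j0" "j0 \<le> l" "1 \<le> r0" "1 \<le> c0" "c0 \<le> lam j0 r0"
  using x0(1) unfolding x0(3) by (auto simp: diagram_iff)

lemma c0: "c0 = lam j0 r0"
proof (rule ccontr)
  assume "c0 \<noteq> lam j0 r0"
  then have y: "(r0, Suc c0, j0) \<in> D" using x0_bounds by (simp add: diagram_iff)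
  then have "t (r0, c0, j0) < t (r0, Suc c0, j0)"
    using t x0(1) unfolding x0(3) by (auto simp: Std_def)
  moreover have "t (r0, Suc c0, j0) \<le> n" using bij_betwE[OF tb] y by auto
  ultimately show False using x0 by simp
qed

lemma m: "m \<in> {1..n}" "1 \<le> m" "m \<le> n"
  using initial_tab_range[OF lam x0(1)] by (auto simp: m_def)

lemma m_eq: "m = row_offset lam j0 r0 + lam j0 r0"
  using initial_tab_eq[of r0 c0 j0 l lam] x0 c0 by (simp add: m_def)

lemma n_of: "n_of l n lam t = m"
  unfolding n_of_def
proof (rule the_equality)
  have "node_of l lam ini m = x0"
    unfolding node_of_def m_def by (rule inv_into_f_f[OF initial_tab_inj[OF lam] x0(1)])
  then show "m \<in> {1..n} \<and> node_of l lam t n = node_of l lam ini m"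
    using m by (simp add: x0_def)
  fix m' assume m': "m' \<in> {1..n} \<and> node_of l lam t n = node_of l lam ini m'"
  then show "m' = m"
    using node_of(2)[OF lam initial_tab_bij[OF lam tb], of m'] by (simp add: m_def x0_def)
qed

definition mu :: "nat \<Rightarrow> nat \<Rightarrow> nat" where "mu = sub_shape l lam t (n - 1)"

lemma sub_nodes: "sub_nodes l lam t (n - 1) = D - {x0}"
proof -
  have "t x \<le> n - 1 \<longleftrightarrow> x \<noteq> x0" if x: "x \<in> D" for x
  proof -
    have "t x \<in> {1..n}" using bij_betwE[OF tb] x by auto
    moreover have "t x = n \<longleftrightarrow> x = x0" using inj_onD[OF bij_betw_imp_inj_on[OF tb], of x x0] x x0 by auto
    ultimately show ?thesis using n by auto
  qed
  then show ?thesis by (auto simp: sub_nodes_def)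
qed

lemma lam_0: "lam j 0 = 0" "j \<notin> {1..l} \<Longrightarrow> lam j r = 0"
  using lam by (auto simp: multicomposition_def)

lemma mu_eq: "mu j r = lam j r - (if j = j0 \<and> r = r0 then 1 else 0)"
proof (cases "1 \<le> j \<and> j \<le> l \<and> 1 \<le> r")
  case True
  then have "{c. (r, c, j) \<in> sub_nodes l lam t (n - 1)} = {1..lam j r} - (if j = j0 \<and> r = r0 then {c0} else {})"
    unfolding sub_nodes by (auto simp: diagram_iff x0(3))
  then show ?thesis using True x0_bounds by (auto simp: mu_def sub_shape_def)
next
  case False
  then have "lam j r = 0" using lam_0 by (cases "r = 0") auto
  moreover have "{c. (r, c, j) \<in> sub_nodes l lam t (n - 1)} = {}"
    unfolding sub_nodes using False by (auto simp: diagram_iff)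
  ultimately show ?thesis by (simp add: mu_def sub_shape_def)
qed

lemma mu_other: "j \<noteq> j0 \<Longrightarrow> mu j = lam j"
  by (simp add: mu_eq fun_eq_iff)

lemma diagram_mu: "diagram l mu = D - {x0}"
  using c0 x0_bounds by (auto simp: diagram_def x0(3) mu_eq split: if_splits)

lemma psize_mu: "psize (lam j0) = Suc (psize (mu j0))"
proof -
  let ?F = "{r. lam j0 r \<noteq> 0}"
  have fin: "finite ?F" using lam by (simp add: multicomposition_def)
  have r0: "r0 \<in> ?F" using x0_bounds by auto
  have "psize (mu j0) = (\<Sum>r\<in>?F. mu j0 r)"
    unfolding psize_def using fin by (intro sum.mono_neutral_left) (auto simp: mu_eq)
  also have "\<dots> = mu j0 r0 + (\<Sum>r\<in>?F - {r0}. mu j0 r)" by (rule sum.remove[OF fin r0])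
  also have "(\<Sum>r\<in>?F - {r0}. mu j0 r) = (\<Sum>r\<in>?F - {r0}. lam j0 r)"
    by (rule sum.cong) (auto simp: mu_eq)
  finally have "psize (mu j0) = mu j0 r0 + (\<Sum>r\<in>?F - {r0}. lam j0 r)" .
  moreover have "psize (lam j0) = lam j0 r0 + (\<Sum>r\<in>?F - {r0}. lam j0 r)"
    unfolding psize_def by (rule sum.remove[OF fin r0])
  moreover have "lam j0 r0 = Suc (mu j0 r0)" using x0_bounds by (simp add: mu_eq)
  ultimately show ?thesis by (simp only: add_Suc)
qed

lemma sum_psize_mu:
  assumes "finite A" "j0 \<in> A"
  shows "(\<Sum>j\<in>A. psize (lam j)) = Suc (\<Sum>j\<in>A. psize (mu j))"
proof -
  have "(\<Sum>j\<in>A - {j0}. psize (lam j)) = (\<Sum>j\<in>A - {j0}. psize (mu j))"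
    by (rule sum.cong) (auto simp: mu_other)
  then show ?thesis
    using sum.remove[OF assms, of "\<lambda>j. psize (lam j)"] sum.remove[OF assms, of "\<lambda>j. psize (mu j)"] psize_mu
    by simp
qed

lemma partial_size_mu: "partial_size mu s = partial_size lam s - (if j0 < s then 1 else 0)"
proof (cases "j0 < s")
  case True
  then show ?thesis using sum_psize_mu[of "{1..<s}"] x0_bounds by (simp add: partial_size_def)
next
  case False
  then have "partial_size mu s = partial_size lam s"
    unfolding partial_size_def by (intro sum.cong) (auto simp: mu_other)
  then show ?thesis using False by simp
qed

lemma partial_size_pos: "j0 < s \<Longrightarrow> 1 \<le> partial_size lam s"
  using sum_psize_mu[of "{1..<s}"] x0_bounds by (simp add: partial_size_def)

lemma mu: "multicomposition l (n - 1) mu"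
proof -
  have "finite {r. mu j r \<noteq> 0}" for j
    by (rule finite_subset[of _ "{r. lam j r \<noteq> 0}"])
      (use lam in \<open>auto simp: mu_eq multicomposition_def split: if_splits\<close>)
  moreover have "mu j = (\<lambda>_. 0)" if "j \<notin> {1..l}" for j
    using lam that by (auto simp: mu_eq multicomposition_def fun_eq_iff)
  moreover have "n = Suc (\<Sum>j = 1..l. psize (mu j))"
    using sum_psize_mu[of "{1..l}"] x0_bounds lam by (simp add: multicomposition_def)
  then have "(\<Sum>j = 1..l. psize (mu j)) = n - 1" by simp
  ultimately show ?thesis using lam_0 by (simp add: multicomposition_def mu_eq)
qed

lemma row_sum_mu:
  "(\<Sum>i = 1..<r. mu j i) = (\<Sum>i = 1..<r. lam j i) - (if j = j0 \<and> r0 < r then 1 else 0)"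
proof (cases "j = j0 \<and> r0 < r")
  case True
  then have r0: "r0 \<in> {1..<r}" using x0_bounds by auto
  have "(\<Sum>i\<in>{1..<r} - {r0}. lam j i) = (\<Sum>i\<in>{1..<r} - {r0}. mu j i)"
    by (rule sum.cong) (auto simp: mu_eq)
  then show ?thesis
    using sum.remove[OF _ r0, of "lam j"] sum.remove[OF _ r0, of "mu j"] True x0_bounds
    by (simp add: mu_eq)
next
  case False
  then have "(\<Sum>i = 1..<r. mu j i) = (\<Sum>i = 1..<r. lam j i)"
    by (intro sum.cong) (auto simp: mu_eq)
  then show ?thesis using False by auto
qed

lemma row_sum_pos: "r0 < r \<Longrightarrow> 1 \<le> (\<Sum>i = 1..<r. lam j0 i)"
  using member_le_sum[of r0 "{1..<r}" "lam j0"] x0_bounds by auto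

text \<open>Removing the row end x0 lowers by one the numbers of exactly those nodes that come after
  x0 in reading order, and these are the nodes with numbers above m.\<close>

lemma initial_tab_mu:
  assumes "x \<in> D - {x0}"
  shows "initial_tab l mu x = zperm m n (ini x)"
proof -
  obtain r c j where x: "x = (r, c, j)" by (cases x)
  have xD: "(r, c, j) \<in> D" "(r, c, j) \<noteq> x0" using assms x by auto
  have mu: "initial_tab l mu x = row_offset mu j r + c"
    using assms by (simp add: initial_tab_eq x diagram_mu)
  have lam': "ini x = row_offset lam j r + c" using xD by (simp add: initial_tab_eq x)
  have x0D: "(r0, c0, j0) \<in> D" using x0 by simp
  have off: "row_offset mu j r = row_offset lam j r - (if j0 < j \<or> j = j0 \<and> r0 < r then 1 else 0)"
    using partial_size_mu[of j] row_sum_mu[of j r] partial_size_pos[of j] row_sum_pos[of r]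
    by (auto simp: row_offset_def)
  \<comment> \<open>Subtraction of natural numbers is truncated; the offset must be positive for the
    drop by one to be genuine.\<close>
  have pos: "j0 < j \<or> j = j0 \<and> r0 < r \<Longrightarrow> 1 \<le> row_offset lam j r"
    using partial_size_pos[of j] row_sum_pos[of r] by (auto simp: row_offset_def)
  show ?thesis
  proof (cases "j0 < j \<or> j = j0 \<and> r0 < r")
    case True
    then have "m < ini x"
      using initial_tab_less[OF lam x0D xD(1)] x0(3) x by (auto simp: m_def)
    moreover have "ini x \<le> n" using initial_tab_range[OF lam xD(1)] x by simp
    ultimately show ?thesis using True mu lam' off pos by (simp add: zperm_def)
  next
    case False
    have "c < c0" if "j = j0" "r = r0"
      using that xD c0 x0(3) by (auto simp: diagram_iff le_less)
    then have "j < j0 \<or> j = j0 \<and> (r < r0 \<or> r = r0 \<and> c < c0)"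
      using False by (cases j j0 rule: linorder_cases; cases r r0 rule: linorder_cases) auto
    then have "ini x < m"
      using initial_tab_less[OF lam xD(1) x0D] False x0(3) x by (auto simp: m_def)
    then show ?thesis using False mu lam' off by (auto simp: zperm_def)
  qed
qed

definition t' where "t' = sub_tab l lam t (n - 1)"

lemma t'_eq: "x \<in> D - {x0} \<Longrightarrow> t' x = t x"
  by (simp add: t'_def sub_tab_def sub_nodes[simplified])

lemma t'_bij: "bij_betw t' (diagram l mu) {1..n - 1}"
proof -
  have "bij_betw t (D - {x0}) ({1..n} - {n})"
    using bij_betw_DiffI[OF tb bij_betw_singletonI[of t x0 n]] x0(1,2) n by simp
  moreover have "{1..n} - {n} = {1..n - 1}" using n by auto
  ultimately show ?thesis
    unfolding diagram_mu by (subst bij_betw_cong[of _ _ t]) (auto simp: t'_eq)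
qed

lemma permutes_lift: "w permutes {1..n - 1} \<Longrightarrow> w permutes {1..n}"
  by (rule permutes_subset) auto

lemma tab_perm_removal: "tab_perm l n lam t = tab_perm l (n - 1) mu t' \<circ> zperm m n"
proof (rule tab_perm_eqI[OF lam tb])
  have p: "tab_perm l (n - 1) mu t' permutes {1..n - 1}" by (rule tab_perm(1)[OF mu t'_bij])
  show "tab_perm l (n - 1) mu t' \<circ> zperm m n permutes {1..n}"
    by (intro permutes_compose zperm_permutes m permutes_lift[OF p])
  fix x assume x: "x \<in> D"
  show "t x = (tab_perm l (n - 1) mu t' \<circ> zperm m n) (ini x)"
  proof (cases "x = x0")
    case True
    then have "zperm m n (ini x) = n" by (simp add: zperm_def m_def)
    moreover have "tab_perm l (n - 1) mu t' n = n" using permutes_not_in[OF p, of n] n by auto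
    ultimately show ?thesis using x0 True by simp
  next
    case False
    then show ?thesis
      using x tab_perm(2)[OF mu t'_bij, of x] initial_tab_mu[of x] t'_eq[of x]
      by (simp add: diagram_mu)
  qed
qed

lemma partial_size_ge: "j0 = 1 \<Longrightarrow> 2 \<le> s \<Longrightarrow> m \<le> partial_size lam s"
  using row_end_le[OF lam, of j0 r0] x0_bounds partial_size_mono[of 2 s lam] m_eq
  by (simp add: numeral_2_eq_2)

lemma partial_size_less: "j0 \<noteq> 1 \<Longrightarrow> partial_size lam 2 < m"
  using partial_size_mono[of 2 j0 lam] x0_bounds m_eq by (simp add: row_offset_def)

lemma zperm_eq_iff: "zperm m n v = n \<longleftrightarrow> v = m"
proof -
  have "zperm m n m = n" by (simp add: zperm_def)
  then show ?thesis
    using permutes_inj[OF zperm_permutes[OF m(2,3)]] by (metis injD)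
qed

lemma young_fixed:
  "bij_betw (\<lambda>w. zperm m n \<circ> w \<circ> inv_into UNIV (zperm m n))
     {w \<in> young_subgroup l n lam. w m = m} (young_subgroup l (n - 1) mu)"
proof -
  let ?z = "zperm m n" and ?zi = "inv_into UNIV (zperm m n)"
  have z: "?z permutes {1..n}" by (rule zperm_permutes[OF m(2,3)])
  have zz: "?zi (?z v) = v" "?z (?zi v) = v" for v using permutes_inverses[OF z] by auto
  have ini_m: "ini x = m \<longleftrightarrow> x = x0" if "x \<in> D" for x
    using inj_onD[OF initial_tab_inj[OF lam], of x x0] that x0 by (auto simp: m_def)
  have perm_n: "w permutes {1..n - 1}" if "w permutes {1..n}" "w n = n" for w
  proof (rule permutes_superset[OF that(1)])
    fix x assume "x \<in> {1..n} - {1..n - 1}"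
    then have "x = n" by auto
    then show "w x = x" using that(2) by simp
  qed
  have im: "?z \<circ> w \<circ> ?zi \<in> young_subgroup l (n - 1) mu"
    if w: "w \<in> young_subgroup l n lam" "w m = m" for w
  proof -
    have wp: "w permutes {1..n}" using w by (simp add: young_subgroup_def)
    have "?z \<circ> w \<circ> ?zi permutes {1..n}"
      by (intro permutes_compose permutes_inv z wp)
    moreover have "(?z \<circ> w \<circ> ?zi) n = n"
      using zz(1)[of m] w(2) by (simp add: zperm_def)
    ultimately have "?z \<circ> w \<circ> ?zi permutes {1..n - 1}" by (rule perm_n)
    moreover have "\<exists>c'. (r, c', j) \<in> diagram l mu
        \<and> (?z \<circ> w \<circ> ?zi) (initial_tab l mu (r, c, j)) = initial_tab l mu (r, c', j)"
      if x: "(r, c, j) \<in> diagram l mu" for r c j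
    proof -
      have xD: "(r, c, j) \<in> D" "(r, c, j) \<noteq> x0" using x by (auto simp: diagram_mu)
      obtain c' where c': "(r, c', j) \<in> D" "w (ini (r, c, j)) = ini (r, c', j)"
        using w(1) xD unfolding young_subgroup_def by blast
      \<comment> \<open>As w fixes m, injectivity prevents any other node from being sent to the
        entry of the removed one.\<close>
      have "(r, c', j) \<noteq> x0"
      proof
        assume "(r, c', j) = x0"
        then have "w (ini (r, c, j)) = w m" using c' w(2) by (simp add: m_def)
        then have "ini (r, c, j) = m" using permutes_inj[OF wp] by (simp add: inj_eq)
        then show False using ini_m xD by blast
      qed
      then show ?thesis using c' x xD by (intro exI[of _ c']) (simp add: diagram_mu initial_tab_mu zz)
    qed
    ultimately show ?thesis by (simp add: young_subgroup_def)
  qed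
  have im': "?zi \<circ> v \<circ> ?z \<in> {w \<in> young_subgroup l n lam. w m = m}"
    if v: "v \<in> young_subgroup l (n - 1) mu" for v
  proof -
    have vp: "v permutes {1..n - 1}" using v by (simp add: young_subgroup_def)
    then have vn: "v n = n" using permutes_not_in[OF vp, of n] n by auto
    have "?zi \<circ> v \<circ> ?z permutes {1..n}"
      by (intro permutes_compose permutes_inv z permutes_lift[OF vp])
    moreover have fix_m: "(?zi \<circ> v \<circ> ?z) m = m"
      using zz(1)[of m] vn by (simp add: zperm_def)
    moreover have "\<exists>c'. (r, c', j) \<in> D \<and> (?zi \<circ> v \<circ> ?z) (ini (r, c, j)) = ini (r, c', j)"
      if x: "(r, c, j) \<in> D" for r c j
    proof (cases "(r, c, j) = x0")
      case True
      then have "ini (r, c, j) = m" by (simp add: m_def)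
      then show ?thesis using fix_m x by (intro exI[of _ c]) simp
    next
      case False
      then have x': "(r, c, j) \<in> diagram l mu" using x by (simp add: diagram_mu)
      then obtain c' where c': "(r, c', j) \<in> diagram l mu" "v (initial_tab l mu (r, c, j)) = initial_tab l mu (r, c', j)"
        using v unfolding young_subgroup_def by blast
      then have "v (?z (ini (r, c, j))) = ?z (ini (r, c', j))"
        using x' by (simp add: initial_tab_mu diagram_mu)
      then show ?thesis using c' by (intro exI[of _ c']) (simp add: diagram_mu zz)
    qed
    ultimately show ?thesis by (simp add: young_subgroup_def)
  qed
  show ?thesis
    by (rule bij_betw_byWitness[where f' = "\<lambda>v. ?zi \<circ> v \<circ> ?z"])
      (use im im' in \<open>auto simp: fun_eq_iff zz\<close>)
qed

end

text \<open>Since w preserves rows, the two removed nodes lie in the same row; both are its last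
  node. This is how a contribution to the leading coefficient forces n(s) = n(t).\<close>

lemma young_subgroup_row_end:
  assumes "removal l n lam s" "removal l n lam t" "w \<in> young_subgroup l n lam"
    and "w (removal.m l n lam s) = removal.m l n lam t"
  shows "removal.x0 l n lam s = removal.x0 l n lam t"
proof -
  interpret s: removal l n lam s by fact
  interpret t: removal l n lam t by fact
  have "(s.r0, s.c0, s.j0) \<in> diagram l lam" using s.x0(1) unfolding s.x0(3) .
  then obtain c' where c': "(s.r0, c', s.j0) \<in> diagram l lam" "w (initial_tab l lam (s.r0, s.c0, s.j0)) = initial_tab l lam (s.r0, c', s.j0)"
    using assms(3) unfolding young_subgroup_def by blast
  have "initial_tab l lam (s.r0, c', s.j0) = initial_tab l lam t.x0"
    using c'(2) assms(4) unfolding s.m_def t.m_def s.x0(3)[symmetric] by (simp only:)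
  then have "(s.r0, c', s.j0) = t.x0"
    using inj_onD[OF initial_tab_inj[OF t.lam] _ c'(1) t.x0(1)] by blast
  then have "s.r0 = t.r0" "s.j0 = t.j0" using t.x0(3) by simp_all
  then show ?thesis unfolding s.x0(3) t.x0(3) s.c0 t.c0 by simp
qed

section \<open>The anti-automorphism, lifts of the Murphy elements, and the final
  computation\<close>

section \<open>The anti-automorphism\<close>

abbreviation rev_free :: "(word \<Rightarrow>\<^sub>0 'r) \<Rightarrow> word \<Rightarrow>\<^sub>0 'r::comm_ring_1" where
  "rev_free \<equiv> Poly_Mapping.map_key rev_word"

lemma rev_word_rev_word [simp]: "rev_word (rev_word w) = w"
  by (simp add: rev_word_def)

lemma inj_rev_word: "inj rev_word"
  by (metis injI rev_word_rev_word)

lemma rev_free_add: "rev_free (x + y) = rev_free x + rev_free y"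
  by (rule map_key_plus[OF inj_rev_word])

lemma rev_free_0 [simp]: "rev_free 0 = 0"
  by (rule map_key_zero[OF inj_rev_word])

lemma rev_free_diff: "rev_free (x - y) = rev_free x - rev_free y"
  using rev_free_add[of "x - y" y] by (simp add: eq_diff_eq)

lemma rev_free_single: "rev_free (Poly_Mapping.single w a) = Poly_Mapping.single (rev_word w) a"
  using map_key_single[OF inj_rev_word, of "rev_word w" a] by simp

lemma rev_free_sum: "rev_free (sum f A) = (\<Sum>i\<in>A. rev_free (f i))"
  by (induction A rule: infinite_finite_induct) (auto simp: rev_free_add)

lemma rev_free_mult: "rev_free (x * y) = rev_free y * rev_free x"
proof -
  have single: "rev_free (Poly_Mapping.single v a * Poly_Mapping.single w b)
      = rev_free (Poly_Mapping.single w b) * rev_free (Poly_Mapping.single v a)" for v w a b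
    by (simp add: rev_free_single mult_single plus_word_def rev_word_def mult.commute)
  let ?e = "\<lambda>x. \<Sum>w\<in>Poly_Mapping.keys x. Poly_Mapping.single w (Poly_Mapping.lookup x w)"
  have "rev_free (?e x * ?e y) = (\<Sum>v\<in>Poly_Mapping.keys x. \<Sum>w\<in>Poly_Mapping.keys y.
      rev_free (Poly_Mapping.single w (Poly_Mapping.lookup y w)) * rev_free (Poly_Mapping.single v (Poly_Mapping.lookup x v)))"
    by (simp add: sum_product rev_free_sum single)
  also have "\<dots> = rev_free (?e y) * rev_free (?e x)"
    by (subst sum.swap) (simp add: sum_product rev_free_sum)
  finally show ?thesis using poly_mapping_expand[of x] poly_mapping_expand[of y] by simp
qed

lemma rev_free_rev_free [simp]: "rev_free (rev_free x) = x"
proof -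
  have "rev_free (rev_free (\<Sum>w\<in>Poly_Mapping.keys x. Poly_Mapping.single w (Poly_Mapping.lookup x w)))
      = (\<Sum>w\<in>Poly_Mapping.keys x. Poly_Mapping.single w (Poly_Mapping.lookup x w))"
    by (simp add: rev_free_sum rev_free_single)
  then show ?thesis using poly_mapping_expand[of x] by simp
qed

lemma rev_free_gens [simp]:
  fixes a :: "'r::comm_ring_1"
  shows "rev_free (s_free i) = s_free i" "rev_free (L_free i) = L_free i"
  "rev_free (const a) = const a" "rev_free 1 = (1 :: word \<Rightarrow>\<^sub>0 'r)"
proof -
  have c: "rev_free (const a) = const a" for a :: 'r
    by (simp add: const_def rev_free_single rev_word_def zero_word_def)
  show "rev_free (const a) = const a" by (rule c)
  show "rev_free 1 = (1 :: word \<Rightarrow>\<^sub>0 'r)" using c[of 1] by simp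
qed (simp_all add: s_free_def L_free_def rev_free_single rev_word_def)

lemma rev_free_prod_list: "rev_free (prod_list xs) = prod_list (rev (map rev_free xs))"
  by (induction xs) (simp_all add: rev_free_mult)

lemma rev_free_closed: "x \<in> carrier (free_alg k) \<Longrightarrow> rev_free x \<in> carrier (free_alg k)"
  by (induction x rule: free_alg_induct) (simp_all add: rev_free_add rev_free_mult)

lemma diff_commute:
  "a * b = b * a \<Longrightarrow> a * c = c * a \<Longrightarrow> b * c = c * b \<Longrightarrow> (a - b) * (a - c) = (a - c) * (a - (b :: 'a::ring))"
  by (simp add: left_diff_distrib right_diff_distrib)

text \<open>Each relator is sent to itself or to its negative. For the cyclotomic one this uses that
  its factors commute, all of them being L_1 minus a scalar.\<close>

lemma rev_free_relator:
  assumes "y \<in> relators l u k"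
  shows "rev_free y \<in> rel_ideal l u k"
  using assms
proof (cases rule: relators_cases)
  case cyclotomic
  have "rev_free y = prod_list (rev (map (\<lambda>j. L_free 1 - const (u j)) [1..<Suc l]))"
    unfolding cyclotomic(2) rev_free_prod_list by (simp add: rev_free_diff o_def del: upt_Suc)
  also have "\<dots> = y"
    unfolding cyclotomic(2)
    by (rule prod_list_rev_commuting)
      (auto intro!: diff_commute const_central const_central[symmetric])
  finally show ?thesis using assms relators_in_ideal by metis
next
  case (SS i)
  then have "rev_free y = y" by (simp add: rev_free_mult rev_free_diff)
  then show ?thesis using assms relators_in_ideal by metis
next
  case (far i j)
  then have "rev_free y = - y" by (simp add: rev_free_mult rev_free_diff)
  then show ?thesis using assms relators_in_ideal rel_ideal_closed(4) by metis
next
  case (braid i)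
  then have "rev_free y = y" by (simp add: rev_free_mult rev_free_diff mult.assoc)
  then show ?thesis using assms relators_in_ideal by metis
next
  case (LL i j)
  then have "rev_free y = - y" by (simp add: rev_free_mult rev_free_diff)
  then show ?thesis using assms relators_in_ideal rel_ideal_closed(4) by metis
next
  case (SL i j)
  then have "rev_free y = - y" by (simp add: rev_free_mult rev_free_diff)
  then show ?thesis using assms relators_in_ideal rel_ideal_closed(4) by metis
next
  case (rec i)
  then have "rev_free y = y" by (simp add: rev_free_mult rev_free_diff rev_free_add mult.assoc)
  then show ?thesis using assms relators_in_ideal by metis
qed

lemma rev_free_ideal: "x \<in> rel_ideal l u k \<Longrightarrow> rev_free x \<in> rel_ideal l u k"
proof -
  let ?J = "{x \<in> carrier (free_alg k). rev_free x \<in> rel_ideal l u k}"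
  have "ideal ?J (free_alg k)"
    by (rule free_alg_idealI)
      (auto simp: rev_free_add rev_free_mult intro: rel_ideal_closed rev_free_closed)
  moreover have "relators l u k \<subseteq> ?J"
    using rev_free_relator relators_closed by blast
  ultimately have "rel_ideal l u k \<subseteq> ?J" by (rule rel_ideal_minimal)
  then show "x \<in> rel_ideal l u k \<Longrightarrow> rev_free x \<in> rel_ideal l u k" by blast
qed

lemma star_proj: "star (proj l u k x) = proj l u k (rev_free x)"
proof
  show "star (proj l u k x) \<subseteq> proj l u k (rev_free x)"
    unfolding star_def proj_set using rev_free_ideal by (auto simp: rev_free_add intro!: imageI)
  show "proj l u k (rev_free x) \<subseteq> star (proj l u k x)"
  proof
    fix y assume "y \<in> proj l u k (rev_free x)"
    then obtain r where r: "r \<in> rel_ideal l u k" "y = r + rev_free x" unfolding proj_set by auto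
    then have "y = rev_free (rev_free r + x)" by (simp add: rev_free_add)
    then show "y \<in> star (proj l u k x)"
      unfolding star_def proj_set using rev_free_ideal[OF r(1)] by blast
  qed
qed

section \<open>The Murphy basis in the free algebra\<close>

definition word_free :: "nat list \<Rightarrow> word \<Rightarrow>\<^sub>0 'r::comm_ring_1" where
  "word_free is = prod_list (map s_free is)"

lemma word_free_closed: "set is \<subseteq> {1..<k} \<Longrightarrow> word_free is \<in> carrier (free_alg k)"
  unfolding word_free_def by (rule free_alg_prod_list_closed) force

lemma star_word: "star (proj l u k (word_free is)) = proj l u k (word_free (rev is))"
  by (simp add: star_proj word_free_def rev_free_prod_list rev_map o_def)

lemma proj_word:
  assumes "set is \<subseteq> {1..<k}"
  shows "list_mult (hecke l u k) (map (hs l u k) is) = proj l u k (word_free is)"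
proof -
  have "s_free i \<in> carrier (free_alg k)" if "i \<in> set is" for i
    using assms that by force
  then show ?thesis unfolding word_free_def
    by (subst proj_prod_list) (auto simp: o_def hs_def[abs_def])
qed

text \<open>A lift of the Murphy element to the free algebra, with a chosen word for every
  permutation. The reversed word at the left is the lift of the starred d(s).\<close>

definition murphy_free ::
    "nat \<Rightarrow> (nat \<Rightarrow> 'r) \<Rightarrow> nat \<Rightarrow> (nat \<Rightarrow> nat \<Rightarrow> nat) \<Rightarrow> (node \<Rightarrow> nat) \<Rightarrow> (node \<Rightarrow> nat) \<Rightarrow> word \<Rightarrow>\<^sub>0 'r::comm_ring_1" where
  "murphy_free l u n lam s t = word_free (rev (perm_word n (tab_perm l n lam s))) *
     (\<Sum>w\<in>young_subgroup l n lam. word_free (perm_word n w)) *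
     prod_list [L_free i - const (u j). j \<leftarrow> [2..<Suc l], i \<leftarrow> [1..<Suc (partial_size lam j)]] *
     word_free (perm_word n (tab_perm l n lam t))"

definition jm_bounds :: "nat \<Rightarrow> (nat \<Rightarrow> nat \<Rightarrow> nat) \<Rightarrow> (nat \<times> nat) list" where
  "jm_bounds l lam = map (\<lambda>j. (partial_size lam j, j)) [2..<Suc l]"

context
  fixes l k :: nat and u :: "nat \<Rightarrow> 'r::comm_ring_1"
  assumes l: "1 \<le> l"
begin

interpretation H: hecke_relations "\<lambda>i. gen_at l u k (SGen i)" "\<lambda>i. gen_at l u k (LGen i)"
    "\<lambda>j. const_hprod (u j)" l k
  by (rule hprod_relations[OF l])

lemma eval_word: "hprod.eval_free l u k (word_free is) = H.wordS is"
  by (simp add: word_free_def H.wordS_def hprod.eval_prod_list o_def hprod.eval_s)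

text \<open>Transfers \<open>wordS_unique\<close> from the product ring to the factor
  \<open>hecke l u k\<close>; this resolves the definite description in
  \<open>perm_elem\<close>.\<close>

lemma proj_word_unique:
  assumes "set is \<subseteq> {1..<k}" "set js \<subseteq> {1..<k}" "word_perm is = word_perm js"
  shows "proj l u k (word_free is) = proj l u k (word_free js)"
  using component_eval[OF word_free_closed[OF assms(1)], of l u]
    component_eval[OF word_free_closed[OF assms(2)], of l u]
    H.wordS_unique[OF order_refl assms] by (simp add: eval_word)

lemma perm_elem_eq:
  assumes "w permutes {1..k}"
  shows "perm_elem l u k w = proj l u k (word_free (perm_word k w))"
  unfolding perm_elem_def
proof (rule the_equality)
  have S: "{i. 1 \<le> i \<and> i < k} = {1..<k}" by auto
  show "\<exists>is. set is \<subseteq> {i. 1 \<le> i \<and> i < k} \<and> word_perm is = w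
      \<and> proj l u k (word_free (perm_word k w)) = list_mult (hecke l u k) (map (hs l u k) is)"
    using perm_word[OF assms] proj_word[of "perm_word k w" k l u] unfolding S by metis
  fix A assume "\<exists>is. set is \<subseteq> {i. 1 \<le> i \<and> i < k} \<and> word_perm is = w
      \<and> A = list_mult (hecke l u k) (map (hs l u k) is)"
  then obtain "is" where "set is \<subseteq> {1..<k}" "word_perm is = w"
      "A = list_mult (hecke l u k) (map (hs l u k) is)"
    unfolding S by blast
  then show "A = proj l u k (word_free (perm_word k w))"
    using perm_word[OF assms] proj_word_unique[of "is" "perm_word k w"] proj_word[of "is" k l u] by simp
qed

lemma murphy_eq:
  assumes lam: "multicomposition l k lam"
    and s: "bij_betw s (diagram l lam) {1..k}" and t: "bij_betw t (diagram l lam) {1..k}"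
  shows "murphy l u k lam s t = proj l u k (murphy_free l u k lam s t)"
    and "murphy_free l u k lam s t \<in> carrier (free_alg k)"
proof -
  interpret R: ring "hecke l u k" by (rule ring_hecke)
  let ?Y = "young_subgroup l k lam"
  let ?x = "\<Sum>w\<in>?Y. word_free (perm_word k w) :: word \<Rightarrow>\<^sub>0 'r"
  let ?us = "[L_free i - const (u j). j \<leftarrow> [2..<Suc l], i \<leftarrow> [1..<Suc (partial_size lam j)]]"
  note ps = tab_perm(1)[OF lam s] and pt = tab_perm(1)[OF lam t]
  have Y: "w permutes {1..k}" if "w \<in> ?Y" for w
    using that by (simp add: young_subgroup_def)
  have closed_s: "(word_free (rev (perm_word k (tab_perm l k lam s))) :: word \<Rightarrow>\<^sub>0 'r) \<in> carrier (free_alg k)"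
    using perm_word(1)[OF ps] by (intro word_free_closed) simp
  have closed_t: "(word_free (perm_word k (tab_perm l k lam t)) :: word \<Rightarrow>\<^sub>0 'r) \<in> carrier (free_alg k)"
    using perm_word(1)[OF pt] by (intro word_free_closed)
  have closed_Y: "(word_free (perm_word k w) :: word \<Rightarrow>\<^sub>0 'r) \<in> carrier (free_alg k)" if "w \<in> ?Y" for w
    using perm_word(1)[OF Y[OF that]] by (rule word_free_closed)
  have closed_x: "?x \<in> carrier (free_alg k)" by (rule free_alg_sum_closed[OF closed_Y])
  have L: "(L_free i :: word \<Rightarrow>\<^sub>0 'r) \<in> carrier (free_alg k)"
    if "j \<in> set [2..<Suc l]" "i \<in> set [1..<Suc (partial_size lam j)]" for i j
    using that partial_size_le[OF lam, of j] by (intro free_alg_closed(9)) auto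
  have closed_us: "x \<in> carrier (free_alg k)" if "x \<in> set ?us" for x
    using that L by (auto simp del: upt_Suc)
  have closed_u: "prod_list ?us \<in> carrier (free_alg k)" by (rule free_alg_prod_list_closed[OF closed_us])
  have x: "x_elem l u k lam = proj l u k ?x"
  proof -
    have "proj l u k ?x = (\<Oplus>\<^bsub>hecke l u k\<^esub>w\<in>?Y. proj l u k (word_free (perm_word k w)))"
      by (rule proj_sum[OF closed_Y])
    also have "\<dots> = x_elem l u k lam"
      unfolding x_elem_def
      by (rule R.finsum_cong') (simp_all add: Pi_iff perm_elem_eq[OF Y] closed_Y)
    finally show ?thesis by (rule sym)
  qed
  have u: "u_plus l u k lam = proj l u k (prod_list ?us)"
  proof -
    have map: "map (proj l u k) ?us = [hL l u k i \<ominus>\<^bsub>hecke l u k\<^esub> proj l u k (const (u j)).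
        j \<leftarrow> [2..<Suc l], i \<leftarrow> [1..<Suc (partial_size lam j)]]"
      unfolding map_concat map_map o_def
      by (intro arg_cong[of _ _ concat] map_cong refl) (simp only: proj_diff[OF L free_alg_closed(7)] hL_def)
    have "proj l u k (prod_list ?us) = list_mult (hecke l u k) (map (proj l u k) ?us)"
      by (rule proj_prod_list[OF closed_us])
    then show ?thesis unfolding u_plus_def map by (rule sym)
  qed
  show "murphy l u k lam s t = proj l u k (murphy_free l u k lam s t)"
    unfolding murphy_def m_shape_def x u perm_elem_eq[OF ps] perm_elem_eq[OF pt] star_word murphy_free_def
    using closed_s closed_t closed_x closed_u by (simp only: proj_mult[symmetric] free_alg_closed(5) mult.assoc)
  show "murphy_free l u k lam s t \<in> carrier (free_alg k)"
    unfolding murphy_free_def using closed_s closed_t closed_x closed_u by (intro free_alg_closed(5))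
qed

end

context
  fixes l k :: nat and u :: "nat \<Rightarrow> 'r::comm_ring_1"
  assumes l: "1 \<le> l"
begin

interpretation H: hecke_relations "\<lambda>i. gen_at l u k (SGen i)" "\<lambda>i. gen_at l u k (LGen i)"
    "\<lambda>j. const_hprod (u j)" l k
  by (rule hprod_relations[OF l])

lemma Sub_eval:
  assumes "a \<in> H.Sub"
  shows "\<exists>y \<in> carrier (free_alg (k - 1)). a = hprod.eval_free l u k y"
  using assms
proof induction
  case Sub_1
  then show ?case by (intro bexI[of _ 1]) simp_all
next
  case (Sub_q j)
  then show ?case by (intro bexI[of _ "const (u j)"]) (simp_all add: hprod.eval_const)
next
  case (Sub_S i)
  then show ?case by (intro bexI[of _ "s_free i"]) (simp_all add: hprod.eval_s)
next
  case (Sub_L i)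
  then show ?case by (intro bexI[of _ "L_free i"]) (simp_all add: hprod.eval_L)
next
  case (Sub_add a b)
  then show ?case by (metis hprod.eval_add free_alg_closed(3))
next
  case (Sub_diff a b)
  then show ?case by (metis hprod.eval_diff free_alg_closed(4))
next
  case (Sub_mult a b)
  then show ?case by (metis hprod.eval_mult free_alg_closed(5))
qed

lemma HsH_carrier: "1 \<le> k \<Longrightarrow> HsH l u k \<subseteq> carrier (hecke l u k)"
proof
  fix h assume "1 \<le> k" "h \<in> HsH l u k"
  then obtain x where "x \<in> carrier (free_alg k)" "h = proj l u k x"
    using HsH_coeff[of h l u k "\<lambda>_. 0 :: int"] by auto
  then show "h \<in> carrier (hecke l u k)" by simp
qed

text \<open>The coefficients are lifted to the free algebra on the generators of H_{k-1}, and the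
  family is padded with zeros from d up to l - 1 so that it has the shape used in
  \<open>p_coeff\<close>.\<close>

lemma V_decompose:
  assumes k: "1 \<le> k" and "x \<in> H.V d" "d \<le> l"
  shows "\<exists>h' y. h' \<in> HsH l u k \<and> (\<forall>i. y i \<in> carrier (free_alg (k - 1))) \<and> (\<forall>i\<ge>d. y i = 0)
    \<and> component x (l, u, k) = h' \<oplus>\<^bsub>hecke l u k\<^esub> proj l u k (\<Sum>i<l. y i * L_free k ^ i)"
proof -
  interpret R: ring "hecke l u k" by (rule ring_hecke)
  have HsH_0: "\<zero>\<^bsub>hecke l u k\<^esub> \<in> HsH l u k"
    using generate.one[of "add_monoid (hecke l u k)"] by (simp add: HsH_def)
  show ?thesis using assms(2)
  proof induction
    case V_0
    then show ?case
      by (intro exI[of _ "\<zero>\<^bsub>hecke l u k\<^esub>"] exI[of _ "\<lambda>_. 0"]) (simp add: HsH_0 proj_0 component_simps)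
  next
    case (V_HsH a b)
    then obtain y z where y: "y \<in> carrier (free_alg (k - 1))" "a = hprod.eval_free l u k y"
      and z: "z \<in> carrier (free_alg (k - 1))" "b = hprod.eval_free l u k z"
      using Sub_eval by metis
    have yk: "y \<in> carrier (free_alg k)" "z \<in> carrier (free_alg k)"
      using y z free_alg_mono[of _ "k - 1" k] by auto
    have s: "(s_free (k - 1) :: word \<Rightarrow>\<^sub>0 'r) \<in> carrier (free_alg k)" using V_HsH by simp
    define h where "h = incl l u k (proj l u (k - 1) y) \<otimes>\<^bsub>hecke l u k\<^esub> hs l u k (k - 1)
        \<otimes>\<^bsub>hecke l u k\<^esub> incl l u k (proj l u (k - 1) z)"
    have "h \<in> HsH l u k"
      unfolding HsH_def h_def
      by (intro generate.incl CollectI exI[of _ "proj l u (k - 1) y"] exI[of _ "proj l u (k - 1) z"]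
          conjI refl proj_closed V_HsH(1) y(1) z(1))
    moreover have "component (a * gen_at l u k (SGen (k - 1)) * b) (l, u, k) = h"
      unfolding h_def incl_proj[OF y(1)] incl_proj[OF z(1)] hs_def
      using yk s by (simp add: component_simps y(2) z(2) component_eval flip: hprod.eval_s)
    moreover have "h \<in> carrier (hecke l u k)"
      unfolding calculation(2)[symmetric] by simp
    ultimately show ?case
      by (intro exI[of _ h] exI[of _ "\<lambda>_. 0"]) (simp add: proj_0)
  next
    case (V_power a j)
    then obtain y where y: "y \<in> carrier (free_alg (k - 1))" "a = hprod.eval_free l u k y"
      using Sub_eval by metis
    have yk: "y \<in> carrier (free_alg k)" using y free_alg_mono[of _ "k - 1" k] by auto
    have L: "(L_free k :: word \<Rightarrow>\<^sub>0 'r) \<in> carrier (free_alg k)" using k by simp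
    have "(\<Sum>i<l. (if i = j then y else 0) * L_free k ^ i) = (\<Sum>i<l. if i = j then y * L_free k ^ j else 0)"
      by (rule sum.cong) auto
    also have "\<dots> = y * L_free k ^ j" using V_power assms(3) by simp
    finally have sum: "(\<Sum>i<l. (if i = j then y else 0) * L_free k ^ i) = y * L_free k ^ j" .
    have "component (a * gen_at l u k (LGen k) ^ j) (l, u, k) = proj l u k (y * L_free k ^ j)"
      using component_eval[of "y * L_free k ^ j" k l u] yk L
      by (simp add: y(2) hprod.eval_mult hprod.eval_power hprod.eval_L)
    then show ?case using V_power y yk L
      by (intro exI[of _ "\<zero>\<^bsub>hecke l u k\<^esub>"] exI[of _ "\<lambda>i. if i = j then y else 0"]) (simp add: HsH_0 sum)
  next
    case (V_add x x')
    from V_add.IH(1) obtain h y where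
      h: "h \<in> HsH l u k" "\<forall>i. y i \<in> carrier (free_alg (k - 1))" "\<forall>i\<ge>d. y i = 0"
        "component x (l, u, k) = h \<oplus>\<^bsub>hecke l u k\<^esub> proj l u k (\<Sum>i<l. y i * L_free k ^ i)"
      by blast
    from V_add.IH(2) obtain h' y' where
      h': "h' \<in> HsH l u k" "\<forall>i. y' i \<in> carrier (free_alg (k - 1))" "\<forall>i\<ge>d. y' i = 0"
        "component x' (l, u, k) = h' \<oplus>\<^bsub>hecke l u k\<^esub> proj l u k (\<Sum>i<l. y' i * L_free k ^ i)"
      by blast
    have L: "(L_free k :: word \<Rightarrow>\<^sub>0 'r) \<in> carrier (free_alg k)" using k by simp
    have closed: "(\<Sum>i<l. f i * L_free k ^ i) \<in> carrier (free_alg k)"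
      if "\<And>i. f i \<in> carrier (free_alg (k - 1))" for f :: "nat \<Rightarrow> word \<Rightarrow>\<^sub>0 'r"
      using free_alg_mono[OF that, of k] L
      by (intro free_alg_sum_closed free_alg_closed(5) free_alg_power_closed) auto
    have HsH_closed: "HsH l u k \<subseteq> carrier (hecke l u k)"
      using HsH_carrier[OF k] .
    have "(\<Sum>i<l. (y i + y' i) * L_free k ^ i) = (\<Sum>i<l. y i * L_free k ^ i) + (\<Sum>i<l. y' i * L_free k ^ i)"
      by (simp add: distrib_right sum.distrib)
    moreover have "h \<in> carrier (hecke l u k)" "h' \<in> carrier (hecke l u k)"
      using h(1) h'(1) HsH_closed by auto
    moreover note closed[of y] closed[of y']
    ultimately have "component (x + x') (l, u, k)
        = (h \<oplus>\<^bsub>hecke l u k\<^esub> h') \<oplus>\<^bsub>hecke l u k\<^esub> proj l u k (\<Sum>i<l. (y i + y' i) * L_free k ^ i)"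
      using h(2) h'(2) unfolding component_simps h(4) h'(4) by (simp only: proj_add R.a_ac R.a_closed proj_closed)
    moreover have "h \<oplus>\<^bsub>hecke l u k\<^esub> h' \<in> HsH l u k"
      using generate.eng[of h "add_monoid (hecke l u k)" _ h'] h(1) h'(1) by (simp add: HsH_def)
    ultimately show ?case using h h'
      by (intro exI[of _ "h \<oplus>\<^bsub>hecke l u k\<^esub> h'"] exI[of _ "\<lambda>i. y i + y' i"]) auto
  qed
qed

lemma descend_component:
  assumes k: "1 \<le> k" and y0: "y0 \<in> carrier (free_alg (k - 1))"
    and x: "x - hprod.eval_free l u k y0 * gen_at l u k (LGen k) ^ (l - 1) \<in> H.V (l - 1)"
  shows "descend l u k (component x (l, u, k)) = proj l u (k - 1) y0"
proof -
  interpret R: ring "hecke l u k" by (rule ring_hecke)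
  let ?m = "y0 * L_free k ^ (l - 1)"
  obtain h y where h: "h \<in> HsH l u k" and y: "\<And>i. y i \<in> carrier (free_alg (k - 1))" "\<And>i. l - 1 \<le> i \<Longrightarrow> y i = 0"
    and eq: "component (x - hprod.eval_free l u k y0 * gen_at l u k (LGen k) ^ (l - 1)) (l, u, k)
       = h \<oplus>\<^bsub>hecke l u k\<^esub> proj l u k (\<Sum>i<l. y i * L_free k ^ i)"
    using V_decompose[OF k x] by auto
  \<comment> \<open>The decomposition of the remainder has degrees below l - 1, so the slot l - 1 is
    free for the leading coefficient.\<close>
  define y' where "y' = y(l - 1 := y0)"
  have L: "(L_free k :: word \<Rightarrow>\<^sub>0 'r) \<in> carrier (free_alg k)" using k by simp
  have y'c: "y' i \<in> carrier (free_alg (k - 1))" for i using y y0 by (simp add: y'_def)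
  have up: "z \<in> carrier (free_alg k)" if "z \<in> carrier (free_alg (k - 1))" for z :: "word \<Rightarrow>\<^sub>0 'r"
    using free_alg_mono[OF that, of k] by simp
  have mon: "z * L_free k ^ i \<in> carrier (free_alg k)" if "z \<in> carrier (free_alg (k - 1))"
    for z :: "word \<Rightarrow>\<^sub>0 'r" and i
    using up[OF that] L by simp
  have closed: "(\<Sum>i<l. f i * L_free k ^ i) \<in> carrier (free_alg k)"
    if "\<And>i. f i \<in> carrier (free_alg (k - 1))" for f :: "nat \<Rightarrow> word \<Rightarrow>\<^sub>0 'r"
    by (rule free_alg_sum_closed[OF mon[OF that]])
  have "{..<l} = insert (l - 1) {..<l - 1}" using l by auto
  then have sum: "(\<Sum>i<l. y i * L_free k ^ i) + ?m = (\<Sum>i<l. y' i * L_free k ^ i)"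
    using y(2)[of "l - 1"] by (simp add: y'_def add.commute)
  have hc: "h \<in> carrier (hecke l u k)" using h HsH_carrier[OF k] by blast
  have m: "component (hprod.eval_free l u k y0 * gen_at l u k (LGen k) ^ (l - 1)) (l, u, k) = proj l u k ?m"
    using component_eval[OF mon[OF y0], of l u "l - 1"]
    by (simp add: hprod.eval_mult hprod.eval_power hprod.eval_L)
  have "component x (l, u, k) = component (x - hprod.eval_free l u k y0 * gen_at l u k (LGen k) ^ (l - 1)) (l, u, k)
      \<oplus>\<^bsub>hecke l u k\<^esub> proj l u k ?m"
    unfolding m[symmetric] component_simps(3)[symmetric] by simp
  also have "\<dots> = h \<oplus>\<^bsub>hecke l u k\<^esub> proj l u k ((\<Sum>i<l. y i * L_free k ^ i) + ?m)"
    unfolding eq using hc closed[OF y(1)] mon[OF y0] by (simp add: proj_add R.a_assoc)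
  also have "proj l u k ((\<Sum>i<l. y i * L_free k ^ i) + ?m) = (\<Oplus>\<^bsub>hecke l u k\<^esub>i \<in> {..<l}. proj l u k (y' i * L_free k ^ i))"
    unfolding sum by (rule proj_sum[OF mon[OF y'c]])
  also have "\<dots> = (\<Oplus>\<^bsub>hecke l u k\<^esub>i \<in> {..<l}.
              incl l u k (proj l u (k - 1) (y' i)) \<otimes>\<^bsub>hecke l u k\<^esub> hL l u k k [^]\<^bsub>hecke l u k\<^esub> i)"
    unfolding incl_proj[OF y'c] hL_def using up[OF y'c] L
    by (intro R.finsum_cong') (auto simp: proj_mult proj_power)
  finally have "descend l u k (component x (l, u, k)) = proj l u (k - 1) (y' (l - 1))"
    by (intro descend_eqI[OF l k h, where p = "\<lambda>i. proj l u (k - 1) (y' i)"] proj_closed[OF y'c])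
  then show ?thesis by (simp add: y'_def)
qed

lemma eval_murphy:
  "hprod.eval_free l u k (murphy_free l u n lam s t) = H.wordS (rev (perm_word n (tab_perm l n lam s)))
     * (\<Sum>w\<in>young_subgroup l n lam. H.wordS (perm_word n w)) * H.UP (jm_bounds l lam)
     * H.wordS (perm_word n (tab_perm l n lam t))"
proof -
  have "prod_list (concat xss) = prod_list (map prod_list xss)" for xss :: "'r hprod list list"
    by (induction xss) auto
  then show ?thesis
    by (simp add: murphy_free_def hprod.eval_mult hprod.eval_sum hprod.eval_prod_list eval_word[OF l] H.UP_def
        H.U_def jm_bounds_def map_concat o_def hprod.eval_diff hprod.eval_L hprod.eval_const del: upt_Suc)
qed

lemma word_perm_rev: "word_perm (rev is) (word_perm is x) = x"
  by (induction "is" arbitrary: x) (simp_all add: word_perm_append)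

theorem descend_murphy:
  assumes k: "1 \<le> k" and lam: "multicomposition l k lam" and s: "s \<in> Std l k lam" and t: "t \<in> Std l k lam"
  shows "descend l u k (murphy l u k lam s t) =
    (if n_of l k lam s = n_of l k lam t \<and> comp_of l lam t k = 1
     then murphy l u (k - 1) (sub_shape l lam t (k - 1))
            (sub_tab l lam s (k - 1)) (sub_tab l lam t (k - 1))
     else \<zero>\<^bsub>hecke l u (k - 1)\<^esub>)"
proof -
  interpret s: removal l k lam s by unfold_locales fact+
  interpret t: removal l k lam t by unfold_locales fact+
  let ?ps = "jm_bounds l lam" and ?Y = "young_subgroup l k lam"
  define ds where "ds = rev (perm_word k (tab_perm l k lam s))"
  define dt where "dt = perm_word (k - 1) (tab_perm l (k - 1) t.mu t.t')"
  have len: "length ?ps = l - 1" by (simp add: jm_bounds_def del: upt_Suc)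
  have ps: "a \<le> k" if "(a, j) \<in> set ?ps" for a j
    using that partial_size_le[OF lam, of j] by (auto simp: jm_bounds_def simp del: upt_Suc)
  note perm_s = tab_perm(1)[OF lam s.tb] and perm_t = tab_perm(1)[OF lam t.tb]
  note perm_t' = tab_perm(1)[OF t.mu t.t'_bij]
  have ds: "set ds \<subseteq> {1..<k}" using perm_word(1)[OF perm_s] by (simp add: ds_def)
  have sub: "{1..<k - 1} \<subseteq> {1..<k}" by auto
  have dt: "set dt \<subseteq> {1..<k - 1}" unfolding dt_def by (rule perm_word(1)[OF perm_t'])
  have Y: "w permutes {1..k}" if "w \<in> ?Y" for w using that by (simp add: young_subgroup_def)
  have finY: "finite ?Y"
    by (rule finite_subset[OF _ finite_permutations[of "{1..k}"]]) (use Y in blast, simp)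
  have pw: "set (perm_word k w) \<subseteq> {1..<k}" if "w \<in> ?Y" for w by (rule perm_word(1)[OF Y[OF that]])
  \<comment> \<open>The chosen word of d(t) is exchanged for one that exhibits the cycle, using d(t)
    = z d(t') and independence of the word.\<close>
  have word_t: "H.wordS (perm_word k (tab_perm l k lam t)) = H.wordS [t.m..<k] * H.wordS dt"
  proof -
    have "word_perm ([t.m..<k] @ dt) = word_perm (perm_word k (tab_perm l k lam t))"
      unfolding word_perm_append word_perm_upt[OF t.m(3)] dt_def perm_word(2)[OF perm_t] perm_word(2)[OF perm_t']
      by (rule t.tab_perm_removal[symmetric])
    moreover have "set ([t.m..<k] @ dt) \<subseteq> {1..<k}" using t.m subset_trans[OF dt sub] by auto
    ultimately have "H.wordS ([t.m..<k] @ dt) = H.wordS (perm_word k (tab_perm l k lam t))"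
      using perm_word(1)[OF perm_t] by (intro H.wordS_unique[OF order_refl])
    then show ?thesis by simp
  qed
  define M where "M = hprod.eval_free l u k (murphy_free l u k lam s t)"
  have M: "M = H.wordS ds * (\<Sum>w\<in>?Y. H.wordS (perm_word k w)) * H.UP ?ps * (H.wordS [t.m..<k] * H.wordS dt)"
    unfolding M_def eval_murphy ds_def word_t by simp
  have descend: "descend l u k (murphy l u k lam s t) = proj l u (k - 1) y0"
    if "y0 \<in> carrier (free_alg (k - 1))" "M - hprod.eval_free l u k y0 * gen_at l u k (LGen k) ^ (l - 1) \<in> H.V (l - 1)"
    for y0
    unfolding murphy_eq(1)[OF l lam s.tb t.tb]
    using descend_component[OF k that] component_eval[OF murphy_eq(2)[OF l lam s.tb t.tb], of l u]
    by (simp add: M_def)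
  have zero: "descend l u k (murphy l u k lam s t) = \<zero>\<^bsub>hecke l u (k - 1)\<^esub>" if "M \<in> H.V (l - 1)"
    using descend[of 0] that by (simp add: proj_0)
  \<comment> \<open>As z sends exactly t.m to k, the word for d(s)^{-1} w z fixes k if and only if w
    sends s.m to t.m.\<close>
  have ds_k: "word_perm ds k = s.m"
  proof -
    have "word_perm (perm_word k (tab_perm l k lam s)) s.m = k"
      using tab_perm(2)[OF lam s.tb s.x0(1)] s.x0(2) perm_word(2)[OF perm_s] by (simp add: s.m_def)
    then show ?thesis using word_perm_rev[of "perm_word k (tab_perm l k lam s)" s.m] by (simp add: ds_def)
  qed
  show ?thesis
  proof (cases "t.j0 = 1")
    case False
    then have "2 \<le> l" using t.x0_bounds by simp
    \<comment> \<open>The pair with s = 2 is a witness for a factor that costs no degree: if n lies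
      outside the first component, then m exceeds the size of that component.\<close>
    then have mem: "(partial_size lam 2, 2) \<in> set ?ps" by (auto simp: jm_bounds_def simp del: upt_Suc)
    have "M \<in> H.V (length ?ps)"
      unfolding M by (rule H.murphy_lower[OF t.m(2,3) ps mem t.partial_size_less[OF False] ds pw dt])
    then show ?thesis using zero False by (simp add: len t.comp_of)
  next
    case True
    define Y' where "Y' = {w \<in> ?Y. word_perm (ds @ perm_word k w @ [t.m..<k]) k = k}"
    have Y': "Y' = {w \<in> ?Y. w s.m = t.m}"
      using t.m by (auto simp: Y'_def word_perm_append word_perm_upt ds_k perm_word(2)[OF Y] t.zperm_eq_iff)
    have bounds: "t.m \<le> a \<and> a \<le> k" if "(a, j) \<in> set ?ps" for a j
      using ps[OF that] that t.partial_size_ge[OF True, of j] by (auto simp: jm_bounds_def simp del: upt_Suc)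
    have lead: "M - (\<Sum>w\<in>Y'. H.wordS (ds @ perm_word k w @ [t.m..<k])) * H.UP (H.dec ?ps) * H.wordS dt
        * gen_at l u k (LGen k) ^ (l - 1) \<in> H.V (l - 1)"
      unfolding M Y'_def len[symmetric]
      by (rule H.murphy_lead[OF t.m(2,3) _ ds finY _ dt]) (erule bounds, erule pw)
    show ?thesis
    proof (cases "s.m = t.m")
      case False
      have "Y' = {}"
      proof (rule ccontr)
        assume "Y' \<noteq> {}"
        then obtain w where "w \<in> ?Y" "w s.m = t.m" unfolding Y' by blast
        then have "s.x0 = t.x0"
          by (intro young_subgroup_row_end[OF s.removal_axioms t.removal_axioms])
        then show False using False by (simp add: s.m_def t.m_def)
      qed
      then show ?thesis using lead zero False by (simp add: s.n_of t.n_of)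
    next
      case m: True
      have x0: "s.x0 = t.x0"
        using inj_onD[OF initial_tab_inj[OF lam] _ s.x0(1) t.x0(1)] m by (simp add: s.m_def t.m_def)
      have mu: "s.mu = t.mu"
        using x0 s.mu_eq t.mu_eq by (simp add: fun_eq_iff s.r0_def s.j0_def t.r0_def t.j0_def)
      note s'_bij = s.t'_bij[unfolded mu]
      note perm_s' = tab_perm(1)[OF t.mu s'_bij]
      define y0 where "y0 = murphy_free l u (k - 1) t.mu s.t' t.t'"
      \<comment> \<open>With n in the first component, every partial size with index s >= 2 drops by
        one on removal, which is what \<open>H.dec\<close> does.\<close>
      have dec: "H.dec ?ps = jm_bounds l t.mu"
        using True by (auto simp: H.dec_def jm_bounds_def t.partial_size_mu simp del: upt_Suc)
      define ds' where "ds' = rev (perm_word (k - 1) (tab_perm l (k - 1) t.mu s.t'))"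
      let ?z = "zperm t.m k"
      have z: "?z permutes {1..k}" by (rule zperm_permutes[OF t.m(2,3)])
      let ?c = "\<lambda>w. ?z \<circ> w \<circ> inv_into UNIV ?z"
      \<comment> \<open>Since d(s) = z d(s'), with left factors applied first, d(s)^{-1} w z equals
        d(s')^{-1} times the conjugate z^{-1} w z; as a function this conjugate is
        \<open>?c w\<close>.\<close>
      have word: "H.wordS (ds @ perm_word k w @ [t.m..<k]) = H.wordS (ds' @ perm_word (k - 1) (?c w))"
        if w: "w \<in> Y'" for w
      proof (rule H.wordS_unique[OF order_refl])
        have wY: "w \<in> ?Y" "w t.m = t.m" using w m by (auto simp: Y')
        have c: "?c w permutes {1..k - 1}"
          using bij_betwE[OF t.young_fixed] wY by (auto simp: young_subgroup_def)
        show "set (ds @ perm_word k w @ [t.m..<k]) \<subseteq> {1..<k}" using ds pw[OF wY(1)] t.m by auto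
        show "set (ds' @ perm_word (k - 1) (?c w)) \<subseteq> {1..<k}"
          using subset_trans[OF perm_word(1)[OF c] sub] subset_trans[OF perm_word(1)[OF perm_s'] sub]
          by (auto simp: ds'_def)
        have inv: "word_perm ds x = inv_into UNIV ?z (word_perm ds' x)" for x
        proof -
          obtain v where v: "x = tab_perm l k lam s v"
            using permutes_surj[OF perm_s] by (metis surjD)
          have "word_perm ds x = v"
            unfolding v ds_def using word_perm_rev[of "perm_word k (tab_perm l k lam s)" v] perm_word(2)[OF perm_s] by simp
          moreover have "x = tab_perm l (k - 1) t.mu s.t' (?z v)"
            unfolding v s.tab_perm_removal mu m by simp
          then have "word_perm ds' x = ?z v"
            unfolding ds'_def using word_perm_rev[of "perm_word (k - 1) (tab_perm l (k - 1) t.mu s.t')" "?z v"]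
              perm_word(2)[OF perm_s'] by simp
          ultimately show ?thesis using permutes_inverses(2)[OF z] by simp
        qed
        show "word_perm (ds @ perm_word k w @ [t.m..<k]) = word_perm (ds' @ perm_word (k - 1) (?c w))"
          unfolding word_perm_append word_perm_upt[OF t.m(3)] perm_word(2)[OF c] perm_word(2)[OF Y[OF wY(1)]]
          by (simp add: fun_eq_iff inv)
      qed
      have Y'_bij: "bij_betw ?c Y' (young_subgroup l (k - 1) t.mu)"
        using t.young_fixed m unfolding Y' by simp
      have "(\<Sum>w\<in>Y'. H.wordS (ds @ perm_word k w @ [t.m..<k]))
          = (\<Sum>w\<in>Y'. H.wordS (ds' @ perm_word (k - 1) (?c w)))"
        by (rule sum.cong[OF refl word])
      also have "\<dots> = (\<Sum>v\<in>young_subgroup l (k - 1) t.mu. H.wordS (ds' @ perm_word (k - 1) v))"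
        by (rule sum.reindex_bij_betw[OF Y'_bij])
      also have "\<dots> = H.wordS ds' * (\<Sum>v\<in>young_subgroup l (k - 1) t.mu. H.wordS (perm_word (k - 1) v))"
        by (simp add: sum_distrib_left)
      finally have "(\<Sum>w\<in>Y'. H.wordS (ds @ perm_word k w @ [t.m..<k])) * H.UP (H.dec ?ps) * H.wordS dt
          = hprod.eval_free l u k y0"
        unfolding y0_def eval_murphy dec ds'_def dt_def by simp
      then have "descend l u k (murphy l u k lam s t) = proj l u (k - 1) y0"
        using lead murphy_eq(2)[OF l t.mu s'_bij t.t'_bij] by (intro descend) (simp_all add: y0_def)
      also have "\<dots> = murphy l u (k - 1) t.mu s.t' t.t'"
        unfolding y0_def by (rule murphy_eq(1)[OF l t.mu s'_bij t.t'_bij, symmetric])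
      finally show ?thesis
        using m True by (simp add: s.n_of t.n_of t.comp_of t.mu_def s.t'_def t.t'_def)
    qed
  qed
qed

end

theorem proposition4p16:
  fixes u :: "nat \<Rightarrow> 'r::idom" and l n :: nat
    and lam :: "nat \<Rightarrow> nat \<Rightarrow> nat" and s t :: "node \<Rightarrow> nat"
  assumes "1 \<le> l" and "1 \<le> n"
    and "lam \<in> multipartitions l n"
    and "s \<in> Std l n lam" and "t \<in> Std l n lam"
  shows "descend l u n (murphy l u n lam s t) =
    (if n_of l n lam s = n_of l n lam t \<and> comp_of l lam t n = 1
     then murphy l u (n - 1) (sub_shape l lam t (n - 1))
            (sub_tab l lam s (n - 1)) (sub_tab l lam t (n - 1))
     else \<zero>\<^bsub>hecke l u (n - 1)\<^esub>)"
  using descend_murphy[OF assms(1,2) multipartition_composition[OF assms(3)] assms(4,5)] .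

end
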